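(* Let $G$ be Promislow's group and let $k$ be a field of characteristic different from $2$. There exists a non-trivial unit $U\in k[G]$ of type $2$ if and only if the system of equations (a), (b), (c) below has a solution $$(A,C_1,C_2,C_3,C_4,D_1,D_2,D_3,D_4,\alpha,\beta)\in\mathcal{Z}^{11}$$ different from $(\pm1,0,0,0,0,0,0,0,0,0,0)$, such that $A\in k[\kappa_x,\kappa_y,\kappa_z,\xi]$ and $C_i\gamma_i,\ D_i\delta_i\in k[x^{\pm1},y^{\pm1},z^{\pm1}]$ for all $1\le i\le 4$. (a) $(A^2-1)\omega_x^2+C_1^2(\kappa_x+1)(\kappa_y-1)-C_2^2(\kappa_x-1)(\kappa_y+1)+C_3^2(\kappa_x+1)(\kappa_y+1)-C_4^2(\kappa_x-1)(\kappa_y-1)+2D_1^2(\kappa_z-1)-2D_2^2\omega_x^2(\kappa_z+1)+2D_3^2(\kappa_z+1)-2D_4^2\omega_x^2(\kappa_z-1)=0$. (b) $(\kappa_x-1)C_2C_4-(\kappa_x+1)C_1C_3=0$. (c) In case $C_1\neq0$ or $C_4\neq0$: $D_1=\beta(1-\kappa_x)C_4$, $D_2=\alpha C_4$, $D_3=-\alpha(1+\kappa_x)C_1$, $D_4=\beta C_1$. In case $C_2\neq0$ or $C_3\neq0$: $D_1=-\beta(1+\kappa_x)C_3$, $D_2=\alpha C_3$, $D_3=\alpha(1-\kappa_x)C_2$, $D_4=\beta C_2$.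
   Context: Promislow's group is $G=\langle s,t\mid ts^2t^{-1}=s^{-2},\ st^2s^{-1}=t^{-2}\rangle$. Put $u=st$, $x=s^2$, $y=t^2$, $z=u^2$; $N=\langle x,y,z\rangle\cong\mathbb{Z}^3$ is a normal subgroup with $G/N\cong(\mathbb{Z}/2)^2$ and transversal $\{1,s,t,u\}$, and $k[N]=k[x^{\pm1},y^{\pm1},z^{\pm1}]$. $k[G]$ is an Ore domain; $\mathcal{Q}$ is its Ore field of fractions, $\mathcal{Z}$ the center of $\mathcal{Q}$, and $\mathcal{L}=k(x,y,z)\subseteq\mathcal{Q}$. For $g\in\{x,y,z\}$: $\kappa_g=\frac12(g+g^{-1})$, $\omega_g=\frac12(g-g^{-1})$; $\xi=\omega_x\omega_y\omega_z$. Write $\omega=\omega_x$, and $p^q=qpq^{-1}$ for $p,q\in\mathcal{Q}$, $q\neq0$. $\gamma_1=(1+x)(1-y^{-1})$, $\gamma_2=(1-x)(1+y^{-1})$, $\gamma_3=(1+x)(1+y^{-1})$, $\gamma_4=(1-x)(1-y^{-1})$; $\delta_1=1-z^{-1}$, $\delta_2=(x-x^{-1})(1+z^{-1})$, $\delta_3=1+z^{-1}$, $\delta_4=(x-x^{-1})(1-z^{-1})$. A unit of $k[G]$ is an element with a two-sided inverse in $k[G]$; it is non-trivial if it is not of the form $\lambda g$ with $\lambda\in k\setminus\{0\}$, $g\in G$. Every $T\in\mathcal{Q}$ is uniquely $T=a+bs+ct+du$ with $a,b,c,d\in\mathcal{L}$; its $\omega$-decomposition is $T=T_1+T_{-1}$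 with $T_1=a+bs=\frac12(T+T^\omega)$, $T_{-1}=ct+du=\frac12(T-T^\omega)$, and its $\omega$-degree is $\deg_\omega(T)=([\mathcal{Z}(T_1):\mathcal{Z}],[\mathcal{Z}(T_{-1}):\mathcal{Z}])$, where $\mathcal{Z}(D)$ is the subfield of $\mathcal{Q}$ generated by $\mathcal{Z}$ and $D$. A non-trivial unit $U\in k[G]$ is of type $2$ if $\deg_\omega(\omega^U)=(2,2)$.
   Formalization: Condition (c) is read so: the formulas of at least one applicable case hold (not both with common α, β); if all C_i=0, then all D_i=α=β=0 is required, since otherwise (1,0,…,0,α,0) with α≠0 would be a solution over every field. *)

theory Defs
  imports
    "HOL-Library.Poly_Mapping"
    "HOL-Library.Extended_Nat"
    "HOL-Algebra.Generated_Fields"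
    "HOL-Algebra.Embedded_Algebras"
    "HOL-Algebra.Algebraic_Closure_Type"
begin

section \<open>Promislow's group\<close>

datatype prom_gen = GS | GT

text \<open>A letter \<open>(True, g)\<close> is the generator \<open>g\<close>, a letter \<open>(False, g)\<close> its formal inverse.\<close>

type_synonym prom_word = "(bool \<times> prom_gen) list"

text \<open>The least congruence on words generated by free cancellation and the two relators
  \<open>t s\<^sup>2 t\<^sup>-\<^sup>1 = s\<^sup>-\<^sup>2\<close> and \<open>s t\<^sup>2 s\<^sup>-\<^sup>1 = t\<^sup>-\<^sup>2\<close>.\<close>

inductive prom_eq :: "prom_word \<Rightarrow> prom_word \<Rightarrow> bool" where
  refl: "prom_eq v v"
| sym: "prom_eq v w \<Longrightarrow> prom_eq w v"
| trans: "prom_eq v w \<Longrightarrow> prom_eq w w' \<Longrightarrow> prom_eq v w'"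
| append: "prom_eq v w \<Longrightarrow> prom_eq v' w' \<Longrightarrow> prom_eq (v @ v') (w @ w')"
| cancel: "prom_eq [(e, g), (\<not> e, g)] []"
| rel_s: "prom_eq [(True, GT), (True, GS), (True, GS), (False, GT)] [(False, GS), (False, GS)]"
| rel_t: "prom_eq [(True, GS), (True, GT), (True, GT), (False, GS)] [(False, GT), (False, GT)]"

lemma equivp_prom_eq: "equivp prom_eq"
  by (intro equivpI reflpI sympI transpI) (auto intro: prom_eq.intros)

quotient_type promislow = prom_word / prom_eq
  by (rule equivp_prom_eq)

definition prom_inv :: "prom_word \<Rightarrow> prom_word" where
  "prom_inv w = rev (map (\<lambda>(e, g). (\<not> e, g)) w)"

lemma prom_inv_inv: "prom_inv (prom_inv w) = w"
  by (simp add: prom_inv_def rev_map comp_def case_prod_unfold)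

lemma prom_eq_right_inv: "prom_eq (w @ prom_inv w) []"
proof (induction w)
  case Nil
  show ?case by (simp add: prom_inv_def prom_eq.refl)
next
  case (Cons l w)
  obtain e g where l: "l = (e, g)" by (cases l)
  have "prom_eq ([l] @ ((w @ prom_inv w) @ [(\<not> e, g)])) ([l] @ ([] @ [(\<not> e, g)]))"
    by (intro prom_eq.append prom_eq.refl Cons.IH)
  then have "prom_eq ([l] @ ((w @ prom_inv w) @ [(\<not> e, g)])) []"
    using prom_eq.cancel[of e g] l by (auto intro: prom_eq.trans)
  then show ?case by (simp add: prom_inv_def l)
qed

lemma prom_eq_left_inv: "prom_eq (prom_inv w @ w) []"
  using prom_eq_right_inv[of "prom_inv w"] by (simp add: prom_inv_inv)

lemma prom_eq_inv:
  assumes "prom_eq v w"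
  shows "prom_eq (prom_inv v) (prom_inv w)"
proof -
  have "prom_eq (prom_inv v @ (w @ prom_inv w)) (prom_inv v @ [])"
    by (intro prom_eq.append prom_eq.refl prom_eq_right_inv)
  then have 1: "prom_eq (prom_inv v) (prom_inv v @ (w @ prom_inv w))"
    by (auto intro: prom_eq.sym)
  have 2: "prom_eq (prom_inv v @ (w @ prom_inv w)) (prom_inv v @ (v @ prom_inv w))"
    by (intro prom_eq.append prom_eq.refl prom_eq.sym[OF assms])
  have "prom_eq ((prom_inv v @ v) @ prom_inv w) ([] @ prom_inv w)"
    by (intro prom_eq.append prom_eq.refl prom_eq_left_inv)
  then have 3: "prom_eq (prom_inv v @ (v @ prom_inv w)) (prom_inv w)"
    by simp
  show ?thesis
    using 1 2 3 by (blast intro: prom_eq.trans)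
qed

text \<open>The group law is written additively, although the group is not commutative: the type
  \<open>'g \<Rightarrow>\<^sub>0 'k\<close> carries the convolution product for \<open>'g\<close> of class \<open>monoid_add\<close>,
  so that \<open>promislow \<Rightarrow>\<^sub>0 'k\<close> is the group ring \<open>k[G]\<close>.\<close>

instantiation promislow :: group_add
begin

lift_definition zero_promislow :: promislow is "[]" .

lift_definition plus_promislow :: "promislow \<Rightarrow> promislow \<Rightarrow> promislow" is "(@)"
  by (rule prom_eq.append)

lift_definition uminus_promislow :: "promislow \<Rightarrow> promislow" is prom_inv
  by (rule prom_eq_inv)

definition minus_promislow :: "promislow \<Rightarrow> promislow \<Rightarrow> promislow" where
  "minus_promislow g h = g + (- h)"

instance
proof
  fix a b c :: promislow
  show "a + b + c = a + (b + c)" by transfer (simp add: prom_eq.refl)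
  show "0 + a = a" by transfer (simp add: prom_eq.refl)
  show "a + 0 = a" by transfer (simp add: prom_eq.refl)
  show "- a + a = 0" by transfer (rule prom_eq_left_inv)
  show "a + - b = a - b" by (simp add: minus_promislow_def)
qed

end

lift_definition gs :: promislow is "[(True, GS)]" .
lift_definition gt :: promislow is "[(True, GT)]" .

definition gu :: promislow where "gu = gs + gt"
definition gx :: promislow where "gx = gs + gs"
definition gy :: promislow where "gy = gt + gt"
definition gz :: promislow where "gz = gu + gu"

type_synonym 'k prom_ring = "promislow \<Rightarrow>\<^sub>0 'k"

definition nontrivial_unit :: "'k::field prom_ring \<Rightarrow> bool" where
  "nontrivial_unit U \<longleftrightarrow>
     (\<exists>V. U * V = 1 \<and> V * U = 1) \<and>
     \<not> (\<exists>c g. c \<noteq> 0 \<and> U = Poly_Mapping.single g c)"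


section \<open>The Ore field of fractions\<close>

text \<open>\<open>ore_fraction_field \<phi>\<close>: the embedding \<open>\<phi>\<close> exhibits the division ring \<open>'q\<close> as the (two-sided)
  Ore field of fractions of \<open>'a\<close>. This determines \<open>'q\<close> up to unique isomorphism over \<open>'a\<close>.\<close>

definition ore_fraction_field :: "('a::ring_1 \<Rightarrow> 'q::division_ring) \<Rightarrow> bool" where
  "ore_fraction_field \<phi> \<longleftrightarrow>
     \<phi> 1 = 1 \<and> (\<forall>a b. \<phi> (a + b) = \<phi> a + \<phi> b) \<and> (\<forall>a b. \<phi> (a * b) = \<phi> a * \<phi> b) \<and> inj \<phi> \<and>
     (\<forall>q. \<exists>a b. b \<noteq> 0 \<and> q = \<phi> a * inverse (\<phi> b)) \<and>
     (\<forall>q. \<exists>a b. b \<noteq> 0 \<and> q = inverse (\<phi> b) * \<phi> a)"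

definition skew_center :: "'q::division_ring set" where
  "skew_center = {c. \<forall>q. c * q = q * c}"

definition conj_by :: "'q::division_ring \<Rightarrow> 'q \<Rightarrow> 'q" where
  "conj_by p q = q * p * inverse q"

text \<open>The degree of an extension \<open>K \<subseteq> E\<close> inside \<open>'q\<close>, as a \<open>K\<close>-dimension.\<close>

definition ext_degree :: "'q::division_ring set \<Rightarrow> 'q set \<Rightarrow> enat" where
  "ext_degree K E =
     (if \<exists>n. ring.dimension ring_of_type_algebra n K E
      then enat (THE n. ring.dimension ring_of_type_algebra n K E) else \<infinity>)"

definition center_adjoin :: "'q::division_ring \<Rightarrow> 'q set" where
  "center_adjoin D = generate_field ring_of_type_algebra (insert D skew_center)"

context
  fixes \<phi> :: "'k::field prom_ring \<Rightarrow> 'q::division_ring"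
begin

definition grp :: "promislow \<Rightarrow> 'q" where
  "grp g = \<phi> (Poly_Mapping.single g 1)"

definition scalars :: "'q set" where
  "scalars = range (\<lambda>c. \<phi> (Poly_Mapping.single 0 c))"

definition kap :: "promislow \<Rightarrow> 'q" where
  "kap g = (grp g + inverse (grp g)) / 2"

definition omg :: "promislow \<Rightarrow> 'q" where
  "omg g = (grp g - inverse (grp g)) / 2"

definition xi :: 'q where
  "xi = omg gx * omg gy * omg gz"

definition laurent_ring :: "'q set" where
  "laurent_ring = generate_ring ring_of_type_algebra
     (scalars \<union> {grp gx, inverse (grp gx), grp gy, inverse (grp gy), grp gz, inverse (grp gz)})"

definition kappa_xi_ring :: "'q set" where
  "kappa_xi_ring = generate_ring ring_of_type_algebra (scalars \<union> {kap gx, kap gy, kap gz, xi})"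

definition omega_pos :: "'q \<Rightarrow> 'q" where
  "omega_pos T = (T + conj_by T (omg gx)) / 2"

definition omega_neg :: "'q \<Rightarrow> 'q" where
  "omega_neg T = (T - conj_by T (omg gx)) / 2"

definition omega_degree :: "'q \<Rightarrow> enat \<times> enat" where
  "omega_degree T =
     (ext_degree skew_center (center_adjoin (omega_pos T)),
      ext_degree skew_center (center_adjoin (omega_neg T)))"

definition type2 :: "'k prom_ring \<Rightarrow> bool" where
  "type2 U \<longleftrightarrow> omega_degree (conj_by (omg gx) (\<phi> U)) = (2, 2)"


section \<open>The system of equations\<close>

definition gamma1 :: 'q where "gamma1 = (1 + grp gx) * (1 - inverse (grp gy))"
definition gamma2 :: 'q where "gamma2 = (1 - grp gx) * (1 + inverse (grp gy))"
definition gamma3 :: 'q where "gamma3 = (1 + grp gx) * (1 + inverse (grp gy))"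
definition gamma4 :: 'q where "gamma4 = (1 - grp gx) * (1 - inverse (grp gy))"

definition delta1 :: 'q where "delta1 = 1 - inverse (grp gz)"
definition delta2 :: 'q where "delta2 = (grp gx - inverse (grp gx)) * (1 + inverse (grp gz))"
definition delta3 :: 'q where "delta3 = 1 + inverse (grp gz)"
definition delta4 :: 'q where "delta4 = (grp gx - inverse (grp gx)) * (1 - inverse (grp gz))"

definition eq_a :: "'q \<Rightarrow> 'q \<Rightarrow> 'q \<Rightarrow> 'q \<Rightarrow> 'q \<Rightarrow> 'q \<Rightarrow> 'q \<Rightarrow> 'q \<Rightarrow> 'q \<Rightarrow> bool" where
  "eq_a A C1 C2 C3 C4 D1 D2 D3 D4 \<longleftrightarrow>
     (A^2 - 1) * (omg gx)^2
     + C1^2 * (kap gx + 1) * (kap gy - 1) - C2^2 * (kap gx - 1) * (kap gy + 1)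
     + C3^2 * (kap gx + 1) * (kap gy + 1) - C4^2 * (kap gx - 1) * (kap gy - 1)
     + 2 * D1^2 * (kap gz - 1) - 2 * D2^2 * (omg gx)^2 * (kap gz + 1)
     + 2 * D3^2 * (kap gz + 1) - 2 * D4^2 * (omg gx)^2 * (kap gz - 1) = 0"

definition eq_b :: "'q \<Rightarrow> 'q \<Rightarrow> 'q \<Rightarrow> 'q \<Rightarrow> bool" where
  "eq_b C1 C2 C3 C4 \<longleftrightarrow> (kap gx - 1) * C2 * C4 - (kap gx + 1) * C1 * C3 = 0"

text \<open>Condition (c) is a distinction of cases that parametrises the \<open>D\<^sub>i\<close> by \<open>\<alpha>\<close> and \<open>\<beta>\<close>.
  If both cases apply then, given (b), the two parametrisations describe the same quadruples
  \<open>(D\<^sub>1, D\<^sub>2, D\<^sub>3, D\<^sub>4)\<close> with different parameters, so the formulas of one applicable case are required,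
  not those of both with one common pair \<open>(\<alpha>, \<beta>)\<close>. If all \<open>C\<^sub>i\<close> vanish, neither case applies;
  the quantities that (c) would prescribe are then zero. Leaving them free would make the
  existence of a solution trivial: \<open>(1, 0, \<dots>, 0, \<alpha>, 0)\<close> with \<open>\<alpha> \<noteq> 0\<close> would be a solution
  other than \<open>(\<plusminus>1, 0, \<dots>, 0)\<close> over every field; and if \<open>i\<^sup>2 = -1\<close> in \<open>k\<close>, so would be
  \<open>A = 1 - 2\<omega>\<^sup>2\<close>, \<open>D\<^sub>1 = i\<omega>\<^sup>2\<close>, \<open>D\<^sub>2 = - \<omega>\<^sup>2\<close>, \<open>D\<^sub>3 = \<omega>\<^sup>2\<close>, \<open>D\<^sub>4 = - i\<omega>\<^sup>2\<close>,
  \<open>C\<^sub>i = \<alpha> = \<beta> = 0\<close>.\<close>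

definition eq_c :: "'q \<Rightarrow> 'q \<Rightarrow> 'q \<Rightarrow> 'q \<Rightarrow> 'q \<Rightarrow> 'q \<Rightarrow> 'q \<Rightarrow> 'q \<Rightarrow> 'q \<Rightarrow> 'q \<Rightarrow> bool" where
  "eq_c C1 C2 C3 C4 D1 D2 D3 D4 \<alpha> \<beta> \<longleftrightarrow>
     ((C1 \<noteq> 0 \<or> C4 \<noteq> 0) \<and>
        D1 = \<beta> * (1 - kap gx) * C4 \<and> D2 = \<alpha> * C4 \<and>
        D3 = - \<alpha> * (1 + kap gx) * C1 \<and> D4 = \<beta> * C1) \<or>
     ((C2 \<noteq> 0 \<or> C3 \<noteq> 0) \<and>
        D1 = - \<beta> * (1 + kap gx) * C3 \<and> D2 = \<alpha> * C3 \<and>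
        D3 = \<alpha> * (1 - kap gx) * C2 \<and> D4 = \<beta> * C2) \<or>
     (C1 = 0 \<and> C2 = 0 \<and> C3 = 0 \<and> C4 = 0 \<and>
        D1 = 0 \<and> D2 = 0 \<and> D3 = 0 \<and> D4 = 0 \<and> \<alpha> = 0 \<and> \<beta> = 0)"

end

end

theory Submission
  imports Defs
begin

text \<open>Let \<open>\<omega> = \<omega>\<^sub>x\<close>, and call an element of the division ring even if it commutes with \<open>\<omega>\<close> and odd if it
anticommutes with \<open>\<omega>\<close>: \<open>s\<close> is even, \<open>t\<close> and \<open>u\<close> are odd, and every element is uniquely the sum of an
even and an odd one. Both directions of the theorem pass through pairs \<open>(A, B)\<close> in the group ring,
with \<open>A\<close> central, \<open>B \<noteq> 0\<close> odd and \<open>B\<^sup>2 = (1 - A\<^sup>2) \<omega>\<^sup>2\<close>; equivalently, \<open>T = A \<omega> + B\<close> is a square root of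
\<open>\<omega>\<^sup>2\<close> whose even part is a central multiple of \<open>\<omega>\<close>.

From a pair to a unit (\<open>unit_of_odd_part\<close>). As \<open>\<kappa>\<^sub>x\<^sup>2 - \<omega>\<^sup>2 = 1\<close>, the element \<open>\<kappa>\<^sub>x + T\<close> is a unit with inverse
\<open>\<kappa>\<^sub>x - T\<close>. It conjugates \<open>\<omega>\<close> to an element with even part \<open>(1 + 2 B\<^sup>2) \<omega>\<close> and non-zero odd part, and both
parts have central squares. So the unit is of type 2 unless \<open>1 + 2 B\<^sup>2 = 0\<close>. In that case its square
\<open>(2 \<kappa>\<^sub>x\<^sup>2 - 1) + 2 \<kappa>\<^sub>x T\<close> is of type 2, because \<open>1 + 2 (2 \<kappa>\<^sub>x B)\<^sup>2 = 1 - 4 \<kappa>\<^sub>x\<^sup>2 \<noteq> 0\<close>. Units of type 2 are never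
trivial, since group elements conjugate \<open>\<omega>\<close> to \<open>\<plusminus>\<omega>\<close>.

From a unit to a pair (\<open>odd_part_of_unit\<close>). Let \<open>\<omega>\<^sup>U = E + Q\<close> with \<open>E\<close> even and \<open>Q\<close> odd. Since \<open>Q\<close> has degree
two and conjugation by \<open>\<omega>\<close> maps \<open>Q\<close> to \<open>-Q\<close>, the square \<open>Q\<^sup>2\<close> is central; from \<open>(E + Q)\<^sup>2 = \<omega>\<^sup>2\<close> it follows
that \<open>E\<^sup>2 = \<omega>\<^sup>2 - Q\<^sup>2\<close> and \<open>E Q = - Q E\<close>. The unit \<open>\<kappa>\<^sub>x + \<omega>\<^sup>U\<close>, the conjugate of \<open>x\<close> by \<open>U\<close>, again conjugates
\<open>\<omega>\<close> to an element \<open>A \<omega> + B\<close> with central \<open>A = 1 + 2 Q\<^sup>2\<close> and, up to sign, \<open>B = 2 \<omega> (E + \<kappa>\<^sub>x) Q\<close>. Thus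
after this second conjugation the even part is a central multiple of \<open>\<omega>\<close>, whatever \<open>E\<close> was.

Pairs and solutions. Being odd and in the group ring, \<open>B\<close> is \<open>c t + d u\<close> with Laurent polynomials \<open>c\<close>
and \<open>d\<close>. Conjugation by \<open>s\<close> and \<open>t\<close>, twisted by a monomial, acts on Laurent polynomials by two commuting
involutions. For a suitable twist the \<open>\<gamma>\<^sub>i\<close> span the four joint eigenspaces over the centre, for another
one the \<open>\<delta>\<^sub>i\<close> do. So the eigencomponents of \<open>c\<close> and \<open>d\<close>, which are again Laurent polynomials, are central
multiples of the \<open>\<gamma>\<^sub>i\<close> and \<open>\<delta>\<^sub>i\<close>; up to factors 2 the coefficients are the \<open>C\<^sub>i\<close> and \<open>D\<^sub>i\<close>
(\<open>c_coordinates\<close>, \<open>d_coordinates\<close>). Put \<open>P = c t\<close> and \<open>R = d u\<close>. Then \<open>B\<^sup>2 = (P\<^sup>2 + R\<^sup>2) + (P R + R P)\<close>, where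
\<open>P\<^sup>2\<close> and \<open>R\<^sup>2\<close> are known from \<open>P_sq\<close> and \<open>R_sq\<close>, and \<open>P R + R P\<close> from \<open>anti_PR\<close>. The equation
\<open>B\<^sup>2 = (1 - A\<^sup>2) \<omega>\<^sup>2\<close> thereby splits into (a), (b) and four bilinear relations between the \<open>C\<^sub>i\<close> and the \<open>D\<^sub>i\<close>,
of which (c) is the parametrisation. The parametrisation needs some \<open>C\<^sub>i \<noteq> 0\<close>, that is \<open>c \<noteq> 0\<close>; if \<open>c = 0\<close>,
the automorphism of the group that exchanges \<open>t\<close> and \<open>u\<close> moves \<open>d\<close> into the place of \<open>c\<close>
(\<open>odd_part_with_t_component\<close>).

All computations take place in the given division ring, by rewriting words in \<open>s\<close>, \<open>t\<close> and the inverses of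
\<open>x\<close>, \<open>y\<close>, \<open>z\<close> to a normal form. That elements such as \<open>1 \<plusminus> x\<close>, \<open>\<omega>\<close> or \<open>\<gamma>\<^sub>i\<close> do not vanish follows from \<open>x\<close>, \<open>y\<close>, \<open>z\<close>
having infinite order in the group.\<close>

section \<open>The group and its symmetry that exchanges t and u\<close>

lemma promislow_relations:
  "gt + gx + - gt = - gx" "gs + gy + - gs = - gy"
  unfolding gx_def gy_def
  subgoal by transfer (simp add: prom_inv_def prom_eq.rel_s)
  subgoal by transfer (simp add: prom_inv_def prom_eq.rel_t)
  done

text \<open>Homomorphisms out of the group are obtained from actions of its words: an assignment of maps to the
letters that respects cancellation and the two relators is constant on classes of words.\<close>

primrec act :: "(bool \<times> prom_gen \<Rightarrow> 'a \<Rightarrow> 'a) \<Rightarrow> prom_word \<Rightarrow> 'a \<Rightarrow> 'a" where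
  "act f [] = id"
| "act f (l # w) = f l \<circ> act f w"

lemma act_append: "act f (v @ w) = act f v \<circ> act f w"
  by (induction v) (auto simp: o_assoc)

lemma act_respects_prom_eq:
  assumes "prom_eq v w"
    and c: "\<And>e g a. f (e, g) (f (\<not> e, g) a) = a"
    and "\<And>a. f (True, GT) (f (True, GS) (f (True, GS) (f (False, GT) a))) = f (False, GS) (f (False, GS) a)"
    and "\<And>a. f (True, GS) (f (True, GT) (f (True, GT) (f (False, GS) a))) = f (False, GT) (f (False, GT) a)"
  shows "act f v = act f w"
  using assms(1)
proof (induction rule: prom_eq.induct)
  case (append v w v' w')
  then show ?case by (simp add: act_append)
qed (use assms(2-) in \<open>auto simp: fun_eq_iff\<close>)

text \<open>The group acts on three lines; on each of them one of \<open>s\<close>, \<open>t\<close>, \<open>u\<close> is a translation by 1 and the other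
two are reflections. Hence \<open>x\<close>, \<open>y\<close>, \<open>z\<close> have infinite order. The listed multiples are those needed to see
that certain Laurent polynomials do not vanish.\<close>

lemma axis_elements_ne_0: "gx \<noteq> 0" "gy \<noteq> 0" "gz \<noteq> 0" "gx + gx \<noteq> 0" "gy + gy \<noteq> 0" "gz + gz \<noteq> 0"
  "gx + gx + gx + gx + gx + gx \<noteq> 0" "gx + gx + gx + gx \<noteq> 0" "gx + gx + gx + gx + gx + gx + gx + gx \<noteq> 0"
proof -
  define fx :: "bool \<times> prom_gen \<Rightarrow> int \<Rightarrow> int" where
    "fx = (\<lambda>(e, g) v. case g of GS \<Rightarrow> if e then v + 1 else v - 1 | GT \<Rightarrow> - v)"
  define fy :: "bool \<times> prom_gen \<Rightarrow> int \<Rightarrow> int" where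
    "fy = (\<lambda>(e, g) v. case g of GT \<Rightarrow> if e then v + 1 else v - 1 | GS \<Rightarrow> - v)"
  define fz :: "bool \<times> prom_gen \<Rightarrow> int \<Rightarrow> int" where
    "fz = (\<lambda>(e, g) v. case g of GT \<Rightarrow> - v | GS \<Rightarrow> 1 - v)"
  have X: "act fx v = act fx w" if "prom_eq v w" for v w
    by (rule act_respects_prom_eq[OF that]) (auto simp: fx_def split: prom_gen.splits)
  have Y: "act fy v = act fy w" if "prom_eq v w" for v w
    by (rule act_respects_prom_eq[OF that]) (auto simp: fy_def split: prom_gen.splits)
  have Z: "act fz v = act fz w" if "prom_eq v w" for v w
    by (rule act_respects_prom_eq[OF that]) (auto simp: fz_def split: prom_gen.splits)
  show "gx \<noteq> 0" unfolding gx_def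
    by (transfer, auto dest!: X fun_cong[where x = 0] simp: fx_def)
  show "gx + gx \<noteq> 0" unfolding gx_def
    by (transfer, auto dest!: X fun_cong[where x = 0] simp: fx_def)
  show "gx + gx + gx + gx + gx + gx \<noteq> 0" unfolding gx_def
    by (transfer, auto dest!: X fun_cong[where x = 0] simp: fx_def)
  show "gx + gx + gx + gx \<noteq> 0" unfolding gx_def
    by (transfer, auto dest!: X fun_cong[where x = 0] simp: fx_def)
  show "gx + gx + gx + gx + gx + gx + gx + gx \<noteq> 0" unfolding gx_def
    by (transfer, auto dest!: X fun_cong[where x = 0] simp: fx_def)
  show "gy \<noteq> 0" unfolding gy_def
    by (transfer, auto dest!: Y fun_cong[where x = 0] simp: fy_def)
  show "gy + gy \<noteq> 0" unfolding gy_def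
    by (transfer, auto dest!: Y fun_cong[where x = 0] simp: fy_def)
  show "gz + gz \<noteq> 0" unfolding gz_def gu_def
    by (transfer, auto dest!: Z fun_cong[where x = 0] simp: fz_def)
  show "gz \<noteq> 0" unfolding gz_def gu_def
    by (transfer, auto dest!: Z fun_cong[where x = 0] simp: fz_def)
qed

lemma poly_mapping_single_induct [case_names zero single add]:
  fixes p :: "'a \<Rightarrow>\<^sub>0 'b::comm_monoid_add"
  assumes "P 0" "\<And>g c. P (Poly_Mapping.single g c)" "\<And>p q. P p \<Longrightarrow> P q \<Longrightarrow> P (p + q)"
  shows "P p"
proof (induction p rule: Poly_Mapping.update_induct)
  case const
  show ?case by (rule assms(1))
next
  case (update f a b)
  have "Poly_Mapping.update a b f = f + Poly_Mapping.single a b"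
    using update(1)
    by (intro poly_mapping_eqI) (auto simp: lookup_add lookup_update lookup_single in_keys_iff when_def)
  then show ?case using assms(2,3) update(3) by simp
qed

text \<open>A rewriting system that moves \<open>x\<^sup>\<plusminus>\<^sup>1\<close> and \<open>y\<^sup>\<plusminus>\<^sup>1\<close> to the left of \<open>s\<close> and \<open>t\<close>. It leaves alternating words in \<open>s\<close>
and \<open>t\<close>, which is enough to compare both sides of the relations needed below.\<close>

lemma promislow_add_simps:
  "gs + gs = gx" "gs + (gs + a) = gx + a" "gt + gt = gy" "gt + (gt + a) = gy + a"
  "gt + gx = - gx + gt" "gt + (gx + a) = - gx + (gt + a)"
  "gt + - gx = gx + gt" "gt + (- gx + a) = gx + (gt + a)"
  "gs + gy = - gy + gs" "gs + (gy + a) = - gy + (gs + a)"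
  "gs + - gy = gy + gs" "gs + (- gy + a) = gy + (gs + a)"
  "gs + gx = gx + gs" "gs + (gx + a) = gx + (gs + a)"
  "gs + - gx = - gx + gs" "gs + (- gx + a) = - gx + (gs + a)"
  "gt + gy = gy + gt" "gt + (gy + a) = gy + (gt + a)"
  "gt + - gy = - gy + gt" "gt + (- gy + a) = - gy + (gt + a)"
  "gy + gx = gx + gy" "gy + (gx + a) = gx + (gy + a)"
  "gy + - gx = - gx + gy" "gy + (- gx + a) = - gx + (gy + a)"
  "- gy + gx = gx + - gy" "- gy + (gx + a) = gx + (- gy + a)"
  "- gy + - gx = - gx + - gy" "- gy + (- gx + a) = - gx + (- gy + a)"
  "- gs = - gx + gs" "- gt = - gy + gt"
proof -
  have inv: "p + - q = - q + p" if "p + q = q + p" for p q :: promislow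
    using that by (metis add.assoc add.right_inverse add.left_inverse add_0 add_0_right)
  have inv': "p + - q = q + p" if "p + q = - q + p" for p q :: promislow
    using that by (metis add.assoc add.right_inverse add.left_inverse add_0 add_0_right)
  have ass: "p + (q + r) = p' + (q' + r)" if "p + q = p' + q'" for p q p' q' r :: promislow
    using that by (metis add.assoc)
  show 1: "gs + gs = gx" "gt + gt = gy" by (simp_all add: gx_def gy_def)
  show 2: "gt + gx = - gx + gt" "gs + gy = - gy + gs"
    using promislow_relations by (metis add.assoc add.left_inverse add_0_right)+
  show 3: "gs + gx = gx + gs" "gt + gy = gy + gt" by (simp_all add: gx_def gy_def add.assoc)
  show 4: "gt + - gx = gx + gt" "gs + - gy = gy + gs"
    using inv' 2 by blast+
  show 5: "gs + - gx = - gx + gs" "gt + - gy = - gy + gt"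
    using inv 3 by blast+
  show 6: "gy + gx = gx + gy"
  proof -
    have "gy + gx = gt + (gt + gx)" by (simp add: gy_def add.assoc)
    also have "\<dots> = gt + - gx + gt" by (simp only: 2(1) add.assoc)
    also have "\<dots> = gx + gy" by (simp only: 4(1)) (simp add: gy_def add.assoc)
    finally show ?thesis .
  qed
  show 7: "gy + - gx = - gx + gy" using inv 6 by blast
  show 8: "- gy + gx = gx + - gy" using inv[of gx gy] 6 by simp
  show 9: "- gy + - gx = - gx + - gy" using inv[of "- gx" gy] 7 by simp
  show "gs + (gs + a) = gx + a" "gt + (gt + a) = gy + a"
    by (simp_all add: gx_def gy_def add.assoc)
  show "gt + (gx + a) = - gx + (gt + a)" "gt + (- gx + a) = gx + (gt + a)"
    "gs + (gy + a) = - gy + (gs + a)" "gs + (- gy + a) = gy + (gs + a)"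
    "gs + (gx + a) = gx + (gs + a)" "gs + (- gx + a) = - gx + (gs + a)"
    "gt + (gy + a) = gy + (gt + a)" "gt + (- gy + a) = - gy + (gt + a)"
    "gy + (gx + a) = gx + (gy + a)" "gy + (- gx + a) = - gx + (gy + a)"
    "- gy + (gx + a) = gx + (- gy + a)" "- gy + (- gx + a) = - gx + (- gy + a)"
    by (intro ass 2 3 4 5 6 7 8 9)+
  show "- gs = - gx + gs" "- gt = - gy + gt"
    by (simp_all add: gx_def gy_def minus_add add.assoc)
qed

lemma gs_conj_gz: "- gs + gz + gs = - gz"
  by (simp add: gz_def gu_def minus_add add.assoc promislow_add_simps diff_conv_add_uminus
      del: add_uminus_conv_diff)

text \<open>The assignment \<open>s \<mapsto> s\<^sup>-\<^sup>1\<close>, \<open>t \<mapsto> u\<close> extends to an automorphism that also maps \<open>u\<close> to \<open>t\<close>. With \<open>s \<mapsto> s\<close>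
instead, \<open>u\<close> would be mapped to \<open>x t\<close>; inverting \<open>s\<close> makes the automorphism an involution, so that no second
map is needed as its inverse.\<close>

definition tu_swap_letter :: "bool \<times> prom_gen \<Rightarrow> promislow" where
  "tu_swap_letter l = (let g = (case snd l of GS \<Rightarrow> - gs | GT \<Rightarrow> gu) in if fst l then g else - g)"

lift_definition tu_swap :: "promislow \<Rightarrow> promislow" is "\<lambda>w. act (\<lambda>l. (+) (tu_swap_letter l)) w 0"
proof (rule fun_cong[OF act_respects_prom_eq], assumption)
  fix e g and a :: promislow
  show "tu_swap_letter (e, g) + (tu_swap_letter (\<not> e, g) + a) = a"
    by (simp add: tu_swap_letter_def Let_def add.assoc[symmetric])
next
  fix a
  show "tu_swap_letter (True, GT) + (tu_swap_letter (True, GS) + (tu_swap_letter (True, GS) + (tu_swap_letter (False, GT) + a)))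
    = tu_swap_letter (False, GS) + (tu_swap_letter (False, GS) + a)"
    by (simp add: tu_swap_letter_def gu_def minus_add add.assoc promislow_add_simps diff_conv_add_uminus
      del: add_uminus_conv_diff)
next
  fix a
  show "tu_swap_letter (True, GS) + (tu_swap_letter (True, GT) + (tu_swap_letter (True, GT) + (tu_swap_letter (False, GS) + a)))
    = tu_swap_letter (False, GT) + (tu_swap_letter (False, GT) + a)"
    using arg_cong[OF gs_conj_gz, of "\<lambda>g. g + a"]
    by (simp add: tu_swap_letter_def gz_def minus_add add.assoc diff_conv_add_uminus
      del: add_uminus_conv_diff)
qed

lemma act_left_add: "act (\<lambda>l. (+) (h l)) w a = act (\<lambda>l. (+) (h l)) w 0 + (a :: 'a::monoid_add)"
  by (induction w) (simp_all add: add.assoc)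

lemma tu_swap_add: "tu_swap (g + h) = tu_swap g + tu_swap h"
proof transfer
  fix v w :: prom_word
  let ?f = "\<lambda>l. (+) (tu_swap_letter l)"
  show "act ?f (v @ w) 0 = act ?f v 0 + act ?f w 0"
    using act_left_add[of tu_swap_letter v "act ?f w 0"] by (simp add: act_append)
qed

lemma tu_swap_gs: "tu_swap gs = - gs"
  by (simp add: gs_def tu_swap.abs_eq tu_swap_letter_def)

lemma tu_swap_gt: "tu_swap gt = gu"
  by (simp add: gt_def tu_swap.abs_eq tu_swap_letter_def)

lemma tu_swap_0: "tu_swap 0 = 0"
  by transfer simp

lemma tu_swap_minus: "tu_swap (- g) = - tu_swap g"
  by (metis add.right_inverse minus_unique tu_swap_0 tu_swap_add)

lemma promislow_induct [case_names zero gs gs_inv gt gt_inv]: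
  assumes "P 0" "\<And>g. P g \<Longrightarrow> P (gs + g)" "\<And>g. P g \<Longrightarrow> P (- gs + g)"
    "\<And>g. P g \<Longrightarrow> P (gt + g)" "\<And>g. P g \<Longrightarrow> P (- gt + g)"
  shows "P g"
proof -
  have "P (abs_promislow w)" for w
  proof (induction w)
    case Nil
    then show ?case using assms(1) by (simp add: zero_promislow_def)
  next
    case (Cons l w)
    obtain e h where l: "l = (e, h)" by (cases l)
    have "abs_promislow (l # w) = abs_promislow [l] + abs_promislow w"
      by (simp add: plus_promislow.abs_eq)
    moreover have "abs_promislow [l] = (case h of GS \<Rightarrow> if e then gs else - gs | GT \<Rightarrow> if e then gt else - gt)"
      by (auto simp: l gs_def gt_def uminus_promislow.abs_eq prom_inv_def split: prom_gen.splits)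
    ultimately show ?case using Cons assms(2-5) by (auto split: prom_gen.splits)
  qed
  then show ?thesis by (metis Quotient3_promislow Quotient3_abs_rep)
qed

lemma tu_swap_gx: "tu_swap gx = - gx" and tu_swap_gz: "tu_swap gz = gy"
  by (simp_all add: gx_def gy_def gz_def gu_def tu_swap_add tu_swap_minus tu_swap_gs tu_swap_gt minus_add add.assoc)

lemma tu_swap_involution: "tu_swap (tu_swap g) = g"
  by (induction g rule: promislow_induct)
     (simp_all add: tu_swap_0 tu_swap_add tu_swap_minus tu_swap_gs tu_swap_gt gu_def minus_add add.assoc diff_conv_add_uminus
      del: add_uminus_conv_diff)

text \<open>Precomposition with an involution is the same as pushing forward along it, so the linear extension of
\<open>tu_swap\<close> is available as \<open>map_key\<close>.\<close>

definition tu_swap_ring :: "'k::field prom_ring \<Rightarrow> 'k prom_ring" where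
  "tu_swap_ring = Poly_Mapping.map_key tu_swap"

lemma inj_tu_swap: "inj tu_swap"
  by (metis injI tu_swap_involution)

lemma tu_swap_ring_single: "tu_swap_ring (Poly_Mapping.single g c) = Poly_Mapping.single (tu_swap g) c"
  using map_key_single[OF inj_tu_swap, of "tu_swap g" c] by (simp add: tu_swap_ring_def tu_swap_involution)

lemma tu_swap_ring_add: "tu_swap_ring (p + q) = tu_swap_ring p + tu_swap_ring q"
  by (simp add: tu_swap_ring_def map_key_plus inj_tu_swap)

lemma tu_swap_ring_0: "tu_swap_ring 0 = 0"
  by (simp add: tu_swap_ring_def inj_tu_swap)

lemma tu_swap_ring_mult: "tu_swap_ring (p * q) = tu_swap_ring p * tu_swap_ring q"
proof (induction p rule: poly_mapping_single_induct)
  case (single g c)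
  show ?case
    by (induction q rule: poly_mapping_single_induct)
       (simp_all add: tu_swap_ring_0 tu_swap_ring_single tu_swap_ring_add mult_single tu_swap_add distrib_left)
qed (simp_all add: tu_swap_ring_0 tu_swap_ring_add distrib_right)

lemma tu_swap_ring_involution: "tu_swap_ring (tu_swap_ring p) = p"
  by (induction p rule: poly_mapping_single_induct)
     (simp_all add: tu_swap_ring_0 tu_swap_ring_single tu_swap_ring_add tu_swap_involution)

section \<open>Generated rings and the centre of a division ring\<close>

abbreviation RTA :: "'a::ring_1 ring" where "RTA \<equiv> ring_of_type_algebra"

lemma rta_simps [simp]:
  "carrier RTA = UNIV" "\<one>\<^bsub>RTA\<^esub> = 1" "\<zero>\<^bsub>RTA\<^esub> = 0" "a \<oplus>\<^bsub>RTA\<^esub> b = a + b" "a \<otimes>\<^bsub>RTA\<^esub> b = a * b"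
  by (simp_all add: ring_of_type_algebra_def)

lemma ring_RTA: "ring (RTA :: 'a::ring_1 ring)"
proof -
  have "\<exists>y. x + y = 0" for x :: 'a
    using add.right_inverse by blast
  then show ?thesis
    unfolding ring_of_type_algebra_def using add.right_inverse
    by unfold_locales (auto simp: algebra_simps Units_def)
qed

lemma rta_minus [simp]: "\<ominus>\<^bsub>RTA\<^esub> a = - (a :: 'a::ring_1)"
proof -
  interpret ring "RTA :: 'a ring" by (rule ring_RTA)
  show ?thesis using minus_equality[of "- a" a] by simp
qed

lemma rta_inv [simp]: "a \<noteq> 0 \<Longrightarrow> inv\<^bsub>RTA\<^esub> a = inverse (a :: 'a::division_ring)"
proof -
  assume "a \<noteq> 0"
  interpret ring "RTA :: 'a ring" by (rule ring_RTA)
  show ?thesis using inv_unique'[of a "inverse a"] \<open>a \<noteq> 0\<close> by simp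
qed

lemma gen_ring_closed:
  defines "R \<equiv> \<lambda>H :: 'a::ring_1 set. generate_ring RTA H"
  shows "1 \<in> R H" "h \<in> H \<Longrightarrow> h \<in> R H" "a \<in> R H \<Longrightarrow> - a \<in> R H"
    "a \<in> R H \<Longrightarrow> b \<in> R H \<Longrightarrow> a + b \<in> R H" "a \<in> R H \<Longrightarrow> b \<in> R H \<Longrightarrow> a * b \<in> R H"
    "a \<in> R H \<Longrightarrow> b \<in> R H \<Longrightarrow> a - b \<in> R H" "0 \<in> R H"
proof -
  show 1: "1 \<in> R H" "h \<in> H \<Longrightarrow> h \<in> R H" "\<And>a. a \<in> R H \<Longrightarrow> - a \<in> R H"
    "\<And>a b. a \<in> R H \<Longrightarrow> b \<in> R H \<Longrightarrow> a + b \<in> R H" "a \<in> R H \<Longrightarrow> b \<in> R H \<Longrightarrow> a * b \<in> R H"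
    using generate_ring.intros[where R = RTA and H = H, simplified] unfolding R_def by blast+
  show "a \<in> R H \<Longrightarrow> b \<in> R H \<Longrightarrow> a - b \<in> R H"
    using 1(3)[of b] 1(4)[of a "- b"] by simp
  show "0 \<in> R H" using 1(1) 1(3)[of 1] 1(4)[of 1 "- 1"] by simp
qed

lemma gen_ring_induct [consumes 1, case_names one gen minus add mult]:
  assumes "a \<in> generate_ring RTA (H :: 'a::ring_1 set)"
    "P 1" "\<And>h. h \<in> H \<Longrightarrow> P h" "\<And>a. P a \<Longrightarrow> P (- a)"
    "\<And>a b. P a \<Longrightarrow> P b \<Longrightarrow> P (a + b)" "\<And>a b. P a \<Longrightarrow> P b \<Longrightarrow> P (a * b)"
  shows "P a"
  using assms(1) by (induction rule: generate_ring.induct) (use assms(2-) in auto)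

text \<open>A relation, rather than equations between products, so that closure properties can be used as
introduction rules; the equations themselves would loop as rewrite rules.\<close>

definition comm :: "'a::semigroup_mult \<Rightarrow> 'a \<Rightarrow> bool" where
  "comm a b \<longleftrightarrow> a * b = b * a"

lemma comm_sym: "comm a b \<Longrightarrow> comm b a" by (simp add: comm_def)
lemma comm_mult: "comm c a \<Longrightarrow> comm c b \<Longrightarrow> comm c (a * b)"
  unfolding comm_def by (metis mult.assoc)
lemma comm_add: "comm c a \<Longrightarrow> comm c b \<Longrightarrow> comm c (a + b)" for a :: "'a::ring_1"
  by (simp add: comm_def algebra_simps)
lemma comm_minus: "comm c a \<Longrightarrow> comm c (- a)" for a :: "'a::ring_1"
  by (simp add: comm_def)
lemma comm_1: "comm c (1 :: 'a::ring_1)"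
  by (simp add: comm_def)
lemma comm_0: "comm c (0 :: 'a::ring_1)"
  by (simp add: comm_def)
lemma comm_inverse: "comm c a \<Longrightarrow> comm c (inverse a)" for a :: "'a::division_ring"
proof (cases "a = 0")
  case False
  assume "comm c a"
  then have "inverse a * (c * a) * inverse a = inverse a * (a * c) * inverse a"
    by (simp add: comm_def)
  then show ?thesis using False by (simp add: comm_def mult.assoc flip: mult.assoc[of "inverse a" a])
qed (simp add: comm_def)

lemma center_closed:
  shows "0 \<in> (skew_center :: 'q::division_ring set)" "1 \<in> (skew_center :: 'q::division_ring set)"
  "\<And>a b. (a :: 'q) \<in> skew_center \<Longrightarrow> b \<in> skew_center \<Longrightarrow> a + b \<in> skew_center"
  "\<And>a b. (a :: 'q) \<in> skew_center \<Longrightarrow> b \<in> skew_center \<Longrightarrow> a * b \<in> skew_center"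
  "\<And>a. (a :: 'q) \<in> skew_center \<Longrightarrow> - a \<in> skew_center"
  "\<And>a b. (a :: 'q) \<in> skew_center \<Longrightarrow> b \<in> skew_center \<Longrightarrow> a - b \<in> skew_center"
  "\<And>a. (a :: 'q) \<in> skew_center \<Longrightarrow> inverse a \<in> skew_center"
proof -
  have c: "(a \<in> skew_center) = (\<forall>q. comm q a)" for a :: 'q
    by (auto simp: skew_center_def comm_def)
  show "0 \<in> (skew_center :: 'q set)" "1 \<in> (skew_center :: 'q set)"
    by (auto simp: skew_center_def)
  show "\<And>a b. (a :: 'q) \<in> skew_center \<Longrightarrow> b \<in> skew_center \<Longrightarrow> a + b \<in> skew_center"
    "\<And>a b. (a :: 'q) \<in> skew_center \<Longrightarrow> b \<in> skew_center \<Longrightarrow> a * b \<in> skew_center"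
    "\<And>a. (a :: 'q) \<in> skew_center \<Longrightarrow> - a \<in> skew_center"
    "\<And>a. (a :: 'q) \<in> skew_center \<Longrightarrow> inverse a \<in> skew_center"
    unfolding c by (auto intro: comm_add comm_mult comm_minus comm_inverse)
  show "\<And>a b. (a :: 'q) \<in> skew_center \<Longrightarrow> b \<in> skew_center \<Longrightarrow> a - b \<in> skew_center"
    by (simp add: skew_center_def algebra_simps)
qed

lemma center_comm: "a \<in> skew_center \<Longrightarrow> a * b = b * (a :: 'q::division_ring)"
  by (simp add: skew_center_def)

section \<open>Quadratic extensions of the centre\<close>

lemma subfield_center: "subfield (skew_center :: 'q::division_ring set) RTA"
proof -
  interpret ring "RTA :: 'q ring" by (rule ring_RTA)
  have "subring (skew_center :: 'q set) RTA"
    by (rule subringI) (simp_all add: center_closed)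
  then have 1: "subcring (skew_center :: 'q set) RTA"
    by (rule subcringI) (simp add: center_comm)
  have 2: "subdomain (skew_center :: 'q set) RTA"
    using 1 by (simp add: subdomain_def subdomain_axioms_def)
  have "Units (RTA \<lparr>carrier := skew_center :: 'q set\<rparr>) = skew_center - {0}"
  proof (intro equalityI subsetI)
    fix a assume "a \<in> Units (RTA \<lparr>carrier := skew_center :: 'q set\<rparr>)"
    then show "a \<in> skew_center - {0}" by (auto simp: Units_def)
  next
    fix a :: 'q assume "a \<in> skew_center - {0}"
    then show "a \<in> Units (RTA \<lparr>carrier := skew_center :: 'q set\<rparr>)"
      using center_closed(7)[of a] by (auto simp: Units_def intro!: bexI[of _ "inverse a"])
  qed
  then show ?thesis using 2 by (simp add: subfield_def subfield_axioms_def)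
qed

lemma ext_degree_eq:
  assumes "ring.dimension RTA n skew_center (E :: 'q::division_ring set)"
  shows "ext_degree skew_center E = enat n"
proof -
  interpret ring "RTA :: 'q ring" by (rule ring_RTA)
  have "(THE n. dimension n skew_center E) = n"
    using dimension_is_inj[OF subfield_center assms] assms by blast
  then show ?thesis using assms unfolding ext_degree_def by auto
qed

lemma line_ext_RTA: "ring.line_extension RTA F a E = {k * a + e | k e. k \<in> F \<and> e \<in> (E :: 'q::division_ring set)}"
proof -
  interpret ring "RTA :: 'q ring" by (rule ring_RTA)
  show ?thesis by (auto simp: line_extension_def set_add_def' r_coset_def)
qed

text \<open>For \<open>D\<^sup>2\<close> central and \<open>D\<close> not central, \<open>(a + b D) (a - b D) = a\<^sup>2 - b\<^sup>2 D\<^sup>2\<close> is a non-zero element of the centre, so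
the elements \<open>a + b D\<close> are closed under inversion.\<close>

lemma center_adjoin_eq:
  assumes "(D :: 'q::division_ring) \<notin> skew_center" "D * D \<in> skew_center"
  shows "center_adjoin D = {a + b * D | a b. a \<in> skew_center \<and> b \<in> skew_center}" (is "_ = ?E")
proof (intro equalityI subsetI)
  fix e assume "e \<in> ?E"
  then obtain a b where e: "e = a + b * D" "a \<in> skew_center" "b \<in> skew_center" by blast
  have i: "h \<in> insert D skew_center \<Longrightarrow> h \<in> center_adjoin D" for h
    unfolding center_adjoin_def by (rule generate_field.incl)
  have "a \<oplus>\<^bsub>RTA\<^esub> (b \<otimes>\<^bsub>RTA\<^esub> D) \<in> center_adjoin D"
    using i[of a] i[of b] i[of D] e(2,3) unfolding center_adjoin_def
    by (intro generate_field.eng_add generate_field.eng_mult) auto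
  then show "e \<in> center_adjoin D" by (simp add: e(1))
next
  fix e assume "e \<in> center_adjoin D"
  then show "e \<in> ?E" unfolding center_adjoin_def
  proof (induction rule: generate_field.induct)
    case one
    have "1 = 1 + 0 * D" by simp
    then show ?case using center_closed(1,2) by (simp only: rta_simps) blast
  next
    case (incl h)
    have "h = h + 0 * D" "D = 0 + 1 * D" by simp_all
    then show ?case using center_closed(1,2) incl by blast
  next
    case (a_inv h)
    then obtain a b where h: "h = a + b * D" "a \<in> skew_center" "b \<in> skew_center" by blast
    have "- h = - a + (- b) * D" by (simp add: h)
    then show ?case using center_closed(5) h(2,3) by (simp only: rta_minus) blast
  next
    case (m_inv h)
    then obtain a b where h: "h = a + b * D" "a \<in> skew_center" "b \<in> skew_center" by blast
    have h0: "h \<noteq> 0" using m_inv(2) by simp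
    define n where "n = a * a - b * b * (D * D)"
    have n: "n \<in> skew_center" unfolding n_def by (intro center_closed h assms)
    have bD: "b * D = D * b" by (rule center_comm[OF h(3)])
    have "D * (b * D) = b * (D * D)" unfolding bD by (simp only: bD[symmetric] mult.assoc[symmetric])
    then have hn: "h * (a - b * D) = n"
      using center_comm[OF h(2), of "b * D"]
      by (simp add: h(1) n_def distrib_left distrib_right right_diff_distrib left_diff_distrib mult.assoc)
    have n0: "n \<noteq> 0"
    proof
      assume "n = 0"
      then have ab: "a = b * D" using hn h0 by simp
      show False
      proof (cases "b = 0")
        case True
        then show ?thesis using ab h h0 by simp
      next
        case False
        then have "D = inverse b * a" using ab by (simp flip: mult.assoc)
        then show ?thesis using assms(1) center_closed(4,7) h by blast
      qed
    qed
    have "h * ((a - b * D) * inverse n) = 1"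
      using n0 hn by (simp flip: mult.assoc)
    then have "inverse h = (a - b * D) * inverse n" by (rule inverse_unique)
    also have "\<dots> = inverse n * (a - b * D)"
      by (rule center_comm[OF center_closed(7)[OF n], symmetric])
    also have "\<dots> = inverse n * a + (- (inverse n * b)) * D"
      by (simp add: right_diff_distrib mult.assoc)
    finally have "inv\<^bsub>RTA\<^esub> h = inverse n * a + (- (inverse n * b)) * D" using h0 by simp
    moreover have "inverse n * a \<in> skew_center" "- (inverse n * b) \<in> skew_center"
      by (intro center_closed h n)+
    ultimately show ?case by blast
  next
    case (eng_add g h)
    then obtain a b c d where h: "g = a + b * D" "a \<in> skew_center" "b \<in> skew_center"
       "h = c + d * D" "c \<in> skew_center" "d \<in> skew_center" by blast
    have "g \<oplus>\<^bsub>RTA\<^esub> h = (a + c) + (b + d) * D" by (simp add: h algebra_simps)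
    moreover have "a + c \<in> skew_center" "b + d \<in> skew_center" by (intro center_closed h)+
    ultimately show ?case by blast
  next
    case (eng_mult g h)
    then obtain a b c d where h: "g = a + b * D" "a \<in> skew_center" "b \<in> skew_center"
       "h = c + d * D" "c \<in> skew_center" "d \<in> skew_center" by blast
    have D: "D * c = c * D" "D * d = d * D" using center_comm h by metis+
    have "D * (d * D) = d * (D * D)" using D(2) by (simp flip: mult.assoc)
    then have "g \<otimes>\<^bsub>RTA\<^esub> h = (a * c + b * d * (D * D)) + (a * d + b * c) * D"
      by (simp add: h(1,4) distrib_left distrib_right mult.assoc D add_ac)
    moreover have "a * c + b * d * (D * D) \<in> skew_center" "a * d + b * c \<in> skew_center"
      by (intro center_closed h assms)+
    ultimately show ?case by blast
  qed
qed

lemma ext_degree_sqrt: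
  assumes "(D :: 'q::division_ring) \<notin> skew_center" "D * D \<in> skew_center"
  shows "ext_degree skew_center (center_adjoin D) = 2"
proof -
  interpret ring "RTA :: 'q ring" by (rule ring_RTA)
  have D0: "D \<noteq> 0" using assms(1) center_closed(1) by auto
  have n1: "1 \<notin> line_extension skew_center D {\<zero>\<^bsub>RTA\<^esub>}"
  proof
    assume "1 \<in> line_extension skew_center D {\<zero>\<^bsub>RTA\<^esub>}"
    then obtain k where k: "k \<in> skew_center" "1 = k * D" by (auto simp: line_ext_RTA)
    then have "D = inverse k" using inverse_unique[of k D] by simp
    then show False using assms(1) k(1) center_closed(7) by blast
  qed
  have "dimension (Suc (Suc 0)) skew_center (line_extension skew_center 1 (line_extension skew_center D {\<zero>\<^bsub>RTA\<^esub>}))"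
    using n1 D0 by (intro Suc_dim zero_dim) auto
  also have "line_extension skew_center 1 (line_extension skew_center D {\<zero>\<^bsub>RTA\<^esub>}) = center_adjoin D"
    unfolding center_adjoin_eq[OF assms] by (auto simp: line_ext_RTA)
  finally show ?thesis
    using ext_degree_eq[of "Suc (Suc 0)" "center_adjoin D"] by (simp add: numeral_eq_enat)
qed

text \<open>In degree two the list \<open>1, D, D\<^sup>2\<close> is linearly dependent over the centre, while \<open>1, D\<close> is not.\<close>

lemma ext_degree_2D:
  assumes "ext_degree skew_center (center_adjoin (D :: 'q::division_ring)) = 2"
  shows "D \<notin> skew_center" "\<exists>p\<in>skew_center. \<exists>q\<in>skew_center. D * D = p * D + q"
proof -
  interpret ring "RTA :: 'q ring" by (rule ring_RTA)
  obtain n where n: "dimension n skew_center (center_adjoin D)"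
    using assms unfolding ext_degree_def by (auto split: if_splits)
  have "enat n = 2" using ext_degree_eq[OF n] assms by simp
  then have "n = 2" by (simp add: numeral_eq_enat)
  then have d: "dimension 2 skew_center (center_adjoin D)" using n by simp
  have ca: "D \<in> center_adjoin D" "1 \<in> center_adjoin D" "D * D \<in> center_adjoin D"
    unfolding center_adjoin_def
    using generate_field.incl[of D "insert D skew_center" RTA]
      generate_field.incl[of 1 "insert D skew_center" RTA] center_closed(2)
      generate_field.eng_mult[of D RTA "insert D skew_center" D] by auto
  show 1: "D \<notin> skew_center"
  proof
    assume D: "D \<in> skew_center"
    have "e \<in> skew_center" if "e \<in> center_adjoin D" for e
      using that unfolding center_adjoin_def
    proof (induction rule: generate_field.induct)
      case (incl h)
      then show ?case using D by auto
    qed (simp_all add: center_closed)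
    moreover have "e \<in> center_adjoin D" if "e \<in> skew_center" for e
      using that unfolding center_adjoin_def by (intro generate_field.incl) simp
    ultimately have "center_adjoin D = skew_center" by blast
    then show False using dimension_is_inj[OF subfield_center d] dimension_one[OF subfield_center] by force
  qed
  show "\<exists>p\<in>skew_center. \<exists>q\<in>skew_center. D * D = p * D + q"
  proof (rule ccontr)
    assume *: "\<not> ?thesis"
    have S1: "Span skew_center [1] = skew_center"
      by (auto simp: line_ext_RTA)
    have S2: "Span skew_center [D, 1] = {p * D + q | p q. p \<in> skew_center \<and> q \<in> skew_center}"
      using S1 by (simp add: line_ext_RTA)
    have "independent skew_center [D * D, D, 1]"
      using * 1 S1 S2 by (intro li_Cons li_Nil) (auto simp: line_ext_RTA)
    then have "length [D * D, D, 1] \<le> 2"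
      by (rule independent_length_le_dimension[OF subfield_center d]) (use ca in auto)
    then show False by simp
  qed
qed

section \<open>The group ring inside its division ring of fractions\<close>

text \<open>Inside the locale the letters \<open>s\<close>, \<open>t\<close>, \<open>u\<close>, \<open>x\<close>, \<open>y\<close>, \<open>z\<close> denote the images
of the group elements in the division ring.\<close>

locale promislow_ore =
  fixes \<phi> :: "'k::field prom_ring \<Rightarrow> 'q::division_ring"
  assumes char_ne_2: "CHAR('k) \<noteq> 2"
    and ore: "ore_fraction_field \<phi>"
begin

abbreviation s where "s \<equiv> grp \<phi> gs"
abbreviation t where "t \<equiv> grp \<phi> gt"
abbreviation u where "u \<equiv> grp \<phi> gu"
abbreviation x where "x \<equiv> grp \<phi> gx"
abbreviation y where "y \<equiv> grp \<phi> gy"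
abbreviation z where "z \<equiv> grp \<phi> gz"
abbreviation ix where "ix \<equiv> inverse (grp \<phi> gx)"
abbreviation iy where "iy \<equiv> inverse (grp \<phi> gy)"
abbreviation iz where "iz \<equiv> inverse (grp \<phi> gz)"
abbreviation scal where "scal c \<equiv> \<phi> (Poly_Mapping.single 0 c)"

lemma phi_1: "\<phi> 1 = 1" and phi_add: "\<phi> (a + b) = \<phi> a + \<phi> b" and phi_mult: "\<phi> (a * b) = \<phi> a * \<phi> b"
  and phi_inj: "inj \<phi>"
  using ore by (auto simp: ore_fraction_field_def)

lemma phi_0: "\<phi> 0 = 0" using phi_add[of 0 0] by simp

lemma phi_minus: "\<phi> (- a) = - \<phi> a"
  using phi_add[of a "- a"] by (simp add: phi_0 eq_neg_iff_add_eq_0 add.commute)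

lemma phi_diff: "\<phi> (a - b) = \<phi> a - \<phi> b"
  using phi_add[of a "- b"] by (simp add: phi_minus)

lemma phi_eq_iff: "\<phi> a = \<phi> b \<longleftrightarrow> a = b"
  using phi_inj by (auto dest: injD)

lemma grp_add: "grp \<phi> (a + b) = grp \<phi> a * grp \<phi> b"
  by (simp add: grp_def phi_mult[symmetric] mult_single)

lemma grp_0: "grp \<phi> 0 = 1"
  by (simp add: grp_def phi_1)

lemma grp_eq_iff: "grp \<phi> a = grp \<phi> b \<longleftrightarrow> a = b"
proof -
  have "a = b" if "Poly_Mapping.single a (1::'k) = Poly_Mapping.single b 1"
    using arg_cong[OF that, of "\<lambda>p. Poly_Mapping.lookup p a"] by (auto simp: lookup_single when_def split: if_splits)
  then show ?thesis by (auto simp: grp_def phi_eq_iff)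
qed

lemma grp_ne_0 [simp]: "grp \<phi> a \<noteq> 0"
  using grp_add[of a "- a"] by (auto simp: grp_0)

lemma grp_minus: "grp \<phi> (- a) = inverse (grp \<phi> a)"
  using grp_add[of a "- a"] by (simp add: grp_0 inverse_unique)

lemma phi_single: "\<phi> (Poly_Mapping.single g c) = scal c * grp \<phi> g"
  by (simp add: grp_def phi_mult[symmetric] mult_single)

lemma two_ne_0: "(2 :: 'q) \<noteq> 0"
proof
  assume "(2 :: 'q) = 0"
  then have "scal 2 = 0"
    using phi_add[of 1 1] by (simp add: phi_1)
  then have "Poly_Mapping.single (0::promislow) (2::'k) = 0" using phi_eq_iff[of _ 0] phi_0 by simp
  then have "(2::'k) = 0" using lookup_single_eq[of "0::promislow" "2::'k"] by simp
  then have "CHAR('k) dvd 2"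
    using of_nat_eq_0_iff_char_dvd[of 2, where ?'a = 'k] by simp
  then have "CHAR('k) = 1 \<or> CHAR('k) = 2"
    using two_is_prime_nat unfolding prime_nat_iff by blast
  then show False using char_ne_2 CHAR_not_1'[where ?'a = 'k] by simp
qed

lemma scal_comm_phi: "comm (\<phi> p) (scal c)"
  by (induction p rule: poly_mapping_single_induct)
     (auto simp: comm_def phi_0 phi_mult[symmetric] mult_single mult.commute phi_add distrib_left distrib_right)

text \<open>Every element of the division ring is a fraction of elements of the group ring.\<close>

lemma comm_phi_center: "q \<in> skew_center" if "\<And>p. comm (\<phi> p) q"
proof -
  have "comm q r" for r
  proof -
    obtain a b where "r = \<phi> a * inverse (\<phi> b)"
      using ore unfolding ore_fraction_field_def by meson
    then show ?thesis using comm_sym[OF that] by (auto intro: comm_mult comm_inverse)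
  qed
  then show ?thesis by (simp add: skew_center_def comm_def)
qed

lemma scal_center: "scal c \<in> skew_center"
  using scal_comm_phi by (rule comm_phi_center)

lemma grp_relations:
  "s * s = x" "t * t = y" "u = s * t" "z = u * u"
  "t * x = ix * t" "s * y = iy * s" "t * ix = x * t" "s * iy = y * s"
  "s * x = x * s" "s * ix = ix * s" "t * y = y * t" "t * iy = iy * t"
  "y * x = x * y" "y * ix = ix * y" "iy * x = x * iy" "iy * ix = ix * iy"
  "inverse s = ix * s" "inverse t = iy * t"
  using promislow_add_simps by (simp_all flip: grp_add grp_minus add: gu_def gz_def)

lemma iz_conj: "s * iz = z * s" "s * z = iz * s" "t * z = iz * t" "t * iz = z * t"
proof -
  have g: "gs + - gz = gz + gs"
    using arg_cong[OF gs_conj_gz, of "\<lambda>g. gs + g"] by (simp add: add.assoc[symmetric])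
  show 1: "s * iz = z * s"
    using g by (simp flip: grp_add grp_minus)
  have swap: "a * z = iz * a" if "a * iz = z * a" for a
  proof -
    have "a * z = iz * (z * a) * z" by (simp flip: mult.assoc)
    also have "\<dots> = iz * (a * iz) * z" by (simp only: that)
    finally show ?thesis by (simp add: mult.assoc)
  qed
  have swap': "a * iz = z * a" if "a * z = iz * a" for a
  proof -
    have "a * iz = z * (iz * a) * iz" by (simp flip: mult.assoc)
    also have "\<dots> = z * (a * z) * iz" by (simp only: that)
    finally show ?thesis by (simp add: mult.assoc)
  qed
  show "s * z = iz * s" using 1 by (rule swap)
  have "gt + gz = - gs + gz + gs + gt"
    by (simp add: gz_def gu_def add.assoc)
  then have "gt + gz = - gz + gt" by (simp only: gs_conj_gz)
  then show 2: "t * z = iz * t" by (simp flip: grp_add grp_minus)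
  show "t * iz = z * t" using 2 by (rule swap')
qed

lemma comm_xyz: "z * x = x * z" "z * y = y * z"
proof -
  have "u * x = ix * u"
    by (simp add: grp_relations(3) mult.assoc grp_relations(5))
      (simp add: grp_relations(10) flip: mult.assoc)
  moreover have "u * ix = x * u"
    by (simp add: grp_relations(3) mult.assoc grp_relations(7))
      (simp add: grp_relations(9) flip: mult.assoc)
  ultimately show "z * x = x * z"
    by (simp add: grp_relations(4) mult.assoc) (simp flip: mult.assoc)
  have "u * y = iy * u"
    by (simp add: grp_relations(3) mult.assoc grp_relations(11))
      (simp add: grp_relations(6) flip: mult.assoc)
  moreover have "u * iy = y * u"
    by (simp add: grp_relations(3) mult.assoc grp_relations(12))
      (simp add: grp_relations(8) flip: mult.assoc)
  ultimately show "z * y = y * z"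
    by (simp add: grp_relations(4) mult.assoc) (simp flip: mult.assoc)
qed

lemma comm_inverses: "z * ix = ix * z" "iz * x = x * iz" "iz * ix = ix * iz"
   "z * iy = iy * z" "iz * y = y * iz" "iz * iy = iy * iz"
  using comm_xyz comm_inverse[of z x] comm_inverse[of x z] comm_inverse[of ix z] comm_inverse[of z y]
    comm_inverse[of y z] comm_inverse[of iy z]
  unfolding comm_def by metis+

text \<open>With this rule all words in the generators have the form of a monomial in \<open>x\<close>, \<open>y\<close>, \<open>z\<close> followed by one of
\<open>1, s, t, s t\<close>. It comes from \<open>s t s t = z\<close>.\<close>

lemma t_s: "t * s = ix * (y * (iz * (s * t)))"
proof -
  have "s * (t * s) * t = z"
    by (simp add: grp_relations(3,4) mult.assoc)
  then have "inverse s * (s * (t * s) * t) * inverse t = inverse s * z * inverse t" by simp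
  then have "t * s = inverse s * z * inverse t"
    by (simp add: mult.assoc flip: mult.assoc[of "inverse s" s])
  also have "\<dots> = ix * (s * z) * (iy * t)"
    by (simp add: grp_relations(17,18) mult.assoc)
  also have "\<dots> = ix * iz * (s * iy) * t"
    by (simp add: iz_conj mult.assoc)
  also have "\<dots> = ix * (iz * y) * s * t"
    by (simp add: grp_relations mult.assoc)
  finally show ?thesis by (simp add: comm_inverses mult.assoc)
qed

lemma extend_right: "a * b = c \<Longrightarrow> a * (b * e) = c * (e :: 'q)"
  by (simp flip: mult.assoc)

lemma inverse_cancel: "x * ix = 1" "ix * x = 1" "y * iy = 1" "iy * y = 1" "z * iz = 1" "iz * z = 1"
  by simp_all

text \<open>Each rule is used in two versions, for a product at the end of a word and for a product followed by
further letters.\<close>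

lemmas normal_form_rules = grp_relations(1,2,5-16) iz_conj comm_xyz comm_inverses t_s inverse_cancel

lemmas normal_form = normal_form_rules normal_form_rules[THEN extend_right] grp_relations(17,18) mult.assoc inverse_mult_distrib
  grp_relations(3)

text \<open>Elements commuting with \<open>s\<close> and \<open>t\<close> commute with the group ring, because the scalars are central.\<close>

lemma centerI:
  assumes "comm s r" "comm t r"
  shows "r \<in> skew_center"
proof (rule comm_phi_center)
  have i: "comm (inverse s) r" "comm (inverse t) r"
    by (rule comm_sym[OF comm_inverse[OF comm_sym[OF assms(1)]]],
        rule comm_sym[OF comm_inverse[OF comm_sym[OF assms(2)]]])
  have mult: "comm (a * b) r" if "comm a r" "comm b r" for a b
    by (rule comm_sym, rule comm_mult; rule comm_sym, rule that)
  have add': "comm (a + b) r" if "comm a r" "comm b r" for a b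
    by (rule comm_sym, rule comm_add; rule comm_sym, rule that)
  have g: "comm (grp \<phi> g) r" for g
  proof (induction g rule: promislow_induct)
    case zero
    then show ?case unfolding grp_0 by (rule comm_sym[OF comm_1])
  next
    case (gs g)
    then show ?case unfolding grp_add by (intro mult assms)
  next
    case (gs_inv g)
    then show ?case unfolding grp_add grp_minus by (intro mult i)
  next
    case (gt g)
    then show ?case unfolding grp_add by (intro mult assms)
  next
    case (gt_inv g)
    then show ?case unfolding grp_add grp_minus by (intro mult i)
  qed
  have c: "comm (scal c) r" for c
    unfolding comm_def by (rule center_comm[OF scal_center])
  show "comm (\<phi> p) r" for p
  proof (induction p rule: poly_mapping_single_induct)
    case zero
    then show ?case unfolding phi_0 by (rule comm_sym[OF comm_0])
  next
    case (single g c)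
    then show ?case by (subst phi_single) (rule mult[OF c g])
  next
    case (add p q)
    then show ?case unfolding phi_add by (rule add')
  qed
qed

section \<open>Laurent polynomials and the four cosets\<close>

abbreviation LR where "LR \<equiv> laurent_ring \<phi>"

lemma LR_closed:
  "1 \<in> LR" "0 \<in> LR" "a \<in> LR \<Longrightarrow> - a \<in> LR" "a \<in> LR \<Longrightarrow> b \<in> LR \<Longrightarrow> a + b \<in> LR"
  "a \<in> LR \<Longrightarrow> b \<in> LR \<Longrightarrow> a * b \<in> LR" "a \<in> LR \<Longrightarrow> b \<in> LR \<Longrightarrow> a - b \<in> LR"
  "scal c \<in> LR" "x \<in> LR" "ix \<in> LR" "y \<in> LR" "iy \<in> LR" "z \<in> LR" "iz \<in> LR"
  unfolding laurent_ring_def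
  by (auto intro: gen_ring_closed simp: scalars_def)

lemma LR_induct [consumes 1, case_names scal x ix y iy z iz minus add mult]:
  assumes "a \<in> LR" "\<And>c. P (scal c)" "P x" "P ix" "P y" "P iy" "P z" "P iz" "\<And>a. P a \<Longrightarrow> P (- a)"
    "\<And>a b. P a \<Longrightarrow> P b \<Longrightarrow> P (a + b)" "\<And>a b. P a \<Longrightarrow> P b \<Longrightarrow> P (a * b)"
  shows "P a"
proof -
  have "P 1" using assms(2)[of 1] by (simp add: phi_1)
  with assms show ?thesis unfolding laurent_ring_def
    by (induction rule: gen_ring_induct) (auto simp: scalars_def)
qed

lemma LR_comm_gen: "f \<in> LR \<Longrightarrow> comm x f \<and> comm y f \<and> comm z f"
proof (induction rule: LR_induct)
  case (scal c)
  then show ?case unfolding comm_def using center_comm[OF scal_center] by metis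
next
  case (minus a)
  then show ?case by (intro conjI comm_minus) blast+
next
  case (add a b)
  then show ?case by (intro conjI comm_add) blast+
next
  case (mult a b)
  then show ?case by (intro conjI comm_mult) blast+
qed (simp_all add: comm_def normal_form)

lemma LR_comm:
  assumes "f \<in> LR" "g \<in> LR" shows "comm f g"
proof -
  have gen: "comm f x" "comm f y" "comm f z"
    using LR_comm_gen[OF assms(1)] by (auto simp: comm_def)
  show ?thesis using assms(2)
  proof (induction rule: LR_induct)
    case (scal c)
    show ?case unfolding comm_def by (rule center_comm[OF scal_center, symmetric])
  qed (auto intro: comm_add comm_mult comm_minus comm_inverse gen)
qed

text \<open>Conjugation by \<open>s\<close> and \<open>t\<close> maps the generators of the Laurent polynomial ring to generators.\<close>

lemma LR_conj: "f \<in> LR \<Longrightarrow> (\<exists>g\<in>LR. s * f = g * s) \<and> (\<exists>g\<in>LR. t * f = g * t)"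
proof (induction rule: LR_induct)
  case (scal c)
  have "s * scal c = scal c * s" "t * scal c = scal c * t"
    by (simp_all add: center_comm[OF scal_center, of c s] center_comm[OF scal_center, of c t])
  then show ?case using LR_closed(7) by blast
next
  case (minus a)
  then obtain g h where "g \<in> LR" "h \<in> LR" "s * a = g * s" "t * a = h * t" by blast
  then have "s * (- a) = (- g) * s" "t * (- a) = (- h) * t" "- g \<in> LR" "- h \<in> LR"
    by (simp_all add: LR_closed)
  then show ?case by blast
next
  case (add a b)
  then obtain g h g' h' where "g \<in> LR" "h \<in> LR" "s * a = g * s" "t * a = h * t"
     "g' \<in> LR" "h' \<in> LR" "s * b = g' * s" "t * b = h' * t" by blast
  then have "s * (a + b) = (g + g') * s" "t * (a + b) = (h + h') * t" "g + g' \<in> LR" "h + h' \<in> LR"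
    by (simp_all add: LR_closed distrib_left distrib_right)
  then show ?case by blast
next
  case (mult a b)
  then obtain g h g' h' where *: "g \<in> LR" "h \<in> LR" "s * a = g * s" "t * a = h * t"
     "g' \<in> LR" "h' \<in> LR" "s * b = g' * s" "t * b = h' * t" by blast
  then have "s * (a * b) = (g * g') * s" "t * (a * b) = (h * h') * t"
    using extend_right[OF *(3), of b] extend_right[OF *(4), of b] by (simp_all add: mult.assoc)
  moreover have "g * g' \<in> LR" "h * h' \<in> LR" by (intro LR_closed *)+
  ultimately show ?case by blast
next
  case x
  show ?case using grp_relations LR_closed by blast
next
  case ix
  show ?case using grp_relations LR_closed by blast
next
  case y
  show ?case using grp_relations LR_closed by blast
next
  case iy
  show ?case using grp_relations LR_closed by blast
next
  case z
  show ?case using iz_conj LR_closed by blast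
next
  case iz
  show ?case using iz_conj LR_closed by blast
qed

definition sconj where "sconj f = s * f * inverse s"
definition tconj where "tconj f = t * f * inverse t"

lemma s_mult: "s * f = sconj f * s" and t_mult: "t * f = tconj f * t"
  by (simp_all add: sconj_def tconj_def mult.assoc)

lemma LR_sconj: "f \<in> LR \<Longrightarrow> sconj f \<in> LR"
proof -
  assume "f \<in> LR"
  then obtain g where "g \<in> LR" "s * f = g * s" using LR_conj by blast
  then show ?thesis unfolding sconj_def by (simp add: mult.assoc)
qed

lemma LR_tconj: "f \<in> LR \<Longrightarrow> tconj f \<in> LR"
proof -
  assume "f \<in> LR"
  then obtain g where "g \<in> LR" "t * f = g * t" using LR_conj by blast
  then show ?thesis unfolding tconj_def by (simp add: mult.assoc)
qed

lemma range_phi_closed: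
  "a \<in> range \<phi> \<Longrightarrow> - a \<in> range \<phi>"
  "a \<in> range \<phi> \<Longrightarrow> b \<in> range \<phi> \<Longrightarrow> a + b \<in> range \<phi>"
  "a \<in> range \<phi> \<Longrightarrow> b \<in> range \<phi> \<Longrightarrow> a - b \<in> range \<phi>"
  "a \<in> range \<phi> \<Longrightarrow> b \<in> range \<phi> \<Longrightarrow> a * b \<in> range \<phi>"
  "grp \<phi> g \<in> range \<phi>" "scal c \<in> range \<phi>" "1 \<in> range \<phi>"
  by (auto simp flip: phi_minus phi_add phi_diff phi_mult simp: grp_def) (metis phi_1 rangeI)

lemma LR_phi: "f \<in> LR \<Longrightarrow> f \<in> range \<phi>"
proof (induction rule: LR_induct)
  case ix show ?case by (metis grp_minus range_phi_closed(5))
next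
  case iy show ?case by (metis grp_minus range_phi_closed(5))
next
  case iz show ?case by (metis grp_minus range_phi_closed(5))
qed (rule range_phi_closed; assumption)+

text \<open>For a group element \<open>f\<close> could be taken as a monomial; a Laurent polynomial is as good and needs no separate
closure properties.\<close>

definition in_coset where "in_coset v \<longleftrightarrow> (\<exists>f\<in>LR. v \<in> {f, f * s, f * t, f * u})"

lemma in_coset_LR: "f \<in> LR \<Longrightarrow> in_coset v \<Longrightarrow> in_coset (f * v)"
  unfolding in_coset_def by (auto simp: mult.assoc[symmetric] intro: LR_closed)

lemma in_coset_s: "in_coset v \<Longrightarrow> in_coset (s * v)"
proof -
  assume "in_coset v"
  then obtain f where f: "f \<in> LR" and v: "v \<in> {f, f * s, f * t, f * u}"
    unfolding in_coset_def by blast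
  obtain f' where f': "f' \<in> LR" "s * f = f' * s" using LR_conj[OF f] by blast
  have "s * (f * s) = f' * x" "s * (f * t) = f' * u" "s * (f * u) = f' * x * t"
    by (simp_all only: extend_right[OF f'(2)]) (simp_all only: normal_form)
  note e = this f'(2)
  have "s * v \<in> {f' * s, f' * x, f' * u, f' * x * t}"
    using v unfolding insert_iff by (elim disjE; simp only: e simp_thms empty_iff)
  moreover have "f' * x \<in> LR" by (intro LR_closed f')
  ultimately show ?thesis unfolding in_coset_def using f' by auto
qed

lemma in_coset_t: "in_coset v \<Longrightarrow> in_coset (t * v)"
proof -
  assume "in_coset v"
  then obtain f where f: "f \<in> LR" and v: "v \<in> {f, f * s, f * t, f * u}"
    unfolding in_coset_def by blast
  obtain f' where f': "f' \<in> LR" "t * f = f' * t" using LR_conj[OF f] by blast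
  have "t * (f * s) = f' * (ix * y * iz) * u" "t * (f * t) = f' * y" "t * (f * u) = f' * (ix * iz) * s"
    by (simp_all only: extend_right[OF f'(2)]) (simp_all only: normal_form mult_1_left)
  note e = this f'(2)
  have "t * v \<in> {f' * t, f' * (ix * y * iz) * u, f' * y, f' * (ix * iz) * s}"
    using v unfolding insert_iff by (elim disjE; simp only: e simp_thms empty_iff)
  moreover have "f' * (ix * y * iz) \<in> LR" "f' * y \<in> LR" "f' * (ix * iz) \<in> LR"
    by (intro LR_closed f')+
  ultimately show ?thesis unfolding in_coset_def using f' by auto
qed

lemma grp_coset: "in_coset (grp \<phi> g)"
proof (induction g rule: promislow_induct)
  case zero
  then show ?case using LR_closed(1) by (auto simp: grp_0 in_coset_def)
next
  case (gs g)
  then show ?case by (simp add: grp_add in_coset_s)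
next
  case (gs_inv g)
  then show ?case
    by (simp add: grp_add grp_minus grp_relations(17) mult.assoc in_coset_LR in_coset_s LR_closed)
next
  case (gt g)
  then show ?case by (simp add: grp_add in_coset_t)
next
  case (gt_inv g)
  then show ?case
    by (simp add: grp_add grp_minus grp_relations(18) mult.assoc in_coset_LR in_coset_t LR_closed)
qed

lemma phi_decomp: "\<exists>a\<in>LR. \<exists>b\<in>LR. \<exists>c\<in>LR. \<exists>d\<in>LR. \<phi> p = a + b * s + c * t + d * u"
proof (induction p rule: poly_mapping_single_induct)
  case zero
  show ?case using LR_closed(2) by (auto simp: phi_0 intro!: bexI[of _ 0])
next
  case (single g c)
  obtain f where f: "f \<in> LR" "grp \<phi> g \<in> {f, f * s, f * t, f * u}"
    using grp_coset unfolding in_coset_def by blast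
  have c: "scal c * f \<in> LR" by (intro LR_closed f)
  have "\<phi> (Poly_Mapping.single g c) \<in> {scal c * f, scal c * f * s, scal c * f * t, scal c * f * u}"
    using f(2) unfolding insert_iff phi_single[of g c]
    by (elim disjE; simp only: mult.assoc simp_thms empty_iff)
  then show ?case
  proof (elim insertE)
    show ?thesis if "\<phi> (Poly_Mapping.single g c) = scal c * f"
      using that c LR_closed(2) by (intro bexI[of _ "scal c * f"] bexI[of _ 0]) auto
    show ?thesis if "\<phi> (Poly_Mapping.single g c) = scal c * f * s"
      using that c LR_closed(2) by (intro bexI[of _ 0] bexI[of _ "scal c * f"]  bexI[of _ 0]) auto
    show ?thesis if "\<phi> (Poly_Mapping.single g c) = scal c * f * t"
      using that c LR_closed(2) by (intro bexI[of _ 0] bexI[of _ 0] bexI[of _ "scal c * f"] bexI[of _ 0]) auto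
    show ?thesis if "\<phi> (Poly_Mapping.single g c) = scal c * f * u"
      using that c LR_closed(2) by (intro bexI[of _ 0] bexI[of _ 0] bexI[of _ 0] bexI[of _ "scal c * f"]) auto
  qed simp
next
  case (add p q)
  obtain a b c d where 1: "a \<in> LR" "b \<in> LR" "c \<in> LR" "d \<in> LR" "\<phi> p = a + b * s + c * t + d * u"
    using add(1) by (elim bexE) (rule that)
  obtain a' b' c' d' where 2: "a' \<in> LR" "b' \<in> LR" "c' \<in> LR" "d' \<in> LR" "\<phi> q = a' + b' * s + c' * t + d' * u"
    using add(2) by (elim bexE) (rule that)
  have "\<phi> (p + q) = (a + a') + (b + b') * s + (c + c') * t + (d + d') * u"
    unfolding phi_add 1(5) 2(5) by (simp add: distrib_right)
  moreover have "a + a' \<in> LR" "b + b' \<in> LR" "c + c' \<in> LR" "d + d' \<in> LR"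
    by (rule LR_closed(4)[OF 1(1) 2(1)], rule LR_closed(4)[OF 1(2) 2(2)],
        rule LR_closed(4)[OF 1(3) 2(3)], rule LR_closed(4)[OF 1(4) 2(4)])
  ultimately show ?case by blast
qed

section \<open>The elements kappa and omega\<close>

lemma sq_eq_1: "a = 1 \<or> a = - 1" if "a * a = (1 :: 'q)" for a
proof -
  have "(a - 1) * (a + 1) = 0" using that by (simp add: algebra_simps)
  then show ?thesis by (auto simp: eq_neg_iff_add_eq_0)
qed

lemma xyz_ne_pm1: "x \<noteq> 1" "y \<noteq> 1" "z \<noteq> 1" "x \<noteq> - 1" "y \<noteq> - 1" "z \<noteq> - 1"
proof -
  have n: "grp \<phi> g \<noteq> 1" if "g \<noteq> 0" for g
    using that grp_eq_iff[of g 0] by (simp add: grp_0)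
  have m: "grp \<phi> g \<noteq> - 1" if "g + g \<noteq> 0" for g
    using n[OF that] by (auto simp: grp_add)
  show "x \<noteq> 1" "y \<noteq> 1" "z \<noteq> 1" "x \<noteq> - 1" "y \<noteq> - 1" "z \<noteq> - 1"
    by (rule n m; rule axis_elements_ne_0)+
qed

lemma half_center: "inverse 2 \<in> (skew_center :: 'q set)"
proof -
  have "(2 :: 'q) \<in> skew_center"
    using center_closed(3)[OF center_closed(2) center_closed(2)] by simp
  then show ?thesis by (rule center_closed(7))
qed

lemma half_mult: "(a / 2) * b = (a * b) / (2 :: 'q)" "a * (b / 2) = (a * b) / (2 :: 'q)"
proof -
  show "(a / 2) * b = (a * b) / (2 :: 'q)"
    unfolding divide_inverse mult.assoc center_comm[OF half_center, of b] ..
  show "a * (b / 2) = (a * b) / (2 :: 'q)"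
    unfolding divide_inverse mult.assoc ..
qed

lemma half_add: "(a / 2) + (a / 2) = (a :: 'q)"
  by (metis divide_inverse distrib_left mult.assoc mult_2_right mult_1_right left_inverse two_ne_0 mult_2)

text \<open>The elements \<open>\<kappa>\<close> and \<open>\<omega>\<close> involve the factor 1/2. In a skew field it is more convenient to compare doubles
than to rewrite with this factor.\<close>

lemma double_eq_iff: "a + a = b + b \<longleftrightarrow> a = (b :: 'q)"
proof
  assume "a + a = b + b"
  then have "2 * a = 2 * b" by (simp add: mult_2)
  then show "a = b" using two_ne_0 by simp
qed simp

lemma double_eq_0: "a + a = 0 \<longleftrightarrow> a = (0 :: 'q)"
  using double_eq_iff[of a 0] by simp

abbreviation kx where "kx \<equiv> kap \<phi> gx"
abbreviation ky where "ky \<equiv> kap \<phi> gy"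
abbreviation kz where "kz \<equiv> kap \<phi> gz"
abbreviation wx where "wx \<equiv> omg \<phi> gx"
abbreviation wy where "wy \<equiv> omg \<phi> gy"
abbreviation wz where "wz \<equiv> omg \<phi> gz"

lemma kap_double: "kap \<phi> g + kap \<phi> g = grp \<phi> g + inverse (grp \<phi> g)"
  unfolding kap_def by (rule half_add)

lemma omg_double: "omg \<phi> g + omg \<phi> g = grp \<phi> g - inverse (grp \<phi> g)"
  unfolding omg_def by (rule half_add)

lemma kap_plus_omg: "grp \<phi> g = kap \<phi> g + omg \<phi> g"
proof -
  have "(kap \<phi> g + omg \<phi> g) + (kap \<phi> g + omg \<phi> g) = (kap \<phi> g + kap \<phi> g) + (omg \<phi> g + omg \<phi> g)"
    by (simp only: ac_simps)
  also have "\<dots> = grp \<phi> g + grp \<phi> g" unfolding kap_double omg_double by simp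
  finally show ?thesis by (simp only: double_eq_iff)
qed

lemma kap_minus_omg: "inverse (grp \<phi> g) = kap \<phi> g - omg \<phi> g"
  using kap_double[of g] kap_plus_omg[of g] by (simp add: algebra_simps)

lemma kap_center: "kx \<in> skew_center" "ky \<in> skew_center" "kz \<in> skew_center"
  by (rule centerI; simp only: comm_def kap_def half_mult distrib_left distrib_right normal_form; simp only: add.commute)+

lemma omg_s: "s * wx = wx * s" "s * wy = - (wy * s)" "s * wz = - (wz * s)"
  and omg_t: "t * wx = - (wx * t)" "t * wy = wy * t" "t * wz = - (wz * t)"
  by (simp_all only: omg_def half_mult left_diff_distrib right_diff_distrib normal_form minus_divide_left minus_diff_eq)

lemma half_LR: "inverse 2 \<in> LR"
proof -
  have "(2::'k) \<noteq> 0"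
  proof
    assume "(2::'k) = 0"
    then have "scal (2::'k) = 0" using phi_0 by simp
    moreover have "scal (2::'k) = 2" using phi_add[of 1 1] phi_1 by simp
    ultimately show False using two_ne_0 by simp
  qed
  then have "Poly_Mapping.single (0::promislow) (2::'k) * Poly_Mapping.single 0 (inverse 2) = 1"
    by (simp add: mult_single del: single_numeral)
  then have "\<phi> 2 * scal (inverse (2::'k)) = 1"
    by (metis phi_mult phi_1 single_numeral)
  moreover have "\<phi> 2 = 2" using phi_add[of 1 1] phi_1 by simp
  ultimately have "inverse 2 = scal (inverse (2::'k))"
    by (metis inverse_unique)
  then show ?thesis using LR_closed(7) by metis
qed

lemma LR_half: "f \<in> LR \<Longrightarrow> f / 2 \<in> LR"
  unfolding divide_inverse by (rule LR_closed(5)[OF _ half_LR])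

lemma kap_omg_LR: "kx \<in> LR" "ky \<in> LR" "kz \<in> LR" "wx \<in> LR" "wy \<in> LR" "wz \<in> LR"
  unfolding kap_def omg_def by (intro LR_half LR_closed)+

lemma omg_sq: "omg \<phi> g * omg \<phi> g = kap \<phi> g * kap \<phi> g - 1" if "kap \<phi> g \<in> skew_center"
proof -
  have "1 = (kap \<phi> g + omg \<phi> g) * (kap \<phi> g - omg \<phi> g)"
    by (simp flip: kap_plus_omg kap_minus_omg)
  then show ?thesis using center_comm[OF that, of "omg \<phi> g"] by (simp add: algebra_simps)
qed

lemma omg_sq_center: "wx * wx \<in> skew_center"
  unfolding omg_sq[OF kap_center(1)] by (intro center_closed kap_center)

lemma omg_ne_0: "wx \<noteq> 0" "wy \<noteq> 0" "wz \<noteq> 0"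
proof -
  have "omg \<phi> g \<noteq> 0" if "grp \<phi> g \<noteq> 1" "grp \<phi> g \<noteq> - 1" for g
  proof
    assume "omg \<phi> g = 0"
    then have "grp \<phi> g = inverse (grp \<phi> g)" using omg_double[of g] by simp
    then have "grp \<phi> g * grp \<phi> g = 1" by (metis grp_ne_0 right_inverse)
    then show False using sq_eq_1 that by blast
  qed
  from this[OF xyz_ne_pm1(1,4)] this[OF xyz_ne_pm1(2,5)] this[OF xyz_ne_pm1(3,6)]
  show "wx \<noteq> 0" "wy \<noteq> 0" "wz \<noteq> 0" .
qed

text \<open>If \<open>(x + x\<^sup>-\<^sup>1)\<^sup>2 = 1\<close>, then \<open>x\<^sup>4 + x\<^sup>2 + 1 = 0\<close>, hence \<open>x\<^sup>6 = 1\<close>.\<close>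

lemma double_kx_sq_ne_1: "(kx + kx) * (kx + kx) \<noteq> 1"
proof
  assume "(kx + kx) * (kx + kx) = 1"
  then have "(x + ix) * (x + ix) = 1" by (simp only: kap_double)
  \<comment> \<open>the left-hand side is \<open>(x\<^sup>2 - 1) (x\<^sup>4 + x\<^sup>2 + 1)\<close>\<close>
  then have "(x * x - 1) * x * ((x + ix) * (x + ix) - 1) * x = 0" by simp
  then have "x * x * x * x * x * x = 1"
    by (simp add: algebra_simps normal_form_rules[THEN extend_right])
  moreover have "x * x * x * x * x * x = grp \<phi> (gx + gx + gx + gx + gx + gx)"
    by (simp add: grp_add)
  ultimately show False using axis_elements_ne_0(7) grp_eq_iff[of _ 0] by (simp add: grp_0)
qed

section \<open>Central Laurent polynomials\<close>

abbreviation KR where "KR \<equiv> kappa_xi_ring \<phi>"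

lemma KR_closed:
  "1 \<in> KR" "0 \<in> KR" "a \<in> KR \<Longrightarrow> - a \<in> KR" "a \<in> KR \<Longrightarrow> b \<in> KR \<Longrightarrow> a + b \<in> KR"
  "a \<in> KR \<Longrightarrow> b \<in> KR \<Longrightarrow> a * b \<in> KR"
  "scal c \<in> KR" "kx \<in> KR" "ky \<in> KR" "kz \<in> KR" "xi \<phi> \<in> KR"
  unfolding kappa_xi_ring_def
  by (auto intro: gen_ring_closed simp: scalars_def)

lemma KR_LR: "a \<in> KR \<Longrightarrow> a \<in> LR"
  unfolding kappa_xi_ring_def
proof (induction rule: gen_ring_induct)
  case (gen h)
  then show ?case
    using kap_omg_LR LR_closed(7) LR_closed(5)[OF LR_closed(5)[OF kap_omg_LR(4,5)] kap_omg_LR(6)]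
    by (auto simp: scalars_def xi_def)
qed (simp_all add: LR_closed)

definition kappa_ring where "kappa_ring = generate_ring RTA (scalars \<phi> \<union> {kx, ky, kz})"

lemma kappa_ring_KR: "a \<in> kappa_ring \<Longrightarrow> a \<in> KR"
  unfolding kappa_ring_def
proof (induction rule: gen_ring_induct)
  case (gen h)
  then show ?case using KR_closed by (auto simp: scalars_def)
qed (simp_all add: KR_closed)

lemma kappa_ring_center: "a \<in> kappa_ring \<Longrightarrow> a \<in> skew_center"
  unfolding kappa_ring_def
proof (induction rule: gen_ring_induct)
  case (gen h)
  then show ?case using kap_center scal_center by (auto simp: scalars_def)
qed (simp_all add: center_closed)

definition subring_set :: "'q set \<Rightarrow> bool" where
  "subring_set R \<longleftrightarrow> 1 \<in> R \<and> (\<forall>a\<in>R. - a \<in> R) \<and> (\<forall>a\<in>R. \<forall>b\<in>R. a + b \<in> R \<and> a * b \<in> R)"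

text \<open>If \<open>w\<close> commutes with \<open>R\<close> and \<open>w\<^sup>2 \<in> R\<close>, this is the ring \<open>R[w]\<close>.\<close>

definition adjoin :: "'q set \<Rightarrow> 'q \<Rightarrow> 'q set" where
  "adjoin R w = {a + b * w | a b. a \<in> R \<and> b \<in> R}"

lemma subring_adjoin:
  assumes R: "subring_set R" and w: "w * w \<in> R" "\<And>a. a \<in> R \<Longrightarrow> comm a w"
  shows "subring_set (adjoin R w)" "R \<subseteq> adjoin R w" "w \<in> adjoin R w"
proof -
  have c: "1 \<in> R" "\<And>a. a \<in> R \<Longrightarrow> - a \<in> R" "\<And>a b. a \<in> R \<Longrightarrow> b \<in> R \<Longrightarrow> a + b \<in> R"
    "\<And>a b. a \<in> R \<Longrightarrow> b \<in> R \<Longrightarrow> a * b \<in> R"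
    using R by (auto simp: subring_set_def)
  have z: "0 \<in> R" using c(3)[OF c(1) c(2)[OF c(1)]] by simp
  have mem: "a + b * w \<in> adjoin R w" if "a \<in> R" "b \<in> R" for a b
    using that by (auto simp: adjoin_def)
  show "R \<subseteq> adjoin R w" using mem[OF _ z] by auto
  show "w \<in> adjoin R w" using mem[OF z c(1)] by simp
  show "subring_set (adjoin R w)"
    unfolding subring_set_def
  proof (intro conjI ballI)
    show "1 \<in> adjoin R w" using mem[OF c(1) z] by simp
  next
    fix p assume "p \<in> adjoin R w"
    then obtain a b where p: "p = a + b * w" "a \<in> R" "b \<in> R" by (auto simp: adjoin_def)
    show "- p \<in> adjoin R w" using mem[OF c(2)[OF p(2)] c(2)[OF p(3)]] p(1) by simp
  next
    fix p q assume "p \<in> adjoin R w" "q \<in> adjoin R w"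
    then obtain a b d e where p: "p = a + b * w" "a \<in> R" "b \<in> R" and q: "q = d + e * w" "d \<in> R" "e \<in> R"
      by (auto simp: adjoin_def)
    have "p + q = (a + d) + (b + e) * w" by (simp add: p q algebra_simps)
    then show "p + q \<in> adjoin R w" using mem[OF c(3)[OF p(2) q(2)] c(3)[OF p(3) q(3)]] by simp
    have wd: "w * d = d * w" "w * e = e * w" using w(2)[OF q(2)] w(2)[OF q(3)] by (auto simp: comm_def)
    have "b * w * (e * w) = b * (w * e) * w" by (simp only: mult.assoc)
    then have e4: "b * w * (e * w) = b * e * (w * w)" unfolding wd by (simp only: mult.assoc)
    have e5: "b * w * d = b * d * w" by (simp only: mult.assoc wd(1))
    have "p * q = a * d + a * e * w + (b * w * d + b * w * (e * w))"
      by (simp only: p(1) q(1) distrib_left distrib_right mult.assoc add_ac)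
    then have "p * q = (a * d + b * e * (w * w)) + (a * e + b * d) * w"
      unfolding e4 e5 by (simp only: distrib_right add_ac)
    then show "p * q \<in> adjoin R w"
      using mem[OF c(3)[OF c(4)[OF p(2) q(2)] c(4)[OF c(4)[OF p(3) q(3)] w(1)]] c(3)[OF c(4)[OF p(2) q(3)] c(4)[OF p(3) q(2)]]]
      by simp
  qed
qed

lemma subring_kappa_ring: "subring_set kappa_ring"
  unfolding subring_set_def kappa_ring_def by (blast intro: gen_ring_closed)

lemma omg_sq_kappa_ring: "wx * wx \<in> kappa_ring" "wy * wy \<in> kappa_ring" "wz * wz \<in> kappa_ring"
  unfolding omg_sq[OF kap_center(1)] omg_sq[OF kap_center(2)] omg_sq[OF kap_center(3)] kappa_ring_def
  by (rule gen_ring_closed(6)[OF gen_ring_closed(5) gen_ring_closed(1)]; rule gen_ring_closed(2); blast)+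

text \<open>Since \<open>g = \<kappa>\<^sub>g + \<omega>\<^sub>g\<close>, \<open>g\<^sup>-\<^sup>1 = \<kappa>\<^sub>g - \<omega>\<^sub>g\<close> and \<open>\<omega>\<^sub>g\<^sup>2 = \<kappa>\<^sub>g\<^sup>2 - 1\<close>, adjoining the three \<open>\<omega>\<^sub>g\<close> to the ring generated by the
\<open>\<kappa>\<^sub>g\<close> yields all Laurent polynomials.\<close>

lemma LR_quadratic_tower: "f \<in> LR \<Longrightarrow> f \<in> adjoin (adjoin (adjoin kappa_ring wx) wy) wz"
proof -
  have K_comm: "comm a w" if "a \<in> kappa_ring" for a w
    unfolding comm_def by (rule center_comm[OF kappa_ring_center[OF that]])
  have cw: "comm wx wy" "comm wx wz" "comm wy wz"
    using LR_comm kap_omg_LR by blast+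
  note 1 = subring_adjoin[OF subring_kappa_ring omg_sq_kappa_ring(1) K_comm]
  have c1: "comm a w" if ad: "a \<in> adjoin kappa_ring wx" and cw: "comm wx w" for a w
  proof -
    obtain p q where a: "a = p + q * wx" "p \<in> kappa_ring" "q \<in> kappa_ring" using ad unfolding adjoin_def by blast
    show ?thesis unfolding a(1)
      by (intro comm_sym[OF comm_add] comm_mult comm_sym[OF K_comm] a comm_sym[OF cw])
  qed
  note 2 = subring_adjoin[OF 1(1) subsetD[OF 1(2) omg_sq_kappa_ring(2)] c1[OF _ cw(1)]]
  have c2: "comm a wz" if ad: "a \<in> adjoin (adjoin kappa_ring wx) wy" for a
  proof -
    obtain p q where a: "a = p + q * wy" "p \<in> adjoin kappa_ring wx" "q \<in> adjoin kappa_ring wx" using ad unfolding adjoin_def by blast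
    show ?thesis unfolding a(1)
      by (intro comm_sym[OF comm_add] comm_mult comm_sym[OF c1[OF _ cw(2)]] a comm_sym[OF cw(3)])
  qed
  note 3 = subring_adjoin[OF 2(1) subsetD[OF 2(2) subsetD[OF 1(2) omg_sq_kappa_ring(3)]] c2]
  let ?R = "adjoin (adjoin (adjoin kappa_ring wx) wy) wz"
  have KR: "kappa_ring \<subseteq> ?R" using 1(2) 2(2) 3(2) by blast
  have w: "wx \<in> ?R" "wy \<in> ?R" "wz \<in> ?R" using 1(3) 2(2,3) 3(2,3) by blast+
  have c: "\<And>a. a \<in> ?R \<Longrightarrow> - a \<in> ?R" "\<And>a b. a \<in> ?R \<Longrightarrow> b \<in> ?R \<Longrightarrow> a + b \<in> ?R"
    "\<And>a b. a \<in> ?R \<Longrightarrow> b \<in> ?R \<Longrightarrow> a * b \<in> ?R"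
    using 3(1) unfolding subring_set_def by blast+
  have d: "a - b \<in> ?R" if "a \<in> ?R" "b \<in> ?R" for a b
    using c(2)[OF that(1) c(1)[OF that(2)]] by simp
  have "scal c \<in> kappa_ring" "kx \<in> kappa_ring" "ky \<in> kappa_ring" "kz \<in> kappa_ring" for c
    unfolding kappa_ring_def scalars_def by (rule gen_ring_closed(2); blast)+
  then have k: "scal c \<in> ?R" "kx \<in> ?R" "ky \<in> ?R" "kz \<in> ?R" for c
    using KR by blast+
  have g: "x \<in> ?R" "y \<in> ?R" "z \<in> ?R"
    by (subst kap_plus_omg, rule c(2); fact k w)+
  have ig: "ix \<in> ?R" "iy \<in> ?R" "iz \<in> ?R"
    unfolding kap_minus_omg by (rule d; fact k w)+
  assume "f \<in> LR"
  then show ?thesis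
    by (induction rule: LR_induct) (fact k g ig | rule c; assumption)+
qed

text \<open>By \<open>LR_quadratic_tower\<close> a Laurent polynomial is a combination of the eight products of distinct
\<open>\<omega>\<^sub>x, \<omega>\<^sub>y, \<omega>\<^sub>z\<close>. Conjugation by \<open>s\<close> and \<open>t\<close> changes their signs; only \<open>1\<close> and \<open>\<xi> = \<omega>\<^sub>x \<omega>\<^sub>y \<omega>\<^sub>z\<close> are invariant under both.\<close>

lemma central_LR_KR:
  assumes "f \<in> LR" "f \<in> skew_center"
  shows "f \<in> KR"
proof -
  obtain k0 k1 k2 k3 l0 l1 l2 l3 where
    f: "f = (k0 + k1 * wx + (k2 + k3 * wx) * wy) + (l0 + l1 * wx + (l2 + l3 * wx) * wy) * wz"
    and k: "k0 \<in> kappa_ring" "k1 \<in> kappa_ring" "k2 \<in> kappa_ring" "k3 \<in> kappa_ring" "l0 \<in> kappa_ring" "l1 \<in> kappa_ring" "l2 \<in> kappa_ring" "l3 \<in> kappa_ring"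
    using LR_quadratic_tower[OF assms(1)] unfolding adjoin_def by blast
  have ks: "a * k = k * a" "a * (k * b) = k * (a * b)" if "k \<in> kappa_ring" for k a b
    using center_comm[OF kappa_ring_center[OF that]] by (simp, metis mult.assoc)
  note os = omg_s omg_t
  have os': "s * (wx * e) = wx * (s * e)" "s * (wy * e) = - (wy * (s * e))" "s * (wz * e) = - (wz * (s * e))"
    "t * (wx * e) = - (wx * (t * e))" "t * (wy * e) = wy * (t * e)" "t * (wz * e) = - (wz * (t * e))" for e
    by (simp_all add: omg_s omg_t flip: mult.assoc)
  have "s * f = f * s" using center_comm[OF assms(2)] by simp
  moreover have "s * f = ((k0 + k1 * wx - (k2 + k3 * wx) * wy) - (l0 + l1 * wx - (l2 + l3 * wx) * wy) * wz) * s"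
    unfolding f by (simp add: algebra_simps os os' ks(2)[OF k(1)] ks(2)[OF k(2)] ks(2)[OF k(3)] ks(2)[OF k(4)]
      ks(2)[OF k(5)] ks(2)[OF k(6)] ks(2)[OF k(7)] ks(2)[OF k(8)] ks(1)[OF k(1), of s] ks(1)[OF k(5), of s])
  ultimately have fs: "f = (k0 + k1 * wx - (k2 + k3 * wx) * wy) - (l0 + l1 * wx - (l2 + l3 * wx) * wy) * wz"
    by (metis mult_right_cancel grp_ne_0)
  have f1: "f = k0 + k1 * wx + (l2 + l3 * wx) * wy * wz"
    by (subst double_eq_iff[symmetric], subst (1) f, subst (1) fs) (simp add: algebra_simps)
  have "t * f = f * t" using center_comm[OF assms(2)] by simp
  moreover have "t * f = (k0 - k1 * wx + (- l2 + l3 * wx) * wy * wz) * t"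
    unfolding f1 by (simp add: algebra_simps os os' ks(2)[OF k(1)] ks(2)[OF k(2)] ks(2)[OF k(7)] ks(2)[OF k(8)] ks(1)[OF k(1), of t])
  ultimately have ft: "f = k0 - k1 * wx + (- l2 + l3 * wx) * wy * wz"
    by (metis mult_right_cancel grp_ne_0)
  have "f = k0 + l3 * (wx * wy * wz)"
    by (subst double_eq_iff[symmetric], subst (1) f1, subst (1) ft) (simp add: algebra_simps)
  then show ?thesis
    using KR_closed kappa_ring_KR k by (simp add: xi_def)
qed

text \<open>Commuting with \<open>\<omega>\<^sub>x\<close> removes the components at \<open>t\<close> and \<open>u\<close>, commuting with \<open>\<omega>\<^sub>y\<close> the one at \<open>s\<close>.\<close>

lemma central_phi_KR:
  assumes "f \<in> range \<phi>" "f \<in> skew_center"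
  shows "f \<in> KR"
proof -
  obtain a b c d where f: "f = a + b * s + c * t + d * u" and l: "a \<in> LR" "b \<in> LR" "c \<in> LR" "d \<in> LR"
    using assms(1) phi_decomp by blast
  note zc = center_comm[OF assms(2)]
  have wl: "wx * a = a * wx" "wx * b = b * wx" "wx * c = c * wx" "wx * d = d * wx"
    "wy * a = a * wy" "wy * b = b * wy"
    using LR_comm[OF _ kap_omg_LR(4)] LR_comm[OF _ kap_omg_LR(5)] l by (auto simp: comm_def)
  have wl': "wx * (a * e) = a * (wx * e)" "wx * (b * e) = b * (wx * e)" "wx * (c * e) = c * (wx * e)"
    "wx * (d * e) = d * (wx * e)" "wy * (a * e) = a * (wy * e)" "wy * (b * e) = b * (wy * e)" for e
    by (simp_all add: wl flip: mult.assoc)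
  have sw: "wx * s = s * wx" "wx * t = - (t * wx)" "wx * (s * e) = s * (wx * e)" "wx * (t * e) = - (t * (wx * e))"
    "wy * s = - (s * wy)" for e
    by (simp_all add: omg_s omg_t flip: mult.assoc)
  have "wx * f = (a + b * s - c * t - d * u) * wx"
    unfolding f by (simp add: algebra_simps wl wl' sw grp_relations(3))
  moreover have "wx * f = f * wx" using zc by simp
  ultimately have "f = a + b * s - c * t - d * u" by (metis mult_right_cancel omg_ne_0(1))
  then have f1: "f = a + b * s"
    by (subst double_eq_iff[symmetric], subst (1) f) (simp add: algebra_simps)
  have "wy * f = (a - b * s) * wy"
    unfolding f1 by (simp add: algebra_simps wl wl' sw)
  moreover have "wy * f = f * wy" using zc by simp
  ultimately have "f = a - b * s" by (metis mult_right_cancel omg_ne_0(2))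
  then have "f = a"
    by (subst double_eq_iff[symmetric], subst (1) f1) (simp add: algebra_simps)
  then show ?thesis using central_LR_KR l assms(2) by simp
qed

section \<open>Squares and anticommutators in coordinates\<close>

text \<open>A commutative ring in which the polynomial identities of this section can be verified: the rules
\<open>CL_ac\<close> sort products of its elements, and only the membership of the atoms has to be supplied.\<close>

definition CL where "CL = generate_ring RTA (LR \<union> skew_center)"

lemma CL_mem: "f \<in> LR \<Longrightarrow> f \<in> CL" "f \<in> skew_center \<Longrightarrow> f \<in> CL"
  unfolding CL_def by (auto intro: gen_ring_closed)

lemma CL_comm:
  assumes "a \<in> CL" "b \<in> CL"
  shows "comm a b"
proof -
  have g: "comm a g" if "g \<in> LR \<union> skew_center" for g
    using assms(1) unfolding CL_def
  proof (induction rule: gen_ring_induct)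
    case (gen h)
    show ?case
    proof (cases "h \<in> skew_center \<or> g \<in> skew_center")
      case True
      then show ?thesis using center_comm unfolding comm_def by metis
    next
      case False
      then show ?thesis using LR_comm that gen by blast
    qed
  qed (blast intro: comm_sym[OF comm_add] comm_sym[OF comm_mult] comm_sym[OF comm_minus] comm_sym[OF comm_1] dest: comm_sym)+
  show ?thesis using assms(2) unfolding CL_def
    by (induction rule: gen_ring_induct) (auto intro: g comm_add comm_mult comm_minus comm_1)
qed

lemma CL_ac: "a \<in> CL \<Longrightarrow> b \<in> CL \<Longrightarrow> a * b = b * a"
  "a \<in> CL \<Longrightarrow> b \<in> CL \<Longrightarrow> a * (b * e) = b * (a * e)"
  using CL_comm[of a b] unfolding comm_def by (simp, metis mult.assoc)

lemma mult_4: "4 * a = a + a + a + (a :: 'q)"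
  using distrib_right[of 2 2 a] by (simp add: mult_2 add.assoc)

lemmas kap_omg_CL = kap_omg_LR[THEN CL_mem(1)]

text \<open>The four sums and differences \<open>t \<plusminus> t\<^sup>-\<^sup>1\<close> and \<open>u \<plusminus> u\<^sup>-\<^sup>1\<close>, written with \<open>t\<^sup>-\<^sup>1 = y\<^sup>-\<^sup>1 t\<close> and \<open>u\<^sup>-\<^sup>1 = z\<^sup>-\<^sup>1 u\<close>. They
multiply much more simply than \<open>t\<close> and \<open>u\<close>, and by \<open>ab_gamma_delta\<close> they underlie all \<open>\<gamma>\<^sub>i t\<close> and \<open>\<delta>\<^sub>i u\<close>.\<close>

definition pt where "pt = t + iy * t"
definition mt where "mt = t - iy * t"
definition pu where "pu = u + iz * u"
definition mu where "mu = u - iz * u"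

lemma pm_t: "pt * pt = (y + iy) + 2" "mt * mt = (y + iy) - 2" "pt * mt = y - iy" "mt * pt = y - iy"
  by (simp_all add: pt_def mt_def algebra_simps normal_form)

lemma pm_u: "pu * pu = (z + iz) + 2" "mu * mu = (z + iz) - 2" "pu * mu = z - iz" "mu * pu = z - iz"
  by (simp_all add: pu_def mu_def algebra_simps normal_form)

lemma pm_x: "pt * x = ix * pt" "mt * x = ix * mt" "pu * x = ix * pu" "mu * x = ix * mu"
  "pt * ix = x * pt" "mt * ix = x * mt" "pu * ix = x * pu" "mu * ix = x * mu"
  by (simp_all add: pt_def mt_def pu_def mu_def algebra_simps normal_form)

text \<open>Exchanging the two factors only costs the factor \<open>\<plusminus>x\<close>. This is why the anticommutators in \<open>anti_table\<close>
are multiples of \<open>W1\<close>, ..., \<open>W4\<close>.\<close>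

lemma pm_tu: "pu * pt = x * (pt * pu)" "mu * mt = x * (mt * mu)" "mu * pt = - (x * (pt * mu))" "pu * mt = - (x * (mt * pu))"
  by (simp_all add: pt_def mt_def pu_def mu_def algebra_simps normal_form)

definition anti where "anti a b = a * b + b * (a :: 'q)"

lemma anti_add: "anti (a + b) c = anti a c + anti b c" "anti a (b + c) = anti a b + anti a c"
  by (simp_all add: anti_def algebra_simps)

lemma center_pull:
  assumes c: "c \<in> skew_center" and d: "d \<in> skew_center"
  shows "(c * a) * (d * b) = (c * d) * (a * (b :: 'q))"
proof -
  have "c * a * (d * b) = c * (a * d) * b" by (simp only: mult.assoc)
  then show ?thesis unfolding center_comm[OF d, of a, symmetric] by (simp only: mult.assoc)
qed

lemma center_pull_comm:
  assumes c: "c \<in> skew_center" and d: "d \<in> skew_center" and ab: "a * b = b * (a :: 'q)"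
  shows "(c * a) * (d * b) = (d * b) * (c * a)"
  unfolding center_pull[OF c d] center_pull[OF d c] ab center_comm[OF c, of d] ..

lemma center_left_comm: "c \<in> skew_center \<Longrightarrow> q * (c * e) = c * (q * (e :: 'q))"
proof -
  assume c: "c \<in> skew_center"
  have "q * (c * e) = (q * c) * e" by (simp only: mult.assoc)
  then show ?thesis unfolding center_comm[OF c, of q, symmetric] by (simp only: mult.assoc)
qed

lemma add_comm4:
  "c * a = a * c \<Longrightarrow> c * b = b * c \<Longrightarrow> d * a = a * d \<Longrightarrow> d * b = b * d \<Longrightarrow> (c + d) * (a + b) = (a + b) * (c + (d :: 'q))"
  by (simp add: distrib_left distrib_right add_ac)

lemma anti_scale: "c \<in> skew_center \<Longrightarrow> d \<in> skew_center \<Longrightarrow> anti (c * a) (d * b) = (c * d) * anti a b"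
proof -
  assume c: "c \<in> skew_center" and d: "d \<in> skew_center"
  have "c * a * (d * b) = c * d * (a * b)" by (rule center_pull[OF c d])
  moreover have "d * b * (c * a) = c * d * (b * a)"
    unfolding center_pull[OF d c] center_comm[OF d, of c] ..
  ultimately show ?thesis by (simp only: anti_def distrib_left)
qed

text \<open>Here \<open>ai\<close> is \<open>\<gamma>\<^sub>i t\<close>, and \<open>bi\<close> is \<open>\<delta>\<^sub>i u\<close>. The \<open>Wi\<close> are the basis in which their anticommutators are expressed.\<close>

definition "W1 = (1 + x) * (mt * mu)"
definition "W2 = (1 + x) * (pt * pu)"
definition "W3 = (1 - x) * (pt * mu)"
definition "W4 = (1 - x) * (mt * pu)"
definition "a1 = (1 + x) * mt"
definition "a2 = (1 - x) * pt"
definition "a3 = (1 + x) * pt"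
definition "a4 = (1 - x) * mt"
definition "b1 = mu"
definition "b2 = (x - ix) * pu"
definition "b3 = pu"
definition "b4 = (x - ix) * mu"

lemmas pm_x' = pm_x[THEN extend_right] pm_tu[THEN extend_right]

lemma anti_table:
  "anti a1 b1 = W1 + W1" "anti a1 b2 = (2 + (x + ix)) * (W4 + W4)" "anti a1 b3 = 0" "anti a1 b4 = 0"
  "anti a2 b1 = W3 + W3" "anti a2 b2 = - ((2 - (x + ix)) * (W2 + W2))" "anti a2 b3 = 0" "anti a2 b4 = 0"
  "anti a3 b1 = 0" "anti a3 b2 = 0" "anti a3 b3 = W2 + W2" "anti a3 b4 = (2 + (x + ix)) * (W3 + W3)"
  "anti a4 b1 = 0" "anti a4 b2 = 0" "anti a4 b3 = W4 + W4" "anti a4 b4 = - ((2 - (x + ix)) * (W1 + W1))"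
  unfolding anti_def W1_def W2_def W3_def W4_def a1_def a2_def a3_def a4_def b1_def b2_def b3_def b4_def
  by (simp_all add: algebra_simps pm_x pm_x' pm_tu normal_form_rules(11-16) normal_form_rules[THEN extend_right] mult_2)

text \<open>Twice the components \<open>c t\<close> and \<open>d u\<close> of an odd element with coordinates \<open>C\<^sub>i\<close>, \<open>D\<^sub>i\<close>. In \<open>d\<close> the
weights of \<open>\<delta>\<^sub>1\<close> and \<open>\<delta>\<^sub>3\<close> are 1, all other weights in \<open>c\<close> and \<open>d\<close> are 1/2: this makes the square of
\<open>c t + d u\<close> agree with the coefficients in (a).\<close>

definition Psum where "Psum C1 C2 C3 C4 = C1 * a1 + C2 * a2 + C3 * a3 + C4 * a4"
definition Rsum where "Rsum D1 D2 D3 D4 = (D1 + D1) * b1 + D2 * b2 + (D3 + D3) * b3 + D4 * b4"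

text \<open>The four coefficients are those whose vanishing is parametrised by (c).\<close>

lemma anti_PR:
  assumes "{C1, C2, C3, C4, D1, D2, D3, D4} \<subseteq> skew_center"
  shows "anti (Psum C1 C2 C3 C4) (Rsum D1 D2 D3 D4) =
    4 * ((C1 * D1 - (1 - kx) * C4 * D4) * W1 + (C3 * D3 - (1 - kx) * C2 * D2) * W2
       + (C2 * D1 + (1 + kx) * C3 * D4) * W3 + (C4 * D3 + (1 + kx) * C1 * D2) * W4)"
proof -
  have c: "C1 \<in> skew_center" "C2 \<in> skew_center" "C3 \<in> skew_center" "C4 \<in> skew_center"
    "D1 \<in> skew_center" "D2 \<in> skew_center" "D3 \<in> skew_center" "D4 \<in> skew_center"
    "D1 + D1 \<in> skew_center" "D3 + D3 \<in> skew_center" using assms center_closed by auto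
  note cl = c[THEN CL_mem(2)] kap_omg_CL
  show ?thesis
    unfolding Psum_def Rsum_def anti_add
    by (simp only: anti_scale c anti_table kap_double[symmetric])
       (simp add: algebra_simps mult_2 mult_4 CL_ac cl)
qed

lemma sq_sum:
  assumes "a \<in> skew_center" "b \<in> skew_center" "p * m = m * p"
  shows "(a * m + b * p) * (a * m + b * p) = a * a * (m * m) + b * b * (p * p) + (2 * a * b) * (m * (p :: 'q))"
proof -
  have "(a * m) * (a * m) = a * a * (m * m)" "(a * m) * (b * p) = a * b * (m * p)"
    "(b * p) * (a * m) = b * a * (p * m)" "(b * p) * (b * p) = b * b * (p * p)"
    by (rule center_pull; fact)+
  then show ?thesis
    by (simp only: distrib_left distrib_right assms(3) center_comm[OF assms(2), of a] mult_2 add_ac)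
qed

text \<open>As \<open>P = (1 + x) M + (1 - x) M'\<close> with commuting \<open>M\<close>, \<open>M'\<close> that invert \<open>x\<close>, the mixed terms cancel:
\<open>(1 + x) (1 - x\<^sup>-\<^sup>1) + (1 - x) (1 + x\<^sup>-\<^sup>1) = 0\<close>. Up to constant factors, the coefficient of \<open>\<omega>\<^sub>y\<close> is the left-hand side of
(b) and the rest is the contribution of the \<open>C\<^sub>i\<close> to (a).\<close>

lemma P_sq:
  assumes "{C1, C2, C3, C4} \<subseteq> skew_center"
  shows "Psum C1 C2 C3 C4 * Psum C1 C2 C3 C4 =
    4 * ((C1^2 * (kx + 1) * (ky - 1) - C2^2 * (kx - 1) * (ky + 1)
     + C3^2 * (kx + 1) * (ky + 1) - C4^2 * (kx - 1) * (ky - 1))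
     - 2 * ((kx - 1) * C2 * C4 - (kx + 1) * C1 * C3) * wy)"
proof -
  have c: "C1 \<in> skew_center" "C2 \<in> skew_center" "C3 \<in> skew_center" "C4 \<in> skew_center"
    using assms by auto
  note cl = c[THEN CL_mem(2)] kap_omg_CL
  have cx: "C * x = x * C" "x * (C * e) = C * (x * e)" if "C \<in> skew_center" for C e
    by (rule center_comm[OF that], subst center_comm[OF that]) (simp only: mult.assoc center_comm[OF that, of e])
  define M where "M = C1 * mt + C3 * pt"
  define M' where "M' = C4 * mt + C2 * pt"
  have mx: "(a * mt + b * pt) * x = ix * (a * mt + b * pt)" if "a \<in> skew_center" "b \<in> skew_center" for a b
    by (simp only: distrib_left distrib_right mult.assoc pm_x center_left_comm[OF that(1), of ix]
      center_left_comm[OF that(2), of ix])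
  have Mx: "M * x = ix * M" "M' * x = ix * M'"
    unfolding M_def M'_def using mx c by auto
  have "(C4 * mt) * (C1 * mt) = (C1 * mt) * (C4 * mt)" "(C4 * mt) * (C3 * pt) = (C3 * pt) * (C4 * mt)"
    "(C2 * pt) * (C1 * mt) = (C1 * mt) * (C2 * pt)" "(C2 * pt) * (C3 * pt) = (C3 * pt) * (C2 * pt)"
    by (rule center_pull_comm; simp only: c pm_t)+
  then have MM: "M' * M = M * M'"
    unfolding M_def M'_def by (rule add_comm4)
  have P: "Psum C1 C2 C3 C4 = (1 + x) * M + (1 - x) * M'"
    unfolding Psum_def a1_def a2_def a3_def a4_def M_def M'_def
    by (simp add: algebra_simps cx c)
  have "Psum C1 C2 C3 C4 * Psum C1 C2 C3 C4 = (2 + (x + ix)) * (M * M) + (2 - (x + ix)) * (M' * M')"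
    unfolding P by (simp add: algebra_simps Mx Mx[THEN extend_right] MM MM[THEN extend_right] normal_form_rules[THEN extend_right] mult_2)
  also have "\<dots> = 2 * (1 + kx) * (M * M) + 2 * (1 - kx) * (M' * M')"
    unfolding kap_double[symmetric] by (simp add: algebra_simps mult_2)
  also have "M * M = C1 * C1 * (2 * ky - 2) + C3 * C3 * (2 * ky + 2) + (2 * C1 * C3) * (wy + wy)"
    unfolding M_def by (subst sq_sum[OF c(1,3)]) (simp_all add: pm_t flip: kap_double omg_double mult_2)
  also have "M' * M' = C4 * C4 * (2 * ky - 2) + C2 * C2 * (2 * ky + 2) + (2 * C4 * C2) * (wy + wy)"
    unfolding M'_def by (subst sq_sum[OF c(4,2)]) (simp_all add: pm_t flip: kap_double omg_double mult_2)
  finally show ?thesis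
    by (simp add: algebra_simps mult_2 mult_2_right mult_4 power2_eq_square CL_ac cl)
qed

text \<open>Like \<open>P_sq\<close>, with \<open>R = E + 2 \<omega> E'\<close>, where the mixed terms cancel because \<open>\<omega>\<close> anticommutes with \<open>E\<close> and \<open>E'\<close>.\<close>

lemma R_sq:
  assumes "{D1, D2, D3, D4} \<subseteq> skew_center"
  shows "Rsum D1 D2 D3 D4 * Rsum D1 D2 D3 D4 =
    4 * ((2 * D1^2 * (kz - 1) - 2 * D2^2 * wx^2 * (kz + 1) + 2 * D3^2 * (kz + 1) - 2 * D4^2 * wx^2 * (kz - 1))
     + 4 * (D1 * D3 - wx^2 * D2 * D4) * wz)"
proof -
  have c: "D1 \<in> skew_center" "D2 \<in> skew_center" "D3 \<in> skew_center" "D4 \<in> skew_center"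
    using assms by auto
  have c2: "D1 + D1 \<in> skew_center" "D3 + D3 \<in> skew_center" using c center_closed by blast+
  note cl = c[THEN CL_mem(2)] kap_omg_CL
  have w: "x - ix = wx + wx" by (simp add: omg_double)
  have cw: "D * wx = wx * D" "wx * (D * e) = D * (wx * e)" if "D \<in> skew_center" for D e
    by (rule center_comm[OF that], subst center_comm[OF that]) (simp only: mult.assoc center_comm[OF that, of e])
  have wxpu: "wx * pu = - (pu * wx)" "wx * mu = - (mu * wx)"
    unfolding pu_def mu_def using LR_comm[OF kap_omg_LR(4) LR_closed(13)]
    by (simp_all add: comm_def algebra_simps grp_relations(3) omg_s omg_t omg_s[THEN extend_right] omg_t[THEN extend_right]
       flip: mult.assoc[of wx iz])
  define E where "E = (D1 + D1) * mu + (D3 + D3) * pu"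
  define E' where "E' = D4 * mu + D2 * pu"
  have wE': "(c * mu + d * pu) * wx = - (wx * (c * mu + d * pu))" if "c \<in> skew_center" "d \<in> skew_center" for c d
    by (simp add: distrib_left distrib_right mult.assoc wxpu center_left_comm[OF that(1), of wx]
      center_left_comm[OF that(2), of wx])
  have wE: "E * wx = - (wx * E)" "E' * wx = - (wx * E')"
    unfolding E_def E'_def by (rule wE'; fact c c2)+
  have "(D4 * mu) * ((D1 + D1) * mu) = ((D1 + D1) * mu) * (D4 * mu)" "(D4 * mu) * ((D3 + D3) * pu) = ((D3 + D3) * pu) * (D4 * mu)"
    "(D2 * pu) * ((D1 + D1) * mu) = ((D1 + D1) * mu) * (D2 * pu)" "(D2 * pu) * ((D3 + D3) * pu) = ((D3 + D3) * pu) * (D2 * pu)"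
    by (rule center_pull_comm; simp only: c c2 pm_u)+
  then have EE: "E' * E = E * E'"
    unfolding E_def E'_def by (rule add_comm4)
  have R: "Rsum D1 D2 D3 D4 = E + (wx + wx) * E'"
    unfolding Rsum_def b1_def b2_def b3_def b4_def E_def E'_def w
    by (simp add: algebra_simps cw c)
  have "Rsum D1 D2 D3 D4 * Rsum D1 D2 D3 D4 = E * E - 4 * (wx * wx) * (E' * E')"
    unfolding R by (simp add: algebra_simps wE wE[THEN extend_right] EE EE[THEN extend_right] mult_2 mult_4)
  also have "E * E = (D1 + D1) * (D1 + D1) * (2 * kz - 2) + (D3 + D3) * (D3 + D3) * (2 * kz + 2)
      + (2 * (D1 + D1) * (D3 + D3)) * (wz + wz)"
    unfolding E_def by (subst sq_sum[OF c2]) (simp_all add: pm_u flip: kap_double omg_double mult_2)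
  also have "E' * E' = D4 * D4 * (2 * kz - 2) + D2 * D2 * (2 * kz + 2) + (2 * D4 * D2) * (wz + wz)"
    unfolding E'_def by (subst sq_sum[OF c(4,2)]) (simp_all add: pm_u flip: kap_double omg_double mult_2)
  finally show ?thesis
    by (simp add: algebra_simps mult_2 mult_2_right mult_4 power2_eq_square CL_ac cl)
qed

lemma Psum_gamma:
  assumes "{C1, C2, C3, C4} \<subseteq> skew_center"
  shows "Psum C1 C2 C3 C4 = (C1 * gamma1 \<phi> + C2 * gamma2 \<phi> + C3 * gamma3 \<phi> + C4 * gamma4 \<phi>) * t"
proof -
  have "a1 = gamma1 \<phi> * t" "a2 = gamma2 \<phi> * t" "a3 = gamma3 \<phi> * t" "a4 = gamma4 \<phi> * t"
    by (simp_all add: a1_def a2_def a3_def a4_def gamma1_def gamma2_def gamma3_def gamma4_def pt_def mt_def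
      mult.assoc left_diff_distrib distrib_right)
  then show ?thesis by (simp add: Psum_def distrib_right mult.assoc)
qed

lemma Rsum_delta:
  shows "Rsum D1 D2 D3 D4 = ((D1 + D1) * delta1 \<phi> + D2 * delta2 \<phi> + (D3 + D3) * delta3 \<phi> + D4 * delta4 \<phi>) * u"
proof -
  have "b1 = delta1 \<phi> * u" "b2 = delta2 \<phi> * u" "b3 = delta3 \<phi> * u" "b4 = delta4 \<phi> * u"
    by (simp_all add: b1_def b2_def b3_def b4_def delta1_def delta2_def delta3_def delta4_def pu_def mu_def
      mult.assoc left_diff_distrib distrib_right)
  then show ?thesis by (simp add: Rsum_def distrib_right mult.assoc)
qed

lemma W_conj:
  "s * W1 = W1 * (iy * iz * s)" "s * W2 = W2 * (iy * iz * s)" "s * W3 = - (W3 * (iy * iz * s))"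
  "s * W4 = - (W4 * (iy * iz * s))"
  "t * W1 = - (W1 * (iy * t))" "t * W2 = W2 * (iy * t)" "t * W3 = W3 * (iy * t)" "t * W4 = - (W4 * (iy * t))"
  unfolding W1_def W2_def W3_def W4_def pt_def mt_def pu_def mu_def
  by (simp_all add: algebra_simps normal_form)

lemma pm_ne_0: "pt \<noteq> 0" "mt \<noteq> 0" "pu \<noteq> 0" "mu \<noteq> 0"
proof -
  have p: "1 + inverse a \<noteq> 0" if "a \<noteq> - 1" for a :: 'q
  proof
    assume "1 + inverse a = 0"
    then have "inverse (inverse a) = inverse (- 1)" by (simp add: add_eq_0_iff)
    then show False using that by simp
  qed
  have m: "1 - inverse a \<noteq> 0" if "a \<noteq> 1" for a :: 'q
  proof
    assume "1 - inverse a = 0"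
    then have "inverse (inverse a) = inverse 1" by simp
    then show False using that by simp
  qed
  have "1 + iy \<noteq> 0" "1 - iy \<noteq> 0" "1 + iz \<noteq> 0" "1 - iz \<noteq> 0"
    by (rule p m; rule xyz_ne_pm1)+
  moreover have "pt = (1 + iy) * t" "mt = (1 - iy) * t" "pu = (1 + iz) * u" "mu = (1 - iz) * u"
    by (simp_all add: pt_def mt_def pu_def mu_def algebra_simps)
  ultimately show "pt \<noteq> 0" "mt \<noteq> 0" "pu \<noteq> 0" "mu \<noteq> 0" by simp_all
qed

lemma W_ne_0: "W1 \<noteq> 0" "W2 \<noteq> 0" "W3 \<noteq> 0" "W4 \<noteq> 0"
  using pm_ne_0 xyz_ne_pm1(1,4) unfolding W1_def W2_def W3_def W4_def by (auto simp: add_eq_0_iff)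

text \<open>The \<open>Wi\<close> are eigenvectors of two operators of conjugation with different pairs of eigenvalues, see
\<open>W_conj\<close>, and central coefficients pass through these operators.\<close>

lemma W_center_independent:
  assumes "{a, b, c, d} \<subseteq> skew_center" "a * W1 + b * W2 + c * W3 + d * W4 = 0"
  shows "a = 0 \<and> b = 0 \<and> c = 0 \<and> d = 0"
proof -
  have z: "q * (e * f) = e * (q * f)" if "e \<in> {a, b, c, d}" for e f q
    using center_comm[of e q] assms(1) that by (auto simp flip: mult.assoc)
  note zz = z[of a] z[of b] z[of c] z[of d]
  have "s * (a * W1 + b * W2 + c * W3 + d * W4) = (a * W1 + b * W2 - c * W3 - d * W4) * (iy * iz * s)"
    by (simp add: distrib_left distrib_right left_diff_distrib zz W_conj mult.assoc)
  then have "a * W1 + b * W2 - c * W3 - d * W4 = 0" using assms(2) by simp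
  then have 1: "a * W1 + b * W2 = 0" "c * W3 + d * W4 = 0"
    using assms(2) by (subst double_eq_0[symmetric], simp add: algebra_simps)+
  have "t * (a * W1 + b * W2) = (b * W2 - a * W1) * (iy * t)" "t * (c * W3 + d * W4) = (c * W3 - d * W4) * (iy * t)"
    by (simp_all add: distrib_left distrib_right left_diff_distrib zz W_conj mult.assoc)
  then have "b * W2 = a * W1" "c * W3 = d * W4" using 1 by simp_all
  then show ?thesis using 1 W_ne_0 by (simp add: double_eq_0)
qed

section \<open>From an odd part to a unit of type 2\<close>

lemma even_and_odd_imp_0: "Od = 0" if "wx * Od = Od * wx" "Od * wx = - (wx * Od)" for Od
proof -
  have "wx * Od + wx * Od = 0" using that by (simp add: eq_neg_iff_add_eq_0)
  then have "wx * Od = 0" by (simp only: double_eq_0)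
  then show ?thesis using omg_ne_0 by simp
qed

lemma wx_not_center: "wx \<notin> skew_center"
proof
  assume "wx \<in> skew_center"
  then have "t * wx = wx * t" using center_comm by metis
  then have "wx * t + wx * t = 0" using omg_t(1) by (metis eq_neg_iff_add_eq_0)
  then show False using double_eq_0 omg_ne_0 by simp
qed

lemma omega_parts:
  assumes "T = E + Od" "E * wx = wx * E" "Od * wx = - (wx * Od)"
  shows "omega_pos \<phi> T = E" "omega_neg \<phi> T = Od" "conj_by T wx = E - Od"
proof -
  have "wx * T = (E - Od) * wx" using assms by (simp add: distrib_left left_diff_distrib)
  then show c: "conj_by T wx = E - Od" using omg_ne_0 by (simp add: conj_by_def mult.assoc)
  have "T + (E - Od) = E + E" "T - (E - Od) = Od + Od" using assms(1) by simp_all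
  then show "omega_pos \<phi> T = E" "omega_neg \<phi> T = Od"
    unfolding omega_pos_def omega_neg_def c
    by (metis half_add double_eq_iff)+
qed

lemma grp_wx: "grp \<phi> g * wx = wx * grp \<phi> g \<or> grp \<phi> g * wx = - (wx * grp \<phi> g)"
proof (induction g rule: promislow_induct)
  case zero
  then show ?case by (simp add: grp_0)
next
  case (gs g)
  then show ?case unfolding grp_add
    by (elim disjE) (simp_all add: mult.assoc omg_s(1)[THEN extend_right])
next
  case (gs_inv g)
  have "inverse s * wx = wx * inverse s" using comm_inverse[of wx s] omg_s(1) by (simp add: comm_def)
  note e = this[THEN extend_right]
  show ?case using gs_inv unfolding grp_add grp_minus
    by (elim disjE) (simp_all add: mult.assoc e)
next
  case (gt g)
  have "t * (wx * e) = - (wx * (t * e))" for e using extend_right[OF omg_t(1)] by (simp add: mult.assoc)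
  then show ?case using gt unfolding grp_add
    by (elim disjE) (simp_all add: mult.assoc)
next
  case (gt_inv g)
  have "inverse t * wx = inverse t * (wx * t) * inverse t" by (simp add: mult.assoc)
  also have "wx * t = - (t * wx)" by (simp add: omg_t(1))
  also have "inverse t * - (t * wx) * inverse t = - (inverse t * t * wx * inverse t)"
    by (simp only: mult_minus_right mult_minus_left mult.assoc)
  finally have "inverse t * wx = - (wx * inverse t)" by simp
  then have e: "inverse t * (wx * e) = - (wx * (inverse t * e))" for e
    by (simp only: mult.assoc[symmetric]) simp
  show ?case using gt_inv unfolding grp_add grp_minus
    by (elim disjE) (simp_all add: mult.assoc e)
qed

text \<open>For \<open>T = A \<omega> + B\<close> the norm equation says that \<open>(k + T) (k - T) = 1\<close>. The parameter \<open>k\<close> allows for the powers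
of a unit \<open>\<kappa>\<^sub>x + T\<close>.\<close>

lemma unit_of_norm_equation:
  assumes "k \<in> skew_center" "A \<in> skew_center" "k \<in> range \<phi>" "A \<in> range \<phi>" "B \<in> range \<phi>"
    and B: "B * wx = - (wx * B)" "B \<noteq> 0" "B * B \<in> skew_center"
    and k: "k * k - A * A * (wx * wx) - B * B = 1" "k \<noteq> 0" "1 + 2 * (B * B) \<noteq> 0"
  shows "\<exists>U. nontrivial_unit U \<and> type2 \<phi> U"
proof -
  have cw: "A * wx = wx * A" "k * wx = wx * k" "A * B = B * A" "k * B = B * k" "k * A = A * k"
    by (rule center_comm; fact)+
  define T where "T = A * wx + B"
  define Y where "Y = k + T"
  define Y' where "Y' = k - T"
  have T2: "T * T = A * A * (wx * wx) + B * B"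
  proof -
    have 1: "A * wx * (A * wx) = A * A * (wx * wx)" by (rule center_pull; fact)
    have "B * (A * wx) = A * (B * wx)" by (rule center_left_comm; fact)
    then have 2: "A * wx * B + B * (A * wx) = 0" by (simp add: B mult.assoc)
    have "T * T = A * wx * (A * wx) + (A * wx * B + B * (A * wx)) + B * B"
      unfolding T_def by (simp only: distrib_left distrib_right add_ac)
    then show ?thesis unfolding 1 2 by simp
  qed
  have kT: "k * T = T * k" by (rule center_comm; fact)
  have XX: "Y * Y' = 1" "Y' * Y = 1"
    using k(1) T2 kT unfolding Y_def Y'_def
    by (simp_all add: distrib_left distrib_right left_diff_distrib right_diff_distrib algebra_simps)
  have wr: "wx \<in> range \<phi>" by (rule LR_phi[OF kap_omg_LR(4)])
  have "Y \<in> range \<phi>" "Y' \<in> range \<phi>"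
    unfolding Y_def Y'_def T_def by (intro range_phi_closed assms wr)+
  then obtain U V where U: "Y = \<phi> U" "Y' = \<phi> V" by blast
  have UV: "U * V = 1" "V * U = 1"
    using XX unfolding U by (metis phi_mult phi_1 phi_eq_iff)+
  have X0: "Y \<noteq> 0" using XX by auto
  have iX: "inverse Y = Y'" by (rule inverse_unique[OF XX(1)])
  define E where "E = (1 + 2 * (B * B)) * wx"
  define Q where "Q = - (2 * (wx * ((k + A * wx) * B)))"
  have zz: "1 + 2 * (B * B) \<in> skew_center"
    using center_closed(3)[OF center_closed(2) center_closed(3)[OF B(3) B(3)]] by (simp only: mult_2)
  have conj: "Y * wx * Y' = E + Q"
  proof -
    have Tw: "T * wx = A * (wx * wx) - wx * B" unfolding T_def by (simp add: distrib_right B mult.assoc)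
    have wT: "wx * T = A * (wx * wx) + wx * B"
      unfolding T_def using center_left_comm[OF assms(2), of wx wx] by (simp add: distrib_left)
    have "T * wx * T = wx * (A * wx - B) * T" using Tw center_left_comm[OF assms(2), of wx wx]
      by (simp add: right_diff_distrib)
    also have "\<dots> = wx * (A * A * (wx * wx) - B * B + 2 * (A * (wx * B)))"
    proof -
      have 1: "A * wx * (A * wx) = A * A * (wx * wx)" by (rule center_pull; fact)
      have "B * (A * wx) = A * (B * wx)" by (rule center_left_comm; fact)
      then have 2: "B * (A * wx) = - (A * (wx * B))" by (simp add: B)
      have "(A * wx - B) * T = A * wx * (A * wx) + A * wx * B - B * (A * wx) - B * B"
        unfolding T_def by (simp add: distrib_left left_diff_distrib algebra_simps)
      also have "\<dots> = A * A * (wx * wx) - B * B + 2 * (A * (wx * B))"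
        unfolding 1 2 by (simp add: mult_2 mult.assoc)
      finally show ?thesis by (simp add: mult.assoc)
    qed
    finally have TwT: "T * wx * T = wx * (A * A * (wx * wx) - B * B + 2 * (A * (wx * B)))" .
    have "Y * wx * Y' = k * wx * k - k * wx * T + T * wx * k - T * wx * T"
      unfolding Y_def Y'_def by (simp add: distrib_left distrib_right left_diff_distrib right_diff_distrib algebra_simps)
    also have "k * wx * k = wx * (k * k)" by (simp add: cw(2) mult.assoc)
    also have "T * wx * k = k * (T * wx)" by (rule center_comm[OF assms(1), symmetric])
    also have "k * wx * T = k * (wx * T)" by (rule mult.assoc)
    finally have 3: "Y * wx * Y' = wx * (k * k) - k * (wx * T) + k * (T * wx)
      - wx * (A * A * (wx * wx) - B * B + 2 * (A * (wx * B)))" unfolding TwT .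
    have "wx * (1 + 2 * (B * B)) = (1 + 2 * (B * B)) * wx" by (rule center_comm[OF zz, symmetric])
    then have E: "E = wx * (1 + 2 * (B * B))" unfolding E_def by simp
    have kw: "k * (wx * B) = wx * (k * B)" "A * (wx * B) = wx * (A * B)"
      by (rule center_left_comm[symmetric]; fact)+
    have "Y * wx * Y' - E = wx * (k * k - A * A * (wx * wx) - B * B - 1) - 2 * (k * (wx * B)) - 2 * (wx * (A * (wx * B)))"
      unfolding 3 E Tw wT by (simp add: distrib_left right_diff_distrib mult_2 algebra_simps)
    also have "\<dots> = Q"
      unfolding Q_def using k(1) by (simp add: distrib_left distrib_right mult_2 kw mult.assoc)
    finally show ?thesis by (simp add: algebra_simps)
  qed
  have conj': "conj_by wx (\<phi> U) = E + Q"
    using conj iX by (simp add: conj_by_def U)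
  have Ew: "E * wx = wx * E" unfolding E_def
    using center_comm[OF zz, of wx] by (simp add: mult.assoc)
  have kAw: "(k + A * wx) * wx = wx * (k + A * wx)"
    by (simp add: distrib_left distrib_right cw mult.assoc flip: mult.assoc[of wx A])
  have Ow: "Q * wx = - (wx * Q)"
  proof -
    have "(k + A * wx) * B * wx = - ((k + A * wx) * wx * B)"
      by (simp only: mult.assoc B(1) mult_minus_right)
    then have "(k + A * wx) * B * wx = - (wx * ((k + A * wx) * B))"
      unfolding kAw by (simp only: mult.assoc)
    moreover have "- (2 * (wx * W)) * wx = - (wx * - (2 * (wx * W)))" if "W * wx = - (wx * W)" for W
      by (simp add: mult_2 distrib_left distrib_right left_diff_distrib right_diff_distrib mult.assoc that)
    ultimately show ?thesis unfolding Q_def by blast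
  qed
  have O0: "Q \<noteq> 0"
  proof
    assume "Q = 0"
    then have "wx * ((k + A * wx) * B) + wx * ((k + A * wx) * B) = 0"
      unfolding Q_def mult_2 by (metis neg_equal_0_iff_equal)
    then have "wx * ((k + A * wx) * B) = 0" by (simp only: double_eq_0)
    \<comment> \<open>then either \<open>\<omega>\<close> would be a quotient of central elements, or \<open>A = k = 0\<close>\<close>
    then have kA: "k + A * wx = 0" using B(2) omg_ne_0 by simp
    then have "A \<noteq> 0" using k(2) by auto
    moreover have "A * wx = - k" using kA by (simp add: eq_neg_iff_add_eq_0 add.commute)
    ultimately have "wx = inverse A * (- k)" by (metis mult.assoc left_inverse mult_1_left)
    then show False using wx_not_center center_closed(4,5,7) assms(1,2) by metis
  qed
  have parts: "omega_pos \<phi> (E + Q) = E" "omega_neg \<phi> (E + Q) = Q"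
    using omega_parts[OF HOL.refl Ew Ow] by auto
  \<comment> \<open>the two parts of the conjugate have degree two, since they are non-central with central squares\<close>
  have E_nc: "E \<notin> skew_center"
  proof
    assume "E \<in> skew_center"
    moreover have "wx = inverse (1 + 2 * (B * B)) * E" unfolding E_def using k(3) by (simp flip: mult.assoc)
    ultimately show False using wx_not_center center_closed(4,7) zz by metis
  qed
  have E_sq: "E * E \<in> skew_center"
    unfolding E_def center_pull[OF zz zz] by (intro center_closed(4) zz omg_sq_center)
  have O_nc: "Q \<notin> skew_center"
    using even_and_odd_imp_0[OF _ Ow] O0 center_comm by metis
  have O_sq: "Q * Q \<in> skew_center"
  proof -
    have "B * (A * wx) = A * (B * wx)" by (rule center_left_comm; fact)
    then have "B * (A * wx) = - (A * wx * B)" by (simp only: B mult_minus_right mult.assoc)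
    then have Bk: "B * (k + A * wx) = (k - A * wx) * B"
      by (simp only: distrib_left left_diff_distrib cw(4) add_uminus_conv_diff)
    have "wx * ((k + A * wx) * B) * (wx * ((k + A * wx) * B)) = wx * (k + A * wx) * (B * wx) * (k + A * wx) * B"
      by (simp only: mult.assoc)
    also have "\<dots> = - (wx * (k + A * wx) * wx * (B * (k + A * wx)) * B)"
      unfolding B(1) by (simp add: mult.assoc)
    also have "\<dots> = - (wx * ((k + A * wx) * wx) * (k - A * wx) * B * B)"
      unfolding Bk by (simp only: mult.assoc)
    also have "\<dots> = - (wx * wx * ((k + A * wx) * (k - A * wx)) * (B * B))"
      unfolding kAw by (simp only: mult.assoc)
    also have "(k + A * wx) * (k - A * wx) = k * k - A * A * (wx * wx)"
      unfolding distrib_right right_diff_distrib center_comm[OF assms(1), of "A * wx"]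
        center_pull[OF assms(2,2), of wx wx] by (simp add: algebra_simps)
    finally have *: "wx * ((k + A * wx) * B) * (wx * ((k + A * wx) * B)) \<in> skew_center"
      by (simp only:) (intro center_closed assms omg_sq_center)
    have "Q * Q = 4 * (wx * ((k + A * wx) * B) * (wx * ((k + A * wx) * B)))"
    proof -
      have "- (2 * W) * - (2 * W) = 4 * (W * W)" for W :: 'q
        by (simp add: mult_2 mult_4 distrib_left distrib_right add_ac minus_mult_minus del: minus_add_distrib)
      then show ?thesis unfolding Q_def .
    qed
    then show ?thesis unfolding mult_4 using center_closed(3)[OF center_closed(3)[OF center_closed(3)[OF * *] *] *] by simp
  qed
  have "type2 \<phi> U"
    unfolding type2_def omega_degree_def conj' parts
    using ext_degree_sqrt[OF E_nc E_sq] ext_degree_sqrt[OF O_nc O_sq] by simp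
  moreover have "\<not> (\<exists>c g. c \<noteq> 0 \<and> U = Poly_Mapping.single g c)"
  proof
    assume "\<exists>c g. c \<noteq> 0 \<and> U = Poly_Mapping.single g c"
    then obtain c g where "U = Poly_Mapping.single g c" by blast
    then have Xg: "Y = scal c * grp \<phi> g" unfolding U by (simp only:) (rule phi_single)
    have "Y * wx = wx * Y \<or> Y * wx = - (wx * Y)"
      using grp_wx[of g] center_left_comm[OF scal_center, of wx c "grp \<phi> g"] unfolding Xg
      by (auto simp: mult.assoc)
    then have "E + Q = wx \<or> E + Q = - wx"
    proof
      assume "Y * wx = wx * Y"
      then have "Y * wx * Y' = wx" by (simp only: mult.assoc XX(1) mult_1_right)
      then show ?thesis unfolding conj by simp
    next
      assume "Y * wx = - (wx * Y)"
      then have "Y * wx * Y' = - wx" by (simp only: mult_minus_left mult.assoc XX(1) mult_1_right)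
      then show ?thesis unfolding conj by simp
    qed
    then have "wx * (E + Q) = (E + Q) * wx" by auto
    then have "wx * Q = Q * wx" using Ew by (simp add: distrib_left distrib_right)
    then show False using even_and_odd_imp_0[OF _ Ow] O0 by blast
  qed
  ultimately show ?thesis using UV unfolding nontrivial_unit_def by blast
qed

lemma a_conj:
  "s * a1 = - (x * z * a1 * s)" "s * a2 = x * z * a2 * s" "s * a3 = x * z * a3 * s" "s * a4 = - (x * z * a4 * s)"
  "t * a1 = ix * a1 * t" "t * a2 = - (ix * a2 * t)" "t * a3 = ix * a3 * t" "t * a4 = - (ix * a4 * t)"
  unfolding a1_def a2_def a3_def a4_def pt_def mt_def
  by (simp_all add: algebra_simps normal_form)

lemma a_ne_0: "a1 \<noteq> 0" "a2 \<noteq> 0" "a3 \<noteq> 0" "a4 \<noteq> 0"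
  using pm_ne_0 xyz_ne_pm1(1,4) unfolding a1_def a2_def a3_def a4_def by (auto simp: add_eq_0_iff)

text \<open>The same eigenvector argument as in \<open>W_center_independent\<close>; it shows that a solution with \<open>B = 0\<close> has all
\<open>C\<^sub>i = 0\<close>.\<close>

lemma a_center_independent:
  assumes "{a, b, c, d} \<subseteq> skew_center" "a * a1 + b * a2 + c * a3 + d * a4 = 0"
  shows "a = 0 \<and> b = 0 \<and> c = 0 \<and> d = 0"
proof -
  have z: "q * (e * f) = e * (q * f)" if "e \<in> {a, b, c, d}" for e f q
    by (rule center_left_comm) (use assms(1) that in blast)
  note zz = z[of a] z[of b] z[of c] z[of d]
  have "s * (a * a1 + b * a2 + c * a3 + d * a4) = x * z * (- (a * a1) + b * a2 + c * a3 - d * a4) * s"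
    by (simp add: distrib_left distrib_right left_diff_distrib right_diff_distrib zz a_conj mult.assoc)
  then have "- (a * a1) + b * a2 + c * a3 - d * a4 = 0" using assms(2) by simp
  then have 1: "a * a1 + d * a4 = 0" "b * a2 + c * a3 = 0"
    using assms(2) by (subst double_eq_0[symmetric], simp add: algebra_simps)+
  have "t * (a * a1 + d * a4) = ix * (a * a1 - d * a4) * t" "t * (b * a2 + c * a3) = ix * (c * a3 - b * a2) * t"
    by (simp_all add: distrib_left distrib_right left_diff_distrib right_diff_distrib zz a_conj mult.assoc)
  then have "a * a1 = d * a4" "c * a3 = b * a2" using 1 by simp_all
  then show ?thesis using 1 a_ne_0 by (simp add: double_eq_0)
qed

lemma tu_wx: "t * wx = - (wx * t)" "u * wx = - (wx * u)" "t * wy = wy * t" "u * wy = - (wy * u)"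
  by (simp_all add: omg_t omg_s grp_relations(3) mult.assoc omg_s[THEN extend_right])

lemma LR_tu_wx:
  assumes "c \<in> LR" "d \<in> LR"
  shows "(c * t + d * u) * wx = - (wx * (c * t + d * u))" "wy * (c * t + d * u) = (c * t - d * u) * wy"
proof -
  have w: "c * wx = wx * c" "d * wx = wx * d" "wy * c = c * wy" "wy * d = d * wy"
    using LR_comm[OF assms(1) kap_omg_LR(4)] LR_comm[OF assms(2) kap_omg_LR(4)]
      LR_comm[OF assms(1) kap_omg_LR(5)] LR_comm[OF assms(2) kap_omg_LR(5)] by (simp_all add: comm_def)
  have w': "wy * (c * e) = c * (wy * e)" "wy * (d * e) = d * (wy * e)"
    "c * (wx * e) = wx * (c * e)" "d * (wx * e) = wx * (d * e)" for e
    using w[THEN extend_right] by (simp_all add: mult.assoc)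
  show "(c * t + d * u) * wx = - (wx * (c * t + d * u))"
    by (simp add: distrib_left distrib_right mult.assoc tu_wx w')
  show "wy * (c * t + d * u) = (c * t - d * u) * wy"
    by (simp add: distrib_left distrib_right left_diff_distrib mult.assoc tu_wx w')
qed

text \<open>These are Laurent polynomials in \<open>x\<close> of which a multiple by another one is \<open>x\<^sup>n - 1\<close> for some \<open>n > 0\<close>.\<close>

lemma kx_ne_0: "kx \<noteq> 0" "2 * (kx * kx) \<noteq> 1"
proof -
  show "kx \<noteq> 0"
  proof
    assume "kx = 0"
    then have "x * (x + ix) = 0" using kap_double[of gx] by simp
    then have "x * x = - 1" by (simp add: distrib_left add_eq_0_iff2)
    then have "(x * x) * (x * x) = 1" by simp
    then have "grp \<phi> (gx + gx + gx + gx) = 1" by (simp add: grp_add mult.assoc)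
    then show False using axis_elements_ne_0(8) grp_eq_iff[of _ 0] by (simp add: grp_0)
  qed
  show "2 * (kx * kx) \<noteq> 1"
  proof
    assume "2 * (kx * kx) = 1"
    then have "(kx + kx) * (kx + kx) = 2" by (simp add: distrib_left distrib_right mult_2)
    then have "(x + ix) * (x + ix) = 2" by (simp only: kap_double)
    then have "x * ((x + ix) * (x + ix)) * x = x * 2 * x" by simp
    then have "x * x * (x * x) = - 1"
      by (simp add: distrib_left distrib_right mult.assoc mult_2 mult_2_right normal_form_rules[THEN extend_right] add_eq_0_iff2)
    then have "(x * x * (x * x)) * (x * x * (x * x)) = 1" by simp
    then have "grp \<phi> (gx + gx + gx + gx + gx + gx + gx + gx) = 1" by (simp add: grp_add mult.assoc)
    then show False using axis_elements_ne_0(9) grp_eq_iff[of _ 0] by (simp add: grp_0)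
  qed
qed

text \<open>The unit is \<open>\<kappa>\<^sub>x + A \<omega> + B\<close>, or its square if \<open>1 + 2 B\<^sup>2 = 0\<close>.\<close>

lemma unit_of_odd_part:
  assumes A: "A \<in> skew_center" "A \<in> range \<phi>" and B: "B \<in> range \<phi>" "B * wx = - (wx * B)" "B \<noteq> 0"
    "B * B = (1 - A * A) * (wx * wx)"
  shows "\<exists>U. nontrivial_unit U \<and> type2 \<phi> U"
proof (cases "1 + 2 * (B * B) = 0")
  case False
  have BB: "B * B \<in> skew_center"
    unfolding B(4) by (intro center_closed A omg_sq_center)
  have "kx * kx - A * A * (wx * wx) - B * B = 1"
    unfolding B(4) omg_sq[OF kap_center(1)] by (simp add: left_diff_distrib)
  then show ?thesis
    using unit_of_norm_equation[OF kap_center(1) A(1) LR_phi[OF kap_omg_LR(1)] A(2) B(1-3) BB] kx_ne_0(1) False by blast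
next
  case True
  \<comment> \<open>the square of \<open>\<kappa>\<^sub>x + T\<close> is \<open>?k + ?S T\<close>; with the exceptional value of \<open>B\<^sup>2\<close>, \<open>1 + 2 (?S B)\<^sup>2 = 1 - 4 \<kappa>\<^sub>x\<^sup>2\<close>\<close>
  let ?k = "2 * (kx * kx) - 1" and ?S = "2 * kx"
  have two: "(2::'q) \<in> skew_center" "(2::'q) \<in> range \<phi>"
    using center_closed(3)[OF center_closed(2) center_closed(2)] range_phi_closed(2)[OF range_phi_closed(7) range_phi_closed(7)]
    by simp_all
  have kr: "kx \<in> range \<phi>" by (rule LR_phi[OF kap_omg_LR(1)])
  have BB: "B * B \<in> skew_center"
    unfolding B(4) by (intro center_closed A omg_sq_center)
  have S: "?S \<in> skew_center" by (intro center_closed two kap_center)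
  have SS: "(?S * B) * (?S * B) = ?S * ?S * (B * B)" by (rule center_pull[OF S S])
  have SA: "(?S * A) * (?S * A) = ?S * ?S * (A * A)" by (rule center_pull[OF S S])
  have 1: "?k * ?k - ?S * A * (?S * A) * (wx * wx) - ?S * B * (?S * B) = 1"
  proof -
    have "?S * A * (?S * A) * (wx * wx) + ?S * B * (?S * B) = ?S * ?S * (wx * wx)"
      unfolding SS SA B(4) by (simp add: left_diff_distrib right_diff_distrib mult.assoc)
    moreover have "?S * ?S * (wx * wx) = ?k * ?k - 1"
      unfolding omg_sq[OF kap_center(1)]
      by (simp add: left_diff_distrib right_diff_distrib distrib_left distrib_right mult_2 mult.assoc algebra_simps)
    ultimately show ?thesis by (simp add: algebra_simps)
  qed
  have 3: "1 + 2 * (?S * B * (?S * B)) \<noteq> 0"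
  proof
    assume "1 + 2 * (?S * B * (?S * B)) = 0"
    moreover have "2 * (?S * B * (?S * B)) = ?S * ?S * (2 * (B * B))"
      unfolding SS by (rule center_left_comm[OF two(1), symmetric])
    moreover have "2 * (B * B) = - 1" using True by (simp add: add_eq_0_iff)
    ultimately have "?S * ?S = 1" by simp
    then show False using double_kx_sq_ne_1 by (simp add: mult_2)
  qed
  show ?thesis
  proof (rule unit_of_norm_equation[OF _ _ _ _ _ _ _ _ 1 _ 3])
    show "?k \<in> skew_center" "?S * A \<in> skew_center" by (intro center_closed two kap_center A)+
    show "?k \<in> range \<phi>" "?S * A \<in> range \<phi>" "?S * B \<in> range \<phi>"
      by (intro range_phi_closed two kr A B)+
    show "?S * B * wx = - (wx * (?S * B))"
      using center_left_comm[OF S, of wx B] by (simp add: mult.assoc B)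
    show "?S * B \<noteq> 0" using B kx_ne_0 two_ne_0 by simp
    show "?S * B * (?S * B) \<in> skew_center" unfolding SS by (intro center_closed S BB)
    show "?k \<noteq> 0" using kx_ne_0 by simp
  qed
qed

section \<open>From a solution to a unit\<close>

lemma quarter: "(4 * q) / 2 / 2 = (q :: 'q)"
proof -
  have d: "(q + q) / 2 = q" for q :: 'q
    unfolding add_divide_distrib by (rule half_add)
  have "4 * q = (q + q) + (q + q)" unfolding mult_4 by (simp only: add.assoc)
  then show ?thesis by (simp only: d)
qed

text \<open>In either parametrised case of (c), two of the first four relations hold identically and the other two are multiples of
(b). The last one uses \<open>\<omega>\<^sup>2 = \<kappa>\<^sub>x\<^sup>2 - 1\<close>; it is the coefficient of \<open>\<omega>\<^sub>z\<close> in \<open>R_sq\<close>.\<close>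

lemma eq_c_relations:
  assumes Z: "{C1, C2, C3, C4, D1, D2, D3, D4, \<alpha>, \<beta>} \<subseteq> skew_center"
    and b: "eq_b \<phi> C1 C2 C3 C4" and c: "eq_c \<phi> C1 C2 C3 C4 D1 D2 D3 D4 \<alpha> \<beta>"
  shows "C1 * D1 - (1 - kx) * C4 * D4 = 0" "C3 * D3 - (1 - kx) * C2 * D2 = 0"
    "C2 * D1 + (1 + kx) * C3 * D4 = 0" "C4 * D3 + (1 + kx) * C1 * D2 = 0"
    "D1 * D3 - wx^2 * D2 * D4 = 0"
proof -
  have cl: "C1 \<in> CL" "C2 \<in> CL" "C3 \<in> CL" "C4 \<in> CL" "\<alpha> \<in> CL" "\<beta> \<in> CL" "kx \<in> CL"
    using Z CL_mem(2) kap_omg_CL(1) by auto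
  have b0: "(kx - 1) * C2 * C4 - (kx + 1) * C1 * C3 = 0" using b by (simp add: eq_b_def)
  have w: "wx^2 = kx * kx - 1" unfolding power2_eq_square by (rule omg_sq[OF kap_center(1)])
  let ?R = "C1 * D1 - (1 - kx) * C4 * D4 = 0 \<and> C3 * D3 - (1 - kx) * C2 * D2 = 0 \<and>
    C2 * D1 + (1 + kx) * C3 * D4 = 0 \<and> C4 * D3 + (1 + kx) * C1 * D2 = 0 \<and> D1 * D3 - wx^2 * D2 * D4 = 0"
  consider (c1) "D1 = \<beta> * (1 - kx) * C4" "D2 = \<alpha> * C4" "D3 = - \<alpha> * (1 + kx) * C1" "D4 = \<beta> * C1"
    | (c2) "D1 = - \<beta> * (1 + kx) * C3" "D2 = \<alpha> * C3" "D3 = \<alpha> * (1 - kx) * C2" "D4 = \<beta> * C2"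
    | (c3) "D1 = 0" "D2 = 0" "D3 = 0" "D4 = 0"
    using c unfolding eq_c_def by blast
  then have ?R
  proof cases
    case D: c1
    have "C3 * D3 - (1 - kx) * C2 * D2 = \<alpha> * ((kx - 1) * C2 * C4 - (kx + 1) * C1 * C3)"
      "C2 * D1 + (1 + kx) * C3 * D4 = - (\<beta> * ((kx - 1) * C2 * C4 - (kx + 1) * C1 * C3))"
      "C1 * D1 - (1 - kx) * C4 * D4 = 0" "C4 * D3 + (1 + kx) * C1 * D2 = 0" "D1 * D3 - wx^2 * D2 * D4 = 0"
      unfolding D w by (simp_all add: algebra_simps CL_ac cl)
    then show ?R unfolding b0 by simp
  next
    case D: c2
    have "C1 * D1 - (1 - kx) * C4 * D4 = \<beta> * ((kx - 1) * C2 * C4 - (kx + 1) * C1 * C3)"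
      "C4 * D3 + (1 + kx) * C1 * D2 = - (\<alpha> * ((kx - 1) * C2 * C4 - (kx + 1) * C1 * C3))"
      "C3 * D3 - (1 - kx) * C2 * D2 = 0" "C2 * D1 + (1 + kx) * C3 * D4 = 0" "D1 * D3 - wx^2 * D2 * D4 = 0"
      unfolding D w by (simp_all add: algebra_simps CL_ac cl)
    then show ?R unfolding b0 by simp
  next
    case c3
    then show ?R by simp
  qed
  then show "C1 * D1 - (1 - kx) * C4 * D4 = 0" "C3 * D3 - (1 - kx) * C2 * D2 = 0"
    "C2 * D1 + (1 + kx) * C3 * D4 = 0" "C4 * D3 + (1 + kx) * C1 * D2 = 0"
    "D1 * D3 - wx^2 * D2 * D4 = 0" by blast+
qed

lemma ab_gamma_delta:
  "a1 = gamma1 \<phi> * t" "a2 = gamma2 \<phi> * t" "a3 = gamma3 \<phi> * t" "a4 = gamma4 \<phi> * t"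
  "b1 = delta1 \<phi> * u" "b2 = delta2 \<phi> * u" "b3 = delta3 \<phi> * u" "b4 = delta4 \<phi> * u"
  by (simp_all add: a1_def a2_def a3_def a4_def gamma1_def gamma2_def gamma3_def gamma4_def pt_def mt_def
    b1_def b2_def b3_def b4_def delta1_def delta2_def delta3_def delta4_def pu_def mu_def
      mult.assoc left_diff_distrib distrib_right)

lemma eq_a_sum: "w + f1 - f2 + f3 - f4 + g1 - g2 + g3 - g4 = 0 \<Longrightarrow>
    (f1 - f2 + f3 - f4) + (g1 - g2 + g3 - g4) = - (w :: 'q)"
proof -
  assume "w + f1 - f2 + f3 - f4 + g1 - g2 + g3 - g4 = 0"
  moreover have "w + f1 - f2 + f3 - f4 + g1 - g2 + g3 - g4 = ((f1 - f2 + f3 - f4) + (g1 - g2 + g3 - g4)) + w"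
    by simp
  ultimately show ?thesis by (simp only: eq_neg_iff_add_eq_0)
qed

lemma unit_of_solution:
  assumes Z: "{A, C1, C2, C3, C4, D1, D2, D3, D4, \<alpha>, \<beta>} \<subseteq> skew_center"
    and nt: "(A, C1, C2, C3, C4, D1, D2, D3, D4, \<alpha>, \<beta>) \<noteq> (1, 0, 0, 0, 0, 0, 0, 0, 0, 0, 0)"
      "(A, C1, C2, C3, C4, D1, D2, D3, D4, \<alpha>, \<beta>) \<noteq> (- 1, 0, 0, 0, 0, 0, 0, 0, 0, 0, 0)"
    and a: "eq_a \<phi> A C1 C2 C3 C4 D1 D2 D3 D4" and b: "eq_b \<phi> C1 C2 C3 C4"
    and c: "eq_c \<phi> C1 C2 C3 C4 D1 D2 D3 D4 \<alpha> \<beta>"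
    and A: "A \<in> KR"
    and C: "C1 * gamma1 \<phi> \<in> LR" "C2 * gamma2 \<phi> \<in> LR" "C3 * gamma3 \<phi> \<in> LR" "C4 * gamma4 \<phi> \<in> LR"
    and D: "D1 * delta1 \<phi> \<in> LR" "D2 * delta2 \<phi> \<in> LR" "D3 * delta3 \<phi> \<in> LR" "D4 * delta4 \<phi> \<in> LR"
  shows "\<exists>U. nontrivial_unit U \<and> type2 \<phi> U"
proof -
  define P where "P = Psum C1 C2 C3 C4"
  define R where "R = Rsum D1 D2 D3 D4"
  define B where "B = (P + R) / 2"
  have ZC: "{C1, C2, C3, C4} \<subseteq> skew_center" and ZD: "{D1, D2, D3, D4} \<subseteq> skew_center"
    and ZCD: "{C1, C2, C3, C4, D1, D2, D3, D4} \<subseteq> skew_center"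
    and ZCDab: "{C1, C2, C3, C4, D1, D2, D3, D4, \<alpha>, \<beta>} \<subseteq> skew_center" and ZA: "A \<in> skew_center"
    using Z by auto
  define ct where "ct = (C1 * gamma1 \<phi> + C2 * gamma2 \<phi> + C3 * gamma3 \<phi> + C4 * gamma4 \<phi>) / 2"
  define du where "du = ((D1 + D1) * delta1 \<phi> + D2 * delta2 \<phi> + (D3 + D3) * delta3 \<phi> + D4 * delta4 \<phi>) / 2"
  have LR: "ct \<in> LR" "du \<in> LR"
    unfolding ct_def du_def distrib_right by (intro LR_half LR_closed C D)+
  have "(a * t + b * u) / 2 = a / 2 * t + b / 2 * u" for a b
    by (simp only: add_divide_distrib half_mult)
  then have B: "B = ct * t + du * u"
    unfolding B_def P_def R_def ct_def du_def Psum_gamma[OF ZC] Rsum_delta .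
  have "B \<in> range \<phi>"
    unfolding B by (intro range_phi_closed LR_phi LR)
  moreover have "B * wx = - (wx * B)"
    unfolding B by (rule LR_tu_wx[OF LR])
  moreover have BB: "B * B = (1 - A * A) * (wx * wx)"
  proof -
    note rel = eq_c_relations[OF ZCDab b c]
    have "anti P R = 0"
      unfolding P_def R_def anti_PR[OF ZCD] rel by simp
    moreover have "(P + R) * (P + R) = anti P R + (P * P + R * R)"
      by (simp only: anti_def distrib_left distrib_right add_ac)
    ultimately have "(P + R) * (P + R) = P * P + R * R" by simp
    also have "P * P = 4 * (C1^2 * (kx + 1) * (ky - 1) - C2^2 * (kx - 1) * (ky + 1)
     + C3^2 * (kx + 1) * (ky + 1) - C4^2 * (kx - 1) * (ky - 1))"
      unfolding P_def P_sq[OF ZC] b[unfolded eq_b_def] by simp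
    also have "R * R = 4 * (2 * D1^2 * (kz - 1) - 2 * D2^2 * wx^2 * (kz + 1) + 2 * D3^2 * (kz + 1)
      - 2 * D4^2 * wx^2 * (kz - 1))"
      unfolding R_def R_sq[OF ZD] rel(5) by simp
    finally have "(P + R) * (P + R) = 4 * (- ((A^2 - 1) * wx^2))"
      unfolding distrib_left[symmetric] eq_a_sum[OF a[unfolded eq_a_def]] .
    also have "- ((A^2 - 1) * wx^2) = (1 - A * A) * (wx * wx)"
      unfolding power2_eq_square by (simp only: minus_diff_eq flip: mult_minus_left)
    finally show ?thesis unfolding B_def half_mult by (simp only: quarter)
  qed
  moreover have "B \<noteq> 0"
  proof
    assume B0: "B = 0"
    have 1: "ct * t + du * u = 0" "ct * t - du * u = 0"
      using B0 LR_tu_wx(2)[OF LR] omg_ne_0 unfolding B by auto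
    then have "ct * t + ct * t = 0" by simp
    then have "ct = 0" by (simp only: double_eq_0) simp
    then have "C1 * gamma1 \<phi> + C2 * gamma2 \<phi> + C3 * gamma3 \<phi> + C4 * gamma4 \<phi> = 0"
      using half_add[of "C1 * gamma1 \<phi> + C2 * gamma2 \<phi> + C3 * gamma3 \<phi> + C4 * gamma4 \<phi>"]
      unfolding ct_def[symmetric] by simp
    then have "Psum C1 C2 C3 C4 = 0" unfolding Psum_gamma[OF ZC] by simp
    then have C0: "C1 = 0 \<and> C2 = 0 \<and> C3 = 0 \<and> C4 = 0"
      unfolding Psum_def by (intro a_center_independent ZC)
    then have D0: "D1 = 0 \<and> D2 = 0 \<and> D3 = 0 \<and> D4 = 0 \<and> \<alpha> = 0 \<and> \<beta> = 0"
      using c unfolding eq_c_def by auto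
    have "(1 - A * A) * (wx * wx) = 0" using BB B0 by simp
    then have "A * A = 1" using omg_ne_0 by simp
    then show False using sq_eq_1 nt C0 D0 by auto
  qed
  ultimately show ?thesis
    using unit_of_odd_part[OF ZA LR_phi[OF KR_LR[OF A]]] by blast
qed

section \<open>Coordinates over the centre\<close>

lemma sconj_eqI: "s * f = g * s \<Longrightarrow> sconj f = g" and tconj_eqI: "t * f = g * t \<Longrightarrow> tconj f = g"
  using s_mult[of f] t_mult[of f] by simp_all

lemma conj_add: "sconj (f + g) = sconj f + sconj g" "tconj (f + g) = tconj f + tconj g"
  "sconj (f - g) = sconj f - sconj g" "tconj (f - g) = tconj f - tconj g"
  "sconj (f / 2) = sconj f / 2" "tconj (f / 2) = tconj f / 2"
  by (simp_all add: sconj_def tconj_def distrib_left distrib_right left_diff_distrib right_diff_distrib half_mult)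

lemma conj_mult: "sconj (f * g) = sconj f * sconj g" "tconj (f * g) = tconj f * tconj g"
proof -
  have "inverse (grp \<phi> h) * (grp \<phi> h * e) = e" for h e by (simp flip: mult.assoc)
  then show "sconj (f * g) = sconj f * sconj g" "tconj (f * g) = tconj f * tconj g"
    by (simp_all only: sconj_def tconj_def mult.assoc)
qed

lemma conj_conj:
  assumes "f \<in> LR"
  shows "sconj (sconj f) = f" "tconj (tconj f) = f" "sconj (tconj f) = tconj (sconj f)"
proof -
  have c: "x * f = f * x" "y * f = f * y" using LR_comm_gen[OF assms] by (auto simp: comm_def)
  have "s * sconj f = f * s"
  proof -
    have "s * sconj f = (s * s) * f * inverse s" by (simp only: sconj_def mult.assoc)
    also have "\<dots> = f * (s * s) * inverse s" unfolding grp_relations(1) c(1) ..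
    finally show ?thesis by (simp add: mult.assoc)
  qed
  then show "sconj (sconj f) = f" by (rule sconj_eqI)
  have "t * tconj f = f * t"
  proof -
    have "t * tconj f = (t * t) * f * inverse t" by (simp only: tconj_def mult.assoc)
    also have "\<dots> = f * (t * t) * inverse t" unfolding grp_relations(2) c(2) ..
    finally show ?thesis by (simp add: mult.assoc)
  qed
  then show "tconj (tconj f) = f" by (rule tconj_eqI)
  let ?n = "ix * y * iz" and ?g = "sconj (tconj f)"
  have ts: "t * s = ?n * (s * t)" unfolding t_s by (simp only: mult.assoc)
  have "tconj (sconj f) * (t * s) = t * s * f"
    by (simp only: mult.assoc s_mult[of f]) (simp only: t_mult[of "sconj f"] flip: mult.assoc)
  also have "\<dots> = ?n * (s * (t * f))" unfolding ts by (simp only: mult.assoc)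
  also have "s * (t * f) = ?g * (s * t)"
    by (simp only: t_mult[of f]) (simp only: s_mult[of "tconj f"] flip: mult.assoc)
  also have "?n * (?g * (s * t)) = ?g * (?n * (s * t))"
  proof -
    have "comm ?n ?g"
      by (rule LR_comm) (intro LR_closed LR_sconj LR_tconj assms)+
    then show ?thesis unfolding comm_def by (simp only: mult.assoc[symmetric])
  qed
  finally have "tconj (sconj f) * (t * s) = ?g * (t * s)" unfolding ts .
  then show "?g = tconj (sconj f)" by simp
qed

text \<open>The maps \<open>f \<mapsto> n1 * sconj f\<close> and \<open>f \<mapsto> n2 * tconj f\<close> are commuting involutions; the summands are the images of
\<open>f\<close> under the four projections \<open>(1 \<plusminus> S) (1 \<plusminus> T) / 4\<close>, so they are again Laurent polynomials.\<close>

lemma split_by_two_involutions: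
  assumes f: "f \<in> LR" and n: "n1 \<in> LR" "n2 \<in> LR"
    and n1: "n1 * sconj n1 = 1" and n2: "n2 * tconj n2 = 1" and n12: "n1 * sconj n2 = n2 * tconj n1"
  obtains f1 f2 f3 f4 where "f1 \<in> LR" "f2 \<in> LR" "f3 \<in> LR" "f4 \<in> LR" "f = f1 + f2 + f3 + f4"
    "n1 * sconj f1 = - f1" "n2 * tconj f1 = f1"
    "n1 * sconj f2 = f2" "n2 * tconj f2 = - f2"
    "n1 * sconj f3 = f3" "n2 * tconj f3 = f3"
    "n1 * sconj f4 = - f4" "n2 * tconj f4 = - f4"
proof -
  define S where "S f = n1 * sconj f" for f
  define T where "T f = n2 * tconj f" for f
  have lin: "S (f + g) = S f + S g" "T (f + g) = T f + T g" "S (f - g) = S f - S g" "T (f - g) = T f - T g"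
    "S (f / 2) = S f / 2" "T (f / 2) = T f / 2" for f g
    by (simp_all add: S_def T_def conj_add distrib_left right_diff_distrib half_mult)
  have SS: "S (S g) = g" and TT: "T (T g) = g" and TS: "T (S g) = S (T g)" if "g \<in> LR" for g
    using n1 n2 n12 conj_conj[OF that] by (simp_all add: S_def T_def conj_mult flip: mult.assoc)
  have mem: "S f \<in> LR" "T f \<in> LR" "S (T f) \<in> LR"
    unfolding S_def T_def by (intro LR_closed n LR_sconj LR_tconj f)+
  note ST = SS[OF f] SS[OF mem(2)] TT[OF f] TS[OF f] TS[OF mem(2)]
  let ?h = "\<lambda>g. g / 2 / 2"
  have neg: "- (g / 2 / 2) = (- g) / 2 / 2" for g :: 'q by simp
  show ?thesis
  proof (rule that[of "?h (f - S f + T f - S (T f))" "?h (f + S f - T f - S (T f))"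
        "?h (f + S f + T f + S (T f))" "?h (f - S f - T f + S (T f))"], unfold S_def[symmetric] T_def[symmetric] neg)
    have "f = ?h (4 * f)" by (rule quarter[symmetric])
    also have "4 * f = (f - S f + T f - S (T f)) + (f + S f - T f - S (T f)) + (f + S f + T f + S (T f)) + (f - S f - T f + S (T f))"
      unfolding mult_4 by simp
    finally show "f = ?h (f - S f + T f - S (T f)) + ?h (f + S f - T f - S (T f)) + ?h (f + S f + T f + S (T f)) + ?h (f - S f - T f + S (T f))"
      by (simp only: add_divide_distrib)
    show "?h (f - S f + T f - S (T f)) \<in> LR" "?h (f + S f - T f - S (T f)) \<in> LR"
      "?h (f + S f + T f + S (T f)) \<in> LR" "?h (f - S f - T f + S (T f)) \<in> LR"
      by (intro LR_half LR_closed mem f)+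
  qed (simp_all only: lin ST, (rule arg_cong[where f = ?h], simp only: minus_diff_eq minus_add_distrib diff_conv_add_uminus minus_minus add_ac)+)
qed

text \<open>Two elements with the same eigenvalues under the twisted conjugations have a quotient that is fixed by
the untwisted ones.\<close>

lemma ratio_center:
  assumes "f \<in> LR" "g \<in> LR" "n1 \<in> LR" "n2 \<in> LR" "g \<noteq> 0" "n1 \<noteq> 0" "n2 \<noteq> 0"
    and s: "n1 * sconj f = f \<and> n1 * sconj g = g \<or> n1 * sconj f = - f \<and> n1 * sconj g = - g"
    and t: "n2 * tconj f = f \<and> n2 * tconj g = g \<or> n2 * tconj f = - f \<and> n2 * tconj g = - g"
  shows "f * inverse g \<in> skew_center"
proof -
  have key: "q * (f * inverse g) * inverse q = f * inverse g"
    if "q \<noteq> 0" "n \<in> LR" "n \<noteq> 0" and or: "n * (q * f * inverse q) = f \<and> n * (q * g * inverse q) = g \<or>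
      n * (q * f * inverse q) = - f \<and> n * (q * g * inverse q) = - g" for q n
  proof -
    have c: "comm (inverse n) f" "comm (inverse n) g"
      using LR_comm[OF assms(1) that(2)] LR_comm[OF assms(2) that(2)] by (meson comm_inverse comm_sym)+
    obtain w where w: "w \<noteq> 0" "q * f * inverse q = f * w" "q * g * inverse q = g * w"
    proof (use or in \<open>elim disjE conjE\<close>)
      assume a: "n * (q * f * inverse q) = f" "n * (q * g * inverse q) = g"
      have "q * f * inverse q = inverse n * (n * (q * f * inverse q))" "q * g * inverse q = inverse n * (n * (q * g * inverse q))"
        using \<open>n \<noteq> 0\<close> by (simp_all flip: mult.assoc)
      then have "q * f * inverse q = inverse n * f" "q * g * inverse q = inverse n * g"
        unfolding a by simp_all
      then show thesis using that[of "inverse n"] c \<open>n \<noteq> 0\<close> by (simp add: comm_def)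
    next
      assume a: "n * (q * f * inverse q) = - f" "n * (q * g * inverse q) = - g"
      have "q * f * inverse q = inverse n * (n * (q * f * inverse q))" "q * g * inverse q = inverse n * (n * (q * g * inverse q))"
        using \<open>n \<noteq> 0\<close> by (simp_all flip: mult.assoc)
      then have "q * f * inverse q = - (inverse n * f)" "q * g * inverse q = - (inverse n * g)"
        unfolding a by simp_all
      then show thesis using that[of "- inverse n"] c \<open>n \<noteq> 0\<close> by (simp add: comm_def)
    qed
    have "q * (f * inverse g) * inverse q = (q * f * inverse q) * inverse (q * g * inverse q)"
    proof -
      have "inverse (q * g * inverse q) = q * inverse g * inverse q"
        using that(1) assms(5) by (simp add: nonzero_inverse_mult_distrib mult.assoc)
      moreover have "inverse q * (q * e) = e" for e using that(1) by (simp flip: mult.assoc)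
      ultimately show ?thesis by (simp add: mult.assoc)
    qed
    also have "\<dots> = f * inverse g"
    proof -
      have "w * (inverse w * e) = e" for e using w(1) by (simp flip: mult.assoc)
      then show ?thesis unfolding w using w(1) assms(5)
        by (simp add: nonzero_inverse_mult_distrib mult.assoc)
    qed
    finally show ?thesis .
  qed
  have c: "comm q r" if "q * r * inverse q = r" "q \<noteq> 0" for q r :: 'q
  proof -
    have "q * r = q * r * inverse q * q" using that(2) by (simp add: mult.assoc)
    then show ?thesis unfolding comm_def that(1) .
  qed
  show ?thesis
    using key[of s n1] key[of t n2] assms unfolding sconj_def tconj_def
    by (intro centerI c) simp_all
qed

lemma gamma_delta_LR:
  "gamma1 \<phi> \<in> LR" "gamma2 \<phi> \<in> LR" "gamma3 \<phi> \<in> LR" "gamma4 \<phi> \<in> LR"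
  "delta1 \<phi> \<in> LR" "delta2 \<phi> \<in> LR" "delta3 \<phi> \<in> LR" "delta4 \<phi> \<in> LR"
  unfolding gamma1_def gamma2_def gamma3_def gamma4_def delta1_def delta2_def delta3_def delta4_def
  by (intro LR_closed)+

lemma x_ne_ix: "x - ix \<noteq> 0"
  unfolding omg_double[symmetric] double_eq_0 by (rule omg_ne_0)

lemma gamma_delta_ne_0:
  "gamma1 \<phi> \<noteq> 0" "gamma2 \<phi> \<noteq> 0" "gamma3 \<phi> \<noteq> 0" "gamma4 \<phi> \<noteq> 0"
  "delta1 \<phi> \<noteq> 0" "delta2 \<phi> \<noteq> 0" "delta3 \<phi> \<noteq> 0" "delta4 \<phi> \<noteq> 0"
proof -
  have "b1 \<noteq> 0" "b2 \<noteq> 0" "b3 \<noteq> 0" "b4 \<noteq> 0"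
    using pm_ne_0 x_ne_ix by (simp_all add: b1_def b2_def b3_def b4_def)
  then show "gamma1 \<phi> \<noteq> 0" "gamma2 \<phi> \<noteq> 0" "gamma3 \<phi> \<noteq> 0" "gamma4 \<phi> \<noteq> 0"
    "delta1 \<phi> \<noteq> 0" "delta2 \<phi> \<noteq> 0" "delta3 \<phi> \<noteq> 0" "delta4 \<phi> \<noteq> 0"
    using a_ne_0 unfolding ab_gamma_delta by auto
qed

lemma conj_gens: "sconj x = x" "sconj ix = ix" "sconj y = iy" "sconj iy = y" "sconj z = iz" "sconj iz = z"
  "tconj x = ix" "tconj ix = x" "tconj y = y" "tconj iy = iy" "tconj z = iz" "tconj iz = z"
  "sconj 1 = 1" "tconj 1 = 1"
  by ((rule sconj_eqI tconj_eqI, simp add: normal_form_rules)+)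

lemma gamma_eigen:
  "iy * sconj (gamma1 \<phi>) = - gamma1 \<phi>" "x * tconj (gamma1 \<phi>) = gamma1 \<phi>"
  "iy * sconj (gamma2 \<phi>) = gamma2 \<phi>" "x * tconj (gamma2 \<phi>) = - gamma2 \<phi>"
  "iy * sconj (gamma3 \<phi>) = gamma3 \<phi>" "x * tconj (gamma3 \<phi>) = gamma3 \<phi>"
  "iy * sconj (gamma4 \<phi>) = - gamma4 \<phi>" "x * tconj (gamma4 \<phi>) = - gamma4 \<phi>"
  unfolding gamma1_def gamma2_def gamma3_def gamma4_def conj_mult conj_add conj_gens
  by (simp_all add: algebra_simps normal_form_rules normal_form_rules[THEN extend_right])

lemma delta_eigen:
  "iz * sconj (delta1 \<phi>) = - delta1 \<phi>" "iz * tconj (delta1 \<phi>) = - delta1 \<phi>"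
  "iz * sconj (delta2 \<phi>) = delta2 \<phi>" "iz * tconj (delta2 \<phi>) = - delta2 \<phi>"
  "iz * sconj (delta3 \<phi>) = delta3 \<phi>" "iz * tconj (delta3 \<phi>) = delta3 \<phi>"
  "iz * sconj (delta4 \<phi>) = - delta4 \<phi>" "iz * tconj (delta4 \<phi>) = delta4 \<phi>"
  unfolding delta1_def delta2_def delta3_def delta4_def conj_mult conj_add conj_gens
  by (simp_all add: algebra_simps normal_form_rules normal_form_rules[THEN extend_right])

text \<open>By \<open>gamma_eigen\<close> the \<open>\<gamma>\<^sub>i\<close> represent the four pairs of eigenvalues for the twists \<open>y\<^sup>-\<^sup>1\<close> and \<open>x\<close>.\<close>

lemma c_coordinates:
  assumes "c \<in> LR"
  obtains C1 C2 C3 C4 where "{C1, C2, C3, C4} \<subseteq> skew_center"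
    "C1 * gamma1 \<phi> \<in> LR" "C2 * gamma2 \<phi> \<in> LR" "C3 * gamma3 \<phi> \<in> LR" "C4 * gamma4 \<phi> \<in> LR"
    "Psum C1 C2 C3 C4 = c * t + c * t"
proof -
  have n: "iy * sconj iy = 1" "x * tconj x = 1" "iy * sconj x = x * tconj iy"
    by (simp_all add: conj_gens normal_form_rules)
  obtain f1 f2 f3 f4 where f: "f1 \<in> LR" "f2 \<in> LR" "f3 \<in> LR" "f4 \<in> LR" "c = f1 + f2 + f3 + f4"
    "iy * sconj f1 = - f1" "x * tconj f1 = f1" "iy * sconj f2 = f2" "x * tconj f2 = - f2"
    "iy * sconj f3 = f3" "x * tconj f3 = f3" "iy * sconj f4 = - f4" "x * tconj f4 = - f4"
    using split_by_two_involutions[OF assms LR_closed(11,8) n] by metis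
  note rc = ratio_center[OF _ _ LR_closed(11,8)]
  have Z: "f1 * inverse (gamma1 \<phi>) \<in> skew_center" "f2 * inverse (gamma2 \<phi>) \<in> skew_center"
    "f3 * inverse (gamma3 \<phi>) \<in> skew_center" "f4 * inverse (gamma4 \<phi>) \<in> skew_center"
    by (rule rc; simp add: f gamma_delta_LR gamma_delta_ne_0 gamma_eigen)+
  let ?q = "\<lambda>f g. f * inverse g + f * inverse (g :: 'q)"
  have e: "?q f g * g = f + f" if "g \<noteq> 0" for f g
    using that by (simp add: distrib_right mult.assoc)
  note e' = gamma_delta_ne_0(1-4)[THEN e]
  have zz: "{?q f1 (gamma1 \<phi>), ?q f2 (gamma2 \<phi>), ?q f3 (gamma3 \<phi>), ?q f4 (gamma4 \<phi>)} \<subseteq> skew_center"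
    using Z by (simp add: center_closed(3))
  show ?thesis
  proof (rule that[OF zz])
    show "Psum (?q f1 (gamma1 \<phi>)) (?q f2 (gamma2 \<phi>)) (?q f3 (gamma3 \<phi>)) (?q f4 (gamma4 \<phi>)) = c * t + c * t"
      unfolding Psum_gamma[OF zz] e' f(5) by (simp only: distrib_right add_ac)
  qed (unfold e', (intro LR_closed f)+)
qed

text \<open>Here the twist is \<open>z\<^sup>-\<^sup>1\<close> in both cases, and \<open>\<delta>\<^sub>1\<close>, \<open>\<delta>\<^sub>4\<close> belong to the pairs of eigenvalues of \<open>\<gamma>\<^sub>4\<close>, \<open>\<gamma>\<^sub>1\<close>.\<close>

lemma d_coordinates:
  assumes "d \<in> LR"
  obtains D1 D2 D3 D4 where "{D1, D2, D3, D4} \<subseteq> skew_center"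
    "D1 * delta1 \<phi> \<in> LR" "D2 * delta2 \<phi> \<in> LR" "D3 * delta3 \<phi> \<in> LR" "D4 * delta4 \<phi> \<in> LR"
    "Rsum D1 D2 D3 D4 = d * u + d * u"
proof -
  have n: "iz * sconj iz = 1" "iz * tconj iz = 1" "iz * sconj iz = iz * tconj iz"
    by (simp_all add: conj_gens normal_form_rules)
  obtain g4 g2 g3 g1 where f: "g4 \<in> LR" "g2 \<in> LR" "g3 \<in> LR" "g1 \<in> LR" "d = g4 + g2 + g3 + g1"
    "iz * sconj g4 = - g4" "iz * tconj g4 = g4" "iz * sconj g2 = g2" "iz * tconj g2 = - g2"
    "iz * sconj g3 = g3" "iz * tconj g3 = g3" "iz * sconj g1 = - g1" "iz * tconj g1 = - g1"
    using split_by_two_involutions[OF assms LR_closed(13,13) n] by metis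
  note rc = ratio_center[OF _ _ LR_closed(13,13)]
  have Z: "g1 * inverse (delta1 \<phi>) \<in> skew_center" "g2 * inverse (delta2 \<phi>) \<in> skew_center"
    "g3 * inverse (delta3 \<phi>) \<in> skew_center" "g4 * inverse (delta4 \<phi>) \<in> skew_center"
    by (rule rc; simp add: f gamma_delta_LR gamma_delta_ne_0 delta_eigen)+
  let ?q = "\<lambda>f g. f * inverse g + f * inverse (g :: 'q)"
  let ?r = "\<lambda>f g. f * inverse (g :: 'q)"
  have e: "?q f g * g = f + f" "?r f g * g = f" if "g \<noteq> 0" for f g
    using that by (simp_all add: distrib_right mult.assoc)
  note e' = gamma_delta_ne_0(5-8)[THEN e(1)] gamma_delta_ne_0(5-8)[THEN e(2)]
  have zz: "{?r g1 (delta1 \<phi>), ?q g2 (delta2 \<phi>), ?r g3 (delta3 \<phi>), ?q g4 (delta4 \<phi>)} \<subseteq> skew_center"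
    using Z by (simp add: center_closed(3))
  show ?thesis
  proof (rule that[OF zz])
    show "Rsum (?r g1 (delta1 \<phi>)) (?q g2 (delta2 \<phi>)) (?r g3 (delta3 \<phi>)) (?q g4 (delta4 \<phi>)) = d * u + d * u"
      unfolding Rsum_delta e' f(5)
      by (simp only: distrib_right add_ac)
  qed (unfold e', (intro LR_closed f)+)
qed

section \<open>From a unit to a solution\<close>

lemma center_div:
  assumes "e \<in> skew_center" "d \<in> skew_center" "e \<noteq> (0 :: 'q)"
  obtains q where "q \<in> skew_center" "d = q * e"
proof (rule that)
  show "d * inverse e \<in> skew_center" by (intro center_closed assms)
  show "d = d * inverse e * e" using assms(3) by (simp add: mult.assoc)
qed

lemma four_eq_0: "4 * q = 0 \<Longrightarrow> q = (0 :: 'q)"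
proof -
  assume "4 * q = 0"
  then have "(4 * q) / 2 / 2 = 0" by (simp only: div_0)
  then show "q = 0" unfolding quarter .
qed

lemma one_pm_kx_ne_0: "1 - kx \<noteq> 0" "1 + kx \<noteq> 0"
proof -
  have "(1 - kx) * (1 + kx) = - (wx * wx)"
    unfolding omg_sq[OF kap_center(1)] by (simp add: algebra_simps)
  then have "(1 - kx) * (1 + kx) \<noteq> 0" using omg_ne_0 by simp
  then show "1 - kx \<noteq> 0" "1 + kx \<noteq> 0" by auto
qed

text \<open>The parameters are determined by a non-zero \<open>C\<^sub>i\<close>; the relations then yield the formulas in which that
\<open>C\<^sub>i\<close> does not occur.\<close>

lemma eq_c_exists:
  assumes Z: "{C1, C2, C3, C4, D1, D2, D3, D4} \<subseteq> skew_center"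
    and ne: "C1 \<noteq> 0 \<or> C2 \<noteq> 0 \<or> C3 \<noteq> 0 \<or> C4 \<noteq> 0"
    and r: "C1 * D1 - (1 - kx) * C4 * D4 = 0" "C3 * D3 - (1 - kx) * C2 * D2 = 0"
    "C2 * D1 + (1 + kx) * C3 * D4 = 0" "C4 * D3 + (1 + kx) * C1 * D2 = 0"
  obtains \<alpha> \<beta> where "\<alpha> \<in> skew_center" "\<beta> \<in> skew_center" "eq_c \<phi> C1 C2 C3 C4 D1 D2 D3 D4 \<alpha> \<beta>"
proof -
  have c: "C1 \<in> skew_center" "C2 \<in> skew_center" "C3 \<in> skew_center" "C4 \<in> skew_center"
    "D1 \<in> skew_center" "D2 \<in> skew_center" "D3 \<in> skew_center" "D4 \<in> skew_center"
    using Z by auto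
  have k: "1 - kx \<in> skew_center" "1 + kx \<in> skew_center" by (intro center_closed kap_center)+
  note ac = CL_ac c[THEN CL_mem(2)] k[THEN CL_mem(2)] mult.assoc
  \<comment> \<open>\<open>c4\<close> and \<open>c1\<close> lead to the first set of formulas in (c), \<open>c3\<close> and \<open>c2\<close> to the second one\<close>
  consider (c4) "C4 \<noteq> 0" | (c1) "C4 = 0" "C1 \<noteq> 0" | (c3) "C1 = 0" "C4 = 0" "C3 \<noteq> 0"
    | (c2) "C1 = 0" "C4 = 0" "C3 = 0" "C2 \<noteq> 0" using ne by blast
  then show thesis
  proof cases
    case c4
    obtain \<alpha> where \<alpha>: "\<alpha> \<in> skew_center" "D2 = \<alpha> * C4"
      using center_div[OF c(4,6) c4] by blast
    obtain \<beta> where \<beta>: "\<beta> \<in> skew_center" "D1 = \<beta> * ((1 - kx) * C4)"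
      using center_div[OF center_closed(4)[OF k(1) c(4)] c(5)] c4 one_pm_kx_ne_0 by auto
    note ab = \<alpha>(1)[THEN CL_mem(2)] \<beta>(1)[THEN CL_mem(2)]
    have "(1 - kx) * C4 * D4 = (1 - kx) * C4 * (\<beta> * C1)"
      using r(1) unfolding \<beta>(2) by (simp add: ac ab)
    then have D4: "D4 = \<beta> * C1" using c4 one_pm_kx_ne_0 by simp
    have "C4 * D3 = - ((1 + kx) * C1 * D2)" using r(4) by (simp only: eq_neg_iff_add_eq_0)
    also have "\<dots> = C4 * (- \<alpha> * (1 + kx) * C1)"
      unfolding \<alpha>(2) by (simp add: ac ab)
    finally have D3: "D3 = - \<alpha> * (1 + kx) * C1" by (rule mult_left_cancel[OF c4, THEN iffD1])
    show thesis using that[OF \<alpha>(1) \<beta>(1)] c4 \<alpha>(2) \<beta>(2) D3 D4 unfolding eq_c_def by (simp only: mult.assoc) blast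
  next
    case c1
    obtain \<alpha> where \<alpha>: "\<alpha> \<in> skew_center" "- D3 = \<alpha> * ((1 + kx) * C1)"
      using center_div[OF center_closed(4)[OF k(2) c(1)] center_closed(5)[OF c(7)]] c1 one_pm_kx_ne_0 by auto
    obtain \<beta> where \<beta>: "\<beta> \<in> skew_center" "D4 = \<beta> * C1"
      using center_div[OF c(1,8) c1(2)] by blast
    have "D1 = 0" "D2 = 0" using r c1 one_pm_kx_ne_0 by simp_all
    moreover have "D3 = - \<alpha> * (1 + kx) * C1" using arg_cong[OF \<alpha>(2), of uminus] by (simp add: mult.assoc)
    ultimately show thesis using that[OF \<alpha>(1) \<beta>(1)] c1 \<beta>(2) unfolding eq_c_def by simp
  next
    case c3
    obtain \<alpha> where \<alpha>: "\<alpha> \<in> skew_center" "D2 = \<alpha> * C3"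
      using center_div[OF c(3,6) c3(3)] by blast
    obtain \<beta> where \<beta>: "\<beta> \<in> skew_center" "- D1 = \<beta> * ((1 + kx) * C3)"
      using center_div[OF center_closed(4)[OF k(2) c(3)] center_closed(5)[OF c(5)]] c3 one_pm_kx_ne_0 by auto
    note ab = \<alpha>(1)[THEN CL_mem(2)] \<beta>(1)[THEN CL_mem(2)]
    have D1: "D1 = - \<beta> * (1 + kx) * C3" using arg_cong[OF \<beta>(2), of uminus] by (simp add: mult.assoc)
    have "(1 + kx) * C3 * D4 = - (C2 * D1)" using r(3) by (simp only: eq_neg_iff_add_eq_0 add.commute)
    also have "\<dots> = (1 + kx) * C3 * (\<beta> * C2)"
      unfolding D1 by (simp add: ac ab)
    finally have D4: "D4 = \<beta> * C2" using c3 one_pm_kx_ne_0 by simp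
    have "C3 * D3 = C3 * (\<alpha> * (1 - kx) * C2)"
      using r(2) unfolding \<alpha>(2) by (simp add: ac ab)
    then have D3: "D3 = \<alpha> * (1 - kx) * C2" using c3 by simp
    show thesis using that[OF \<alpha>(1) \<beta>(1)] c3 \<alpha>(2) D1 D3 D4 unfolding eq_c_def by blast
  next
    case c2
    obtain \<alpha> where \<alpha>: "\<alpha> \<in> skew_center" "D3 = \<alpha> * ((1 - kx) * C2)"
      using center_div[OF center_closed(4)[OF k(1) c(2)] c(7)] c2 one_pm_kx_ne_0 by auto
    obtain \<beta> where \<beta>: "\<beta> \<in> skew_center" "D4 = \<beta> * C2"
      using center_div[OF c(2,8) c2(4)] by blast
    have "D1 = 0" "D2 = 0" using r c2 one_pm_kx_ne_0 by simp_all
    then show thesis using that[OF \<alpha>(1) \<beta>(1)] c2 \<alpha>(2) \<beta>(2) unfolding eq_c_def by (simp add: mult.assoc)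
  qed
qed

text \<open>Conjugation by \<open>\<omega>\<^sub>y\<close> fixes \<open>P = c t\<close> and negates \<open>R = d u\<close>. As \<open>B\<^sup>2\<close> is central, \<open>(P - R)\<^sup>2 = (P + R)\<^sup>2\<close>, so
\<open>P R + R P = 0\<close> and \<open>P\<^sup>2 + R\<^sup>2 = B\<^sup>2\<close>. In the latter equation the terms at \<open>\<omega>\<^sub>y\<close> and \<open>\<omega>\<^sub>z\<close> vanish since they are not
invariant under conjugation by \<open>s\<close> and \<open>t\<close>.\<close>

lemma solution_of_odd_part:
  assumes A: "A \<in> skew_center" "A \<in> range \<phi>" and cd: "c \<in> LR" "d \<in> LR" "c \<noteq> 0"
    and BB: "(c * t + d * u) * (c * t + d * u) = (1 - A * A) * (wx * wx)"
  shows "\<exists>A C1 C2 C3 C4 D1 D2 D3 D4 \<alpha> \<beta>.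
       {A, C1, C2, C3, C4, D1, D2, D3, D4, \<alpha>, \<beta>} \<subseteq> (skew_center :: 'q set) \<and>
       (A, C1, C2, C3, C4, D1, D2, D3, D4, \<alpha>, \<beta>) \<noteq> (1, 0, 0, 0, 0, 0, 0, 0, 0, 0, 0) \<and>
       (A, C1, C2, C3, C4, D1, D2, D3, D4, \<alpha>, \<beta>) \<noteq> (- 1, 0, 0, 0, 0, 0, 0, 0, 0, 0, 0) \<and>
       eq_a \<phi> A C1 C2 C3 C4 D1 D2 D3 D4 \<and>
       eq_b \<phi> C1 C2 C3 C4 \<and>
       eq_c \<phi> C1 C2 C3 C4 D1 D2 D3 D4 \<alpha> \<beta> \<and>
       A \<in> kappa_xi_ring \<phi> \<and>
       C1 * gamma1 \<phi> \<in> laurent_ring \<phi> \<and> C2 * gamma2 \<phi> \<in> laurent_ring \<phi> \<and>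
       C3 * gamma3 \<phi> \<in> laurent_ring \<phi> \<and> C4 * gamma4 \<phi> \<in> laurent_ring \<phi> \<and>
       D1 * delta1 \<phi> \<in> laurent_ring \<phi> \<and> D2 * delta2 \<phi> \<in> laurent_ring \<phi> \<and>
       D3 * delta3 \<phi> \<in> laurent_ring \<phi> \<and> D4 * delta4 \<phi> \<in> laurent_ring \<phi>"
proof -
  obtain C1 C2 C3 C4 where C: "{C1, C2, C3, C4} \<subseteq> skew_center"
    "C1 * gamma1 \<phi> \<in> LR" "C2 * gamma2 \<phi> \<in> LR" "C3 * gamma3 \<phi> \<in> LR" "C4 * gamma4 \<phi> \<in> LR"
    "Psum C1 C2 C3 C4 = c * t + c * t" using c_coordinates[OF cd(1)] by blast
  obtain D1 D2 D3 D4 where D: "{D1, D2, D3, D4} \<subseteq> skew_center"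
    "D1 * delta1 \<phi> \<in> LR" "D2 * delta2 \<phi> \<in> LR" "D3 * delta3 \<phi> \<in> LR" "D4 * delta4 \<phi> \<in> LR"
    "Rsum D1 D2 D3 D4 = d * u + d * u" using d_coordinates[OF cd(2)] by blast
  have CD: "{C1, C2, C3, C4, D1, D2, D3, D4} \<subseteq> skew_center" using C(1) D(1) by auto
  define P where "P = c * t"
  define R where "R = d * u"
  define N where "N = (1 - A * A) * (wx * wx)"
  have NZ: "N \<in> skew_center" unfolding N_def by (intro center_closed A omg_sq_center)
  have plus: "(P + R) * (P + R) = N" using BB by (simp only: P_def R_def N_def)
  have wPR: "wy * (P + R) = (P - R) * wy" unfolding P_def R_def by (rule LR_tu_wx(2)[OF cd(1,2)])
  have "(P - R) * (P - R) * wy = (P - R) * (wy * (P + R))"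
    by (simp only: mult.assoc wPR)
  also have "\<dots> = (P - R) * wy * (P + R)" by (simp only: mult.assoc)
  also have "\<dots> = wy * ((P + R) * (P + R))" unfolding wPR[symmetric] by (simp only: mult.assoc)
  also have "\<dots> = N * wy" unfolding plus by (rule center_comm[OF NZ, symmetric])
  finally have minus: "(P - R) * (P - R) = N" using omg_ne_0 by simp
  have e1: "(P * P + R * R) + anti P R = N" using plus by (simp only: anti_def distrib_left distrib_right add_ac)
  have e2: "(P * P + R * R) - anti P R = N"
    using minus by (simp add: anti_def left_diff_distrib right_diff_distrib algebra_simps)
  have "anti P R + anti P R = 0" using e1 e2 by (metis add_diff_cancel_left' diff_add_cancel add_diff_eq diff_self diff_diff_eq2)
  then have an: "anti P R = 0" by (simp only: double_eq_0)
  have PPRR: "P * P + R * R = N" using e1 an by simp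
  have "anti (Psum C1 C2 C3 C4) (Rsum D1 D2 D3 D4) = 4 * anti P R"
    unfolding C(6) D(6) P_def[symmetric] R_def[symmetric] anti_add mult_4 by (simp only: add.assoc)
  then have "4 * ((C1 * D1 - (1 - kx) * C4 * D4) * W1 + (C3 * D3 - (1 - kx) * C2 * D2) * W2
       + (C2 * D1 + (1 + kx) * C3 * D4) * W3 + (C4 * D3 + (1 + kx) * C1 * D2) * W4) = 0"
    unfolding anti_PR[OF CD] an by simp
  then have W0: "(C1 * D1 - (1 - kx) * C4 * D4) * W1 + (C3 * D3 - (1 - kx) * C2 * D2) * W2
       + (C2 * D1 + (1 + kx) * C3 * D4) * W3 + (C4 * D3 + (1 + kx) * C1 * D2) * W4 = 0"
    by (rule four_eq_0)
  have "{C1 * D1 - (1 - kx) * C4 * D4, C3 * D3 - (1 - kx) * C2 * D2, C2 * D1 + (1 + kx) * C3 * D4,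
      C4 * D3 + (1 + kx) * C1 * D2} \<subseteq> skew_center"
    using CD by (auto intro!: center_closed kap_center)
  note rel = W_center_independent[OF this W0]
  define F where "F = C1^2 * (kx + 1) * (ky - 1) - C2^2 * (kx - 1) * (ky + 1)
     + C3^2 * (kx + 1) * (ky + 1) - C4^2 * (kx - 1) * (ky - 1)"
  define G where "G = 2 * D1^2 * (kz - 1) - 2 * D2^2 * wx^2 * (kz + 1) + 2 * D3^2 * (kz + 1) - 2 * D4^2 * wx^2 * (kz - 1)"
  define b where "b = (kx - 1) * C2 * C4 - (kx + 1) * C1 * C3"
  define e where "e = D1 * D3 - wx^2 * D2 * D4"
  have c: "C1 \<in> skew_center" "C2 \<in> skew_center" "C3 \<in> skew_center" "C4 \<in> skew_center"
    "D1 \<in> skew_center" "D2 \<in> skew_center" "D3 \<in> skew_center" "D4 \<in> skew_center"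
    using CD by auto
  have two: "(2::'q) \<in> skew_center" using center_closed(3)[OF center_closed(2) center_closed(2)] by simp
  have be: "b \<in> skew_center" "e \<in> skew_center" "F \<in> skew_center" "G \<in> skew_center"
    unfolding b_def e_def F_def G_def power2_eq_square
    by (intro center_closed two kap_center omg_sq_center c)+
  have "4 * ((F - 2 * b * wy) + (G + 4 * e * wz)) = 4 * N"
  proof -
    have "4 * (F - 2 * b * wy) = (P + P) * (P + P)"
      using P_sq[OF C(1)] unfolding C(6) P_def[symmetric] F_def[symmetric] b_def[symmetric] by simp
    moreover have "4 * (G + 4 * e * wz) = (R + R) * (R + R)"
      using R_sq[OF D(1)] unfolding D(6) R_def[symmetric] G_def[symmetric] e_def[symmetric] by simp
    moreover have "(P + P) * (P + P) + (R + R) * (R + R) = 4 * (P * P + R * R)"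
      by (simp add: mult_4 distrib_left distrib_right add_ac)
    ultimately show ?thesis unfolding PPRR by (simp add: distrib_left)
  qed
  then have sum: "(F - 2 * b * wy) + (G + 4 * e * wz) = N" by (metis quarter)
  define h where "h = N - (F + G)"
  have hZ: "h \<in> skew_center" unfolding h_def by (intro center_closed NZ be)
  have h: "h = 4 * e * wz - 2 * b * wy" unfolding h_def sum[symmetric] by (simp add: algebra_simps)
  have b2: "2 * b \<in> skew_center" "4 * e \<in> skew_center"
  proof -
    show "2 * b \<in> skew_center" by (intro center_closed two be)
    have "4 * e = 2 * (2 * e)" by (simp add: mult_2 mult_4 add.assoc)
    then show "4 * e \<in> skew_center" using center_closed(4)[OF two center_closed(4)[OF two be(2)]] by simp
  qed
  have "s * h = - (h * s)"
    unfolding h right_diff_distrib left_diff_distrib center_left_comm[OF b2(1)] center_left_comm[OF b2(2)] omg_s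
    by (simp add: mult.assoc)
  moreover have "s * h = h * s" by (rule center_comm[OF hZ, symmetric])
  ultimately have "h * s + h * s = 0" by (metis eq_neg_iff_add_eq_0)
  then have h0: "h = 0" by (simp only: double_eq_0) simp
  then have h1: "4 * e * wz = 2 * b * wy" using h by simp
  have "t * (4 * e * wz) = - (4 * e * wz * t)" "t * (2 * b * wy) = 2 * b * wy * t"
    unfolding center_left_comm[OF b2(1)] center_left_comm[OF b2(2)] omg_t by (simp_all add: mult.assoc)
  then have "2 * b * wy * t = - (2 * b * wy * t)" unfolding h1 by simp
  then have "2 * b * wy * t + 2 * b * wy * t = 0" by (simp only: eq_neg_iff_add_eq_0)
  then have "2 * b * wy * t = 0" by (simp only: double_eq_0)
  then have b0: "b = 0" using omg_ne_0 two_ne_0 by simp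
  have eqb: "eq_b \<phi> C1 C2 C3 C4" using b0 by (simp add: eq_b_def b_def)
  have "F + G = N" using h0 unfolding h_def by simp
  then have "(A^2 - 1) * wx^2 + (F + G) = 0"
    unfolding N_def power2_eq_square by (simp add: left_diff_distrib)
  then have eqa: "eq_a \<phi> A C1 C2 C3 C4 D1 D2 D3 D4"
    unfolding eq_a_def F_def G_def by (simp only: add_diff_eq add.assoc[symmetric])
  have C0: "C1 \<noteq> 0 \<or> C2 \<noteq> 0 \<or> C3 \<noteq> 0 \<or> C4 \<noteq> 0"
  proof (rule ccontr)
    assume "\<not> ?thesis"
    then have "c * t + c * t = 0" using C(6) by (simp add: Psum_def)
    then have "c * t = 0" by (simp only: double_eq_0)
    then show False using cd(3) by simp
  qed
  obtain \<alpha> \<beta> where ab: "\<alpha> \<in> skew_center" "\<beta> \<in> skew_center" "eq_c \<phi> C1 C2 C3 C4 D1 D2 D3 D4 \<alpha> \<beta>"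
    using eq_c_exists[OF CD C0] rel by blast
  show ?thesis
  proof (intro exI conjI)
    show "{A, C1, C2, C3, C4, D1, D2, D3, D4, \<alpha>, \<beta>} \<subseteq> skew_center"
      using CD A(1) ab(1,2) by simp
    show "(A, C1, C2, C3, C4, D1, D2, D3, D4, \<alpha>, \<beta>) \<noteq> (1, 0, 0, 0, 0, 0, 0, 0, 0, 0, 0)"
      "(A, C1, C2, C3, C4, D1, D2, D3, D4, \<alpha>, \<beta>) \<noteq> (- 1, 0, 0, 0, 0, 0, 0, 0, 0, 0, 0)"
      using C0 by blast+
    show "A \<in> KR" by (rule central_phi_KR[OF A(2,1)])
  qed (fact eqa eqb ab(3) C(2-5) D(2-5))+
qed

lemma tu_swap_central:
  assumes "\<phi> q \<in> skew_center"
  shows "\<phi> (tu_swap_ring q) \<in> skew_center"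
proof (rule comm_phi_center)
  fix r
  have "q * tu_swap_ring r = tu_swap_ring r * q"
    using center_comm[OF assms, of "\<phi> (tu_swap_ring r)"] by (simp only: phi_eq_iff flip: phi_mult)
  then have "tu_swap_ring (q * tu_swap_ring r) = tu_swap_ring (tu_swap_ring r * q)" by simp
  then have "r * tu_swap_ring q = tu_swap_ring q * r" by (simp only: tu_swap_ring_mult tu_swap_ring_involution)
  then show "comm (\<phi> r) (\<phi> (tu_swap_ring q))" by (simp only: comm_def flip: phi_mult)
qed

lemma phi_odd_decomp:
  assumes "B \<in> range \<phi>" "B * wx = - (wx * B)"
  obtains c d where "c \<in> LR" "d \<in> LR" "B = c * t + d * u"
proof -
  obtain a b c d where f: "a \<in> LR" "b \<in> LR" "c \<in> LR" "d \<in> LR" "B = a + b * s + c * t + d * u"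
    using assms(1) phi_decomp by blast
  have w: "a * wx = wx * a" "b * wx = wx * b"
    using LR_comm[OF f(1) kap_omg_LR(4)] LR_comm[OF f(2) kap_omg_LR(4)] by (simp_all add: comm_def)
  have ev: "(a + b * s) * wx = wx * (a + b * s)"
    by (simp add: distrib_left distrib_right mult.assoc omg_s w)
       (simp add: w flip: mult.assoc)
  have od: "(c * t + d * u) * wx = - (wx * (c * t + d * u))" by (rule LR_tu_wx(1)[OF f(3,4)])
  have B: "B = (a + b * s) + (c * t + d * u)" by (simp add: f(5) add.assoc)
  have "(a + b * s) * wx = - (wx * (a + b * s))"
    using assms(2) unfolding B distrib_left distrib_right[of "a + b * s"] od by simp
  then have "a + b * s = 0" using even_and_odd_imp_0[of "a + b * s"] ev by simp
  then show ?thesis using that[OF f(3,4)] B by simp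
qed

text \<open>If \<open>c = 0\<close>, then \<open>B = d u\<close> commutes with \<open>z\<close>. Exchanging \<open>t\<close> and \<open>u\<close> maps \<open>\<omega>\<close> to \<open>-\<omega>\<close> and \<open>z\<close> to \<open>y\<close>, so it yields
another odd \<open>B'\<close> with the required square that commutes with \<open>y\<close>. As \<open>u\<close> inverts \<open>y\<close>, the component of \<open>B'\<close> at
\<open>u\<close> is zero, and the one at \<open>t\<close> is not.\<close>

lemma odd_part_with_t_component:
  assumes A: "A \<in> skew_center" "A \<in> range \<phi>" and B: "B \<in> range \<phi>" "B * wx = - (wx * B)" "B \<noteq> 0"
    "B * B = (1 - A * A) * (wx * wx)"
  obtains A' c d where "A' \<in> skew_center" "A' \<in> range \<phi>" "c \<in> LR" "d \<in> LR" "c \<noteq> 0"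
    "(c * t + d * u) * (c * t + d * u) = (1 - A' * A') * (wx * wx)"
proof -
  obtain c d where cd: "c \<in> LR" "d \<in> LR" "B = c * t + d * u" using phi_odd_decomp[OF B(1,2)] .
  show thesis
  proof (cases "c = 0")
    case False
    then show thesis using that[OF A cd(1,2) False] B(4) cd(3) by simp
  next
    case True
    obtain p q where p: "B = \<phi> p" and q: "A = \<phi> q" using A B by blast
    define v :: "'k prom_ring" where "v = Poly_Mapping.single gx 1 - Poly_Mapping.single (- gx) 1"
    define z' :: "'k prom_ring" where "z' = Poly_Mapping.single gz 1"
    define y' :: "'k prom_ring" where "y' = Poly_Mapping.single gy 1"
    have v: "\<phi> v = wx + wx"
      unfolding v_def phi_diff grp_def[symmetric] grp_minus by (rule omg_double[symmetric])
    have tm: "tu_swap_ring (- a) = - tu_swap_ring a" for a :: "'k prom_ring"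
      using tu_swap_ring_add[of a "- a"] by (simp add: tu_swap_ring_0 eq_neg_iff_add_eq_0 add.commute)
    have t1: "tu_swap_ring (1 :: 'k prom_ring) = 1"
      using tu_swap_ring_single[of 0 "1 :: 'k"] by (simp add: tu_swap_0)
    have td: "tu_swap_ring (a - b) = tu_swap_ring a - tu_swap_ring b" for a b :: "'k prom_ring"
      using tu_swap_ring_add[of a "- b"] by (simp add: tm)
    have tv: "tu_swap_ring v = - v"
      unfolding v_def td tu_swap_ring_single tu_swap_minus tu_swap_gx by simp
    have tz: "tu_swap_ring z' = y'"
      unfolding z'_def y'_def tu_swap_ring_single tu_swap_gz ..
    \<comment> \<open>\<open>v\<close> represents \<open>2 \<omega>\<close>, which avoids the factor 1/2 in the group ring\<close>
    have pv: "p * v = - (v * p)"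
    proof -
      have "\<phi> (p * v) = \<phi> (- (v * p))"
        unfolding phi_mult phi_minus p[symmetric] v by (simp add: distrib_left distrib_right B(2))
      then show ?thesis by (simp only: phi_eq_iff)
    qed
    have pp: "(p + p) * (p + p) = (1 - q * q) * (v * v)"
    proof -
      have "\<phi> ((p + p) * (p + p)) = \<phi> ((1 - q * q) * (v * v))"
        unfolding phi_mult phi_diff phi_add phi_1 p[symmetric] q[symmetric] v
        by (simp add: distrib_left B(4) distrib_right)
      then show ?thesis by (simp only: phi_eq_iff)
    qed
    have dz: "d * z = z * d" using LR_comm_gen[OF cd(2)] by (simp add: comm_def)
    have "B * z = z * B"
      unfolding cd(3) True using dz by (simp add: mult.assoc grp_relations(4)) (simp add: grp_relations(4) flip: mult.assoc)
    then have pz: "p * z' = z' * p"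
      unfolding z'_def p grp_def phi_mult[symmetric] by (simp only: phi_eq_iff)
    define B' where "B' = \<phi> (tu_swap_ring p)"
    define A' where "A' = \<phi> (tu_swap_ring q)"
    have A': "A' \<in> skew_center" "A' \<in> range \<phi>"
      unfolding A'_def using tu_swap_central A q by auto
    have B'w: "B' * wx = - (wx * B')"
    proof -
      have "tu_swap_ring p * (- v) = - (- v * tu_swap_ring p)"
        using arg_cong[OF pv, of tu_swap_ring] by (simp only: tu_swap_ring_mult tm tv)
      then have "- (tu_swap_ring p * v) = v * tu_swap_ring p" by simp
      then have "tu_swap_ring p * v = - (v * tu_swap_ring p)"
        by (rule minus_equation_iff[THEN iffD1, symmetric])
      then have "\<phi> (tu_swap_ring p * v) = \<phi> (- (v * tu_swap_ring p))" by (simp only:)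
      then have "B' * (wx + wx) = - ((wx + wx) * B')"
        unfolding phi_mult phi_minus B'_def[symmetric] v .
      then have "B' * wx + B' * wx = - (wx * B') + - (wx * B')"
        by (simp add: distrib_left distrib_right)
      then show ?thesis by (simp only: double_eq_iff)
    qed
    have "tu_swap_ring ((p + p) * (p + p)) = tu_swap_ring ((1 - q * q) * (v * v))" by (simp only: pp)
    then have "\<phi> ((tu_swap_ring p + tu_swap_ring p) * (tu_swap_ring p + tu_swap_ring p)) =
        \<phi> ((1 - tu_swap_ring q * tu_swap_ring q) * (- v * - v))"
      by (simp only: tu_swap_ring_mult tu_swap_ring_add td t1 tv)
    then have "(B' + B') * (B' + B') = (1 - A' * A') * ((wx + wx) * (wx + wx))"
      unfolding minus_mult_minus phi_mult phi_add phi_diff phi_1 A'_def[symmetric] B'_def[symmetric] v .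
    then have "(B' * B' + B' * B') + (B' * B' + B' * B') = ((1 - A' * A') * (wx * wx) + (1 - A' * A') * (wx * wx))
      + ((1 - A' * A') * (wx * wx) + (1 - A' * A') * (wx * wx))"
      by (simp only: distrib_left distrib_right)
    then have B'B': "B' * B' = (1 - A' * A') * (wx * wx)" by (simp only: double_eq_iff)
    have B'y: "B' * y = y * B'"
    proof -
      have "tu_swap_ring p * y' = y' * tu_swap_ring p"
        using arg_cong[OF pz, of tu_swap_ring] by (simp only: tu_swap_ring_mult tz)
      then have "\<phi> (tu_swap_ring p * y') = \<phi> (y' * tu_swap_ring p)" by (simp only:)
      then show ?thesis unfolding phi_mult B'_def[symmetric] y'_def grp_def[symmetric] .
    qed
    obtain c' d' where cd': "c' \<in> LR" "d' \<in> LR" "B' = c' * t + d' * u"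
      using phi_odd_decomp[of B'] B'w unfolding B'_def by blast
    have "B' \<noteq> 0"
    proof
      assume "B' = 0"
      then have "tu_swap_ring p = 0" unfolding B'_def using phi_eq_iff[of _ 0] by (simp add: phi_0)
      then have "tu_swap_ring (tu_swap_ring p) = tu_swap_ring 0" by (simp only:)
      then have "p = 0" by (simp only: tu_swap_ring_involution tu_swap_ring_0)
      then show False using p B(3) phi_0 by simp
    qed
    have "c' \<noteq> 0"
    proof
      assume c': "c' = 0"
      have dy: "y * d' = d' * y" using LR_comm_gen[OF cd'(2)] by (simp add: comm_def)
      have uy: "u * y = iy * u" by (simp add: grp_relations(3) mult.assoc normal_form_rules normal_form_rules[THEN extend_right])
      have "d' * iy * u = d' * y * u"
        using B'y unfolding cd'(3) c' using dy uy by (simp add: mult.assoc) (simp flip: mult.assoc)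
      then have "d' * iy = d' * y" by simp
      moreover have "d' \<noteq> 0" using \<open>B' \<noteq> 0\<close> cd'(3) c' by auto
      ultimately have "iy = y" by simp
      then have "y - iy = 0" by simp
      then show False unfolding omg_double[symmetric] double_eq_0 using omg_ne_0 by simp
    qed
    then show thesis using that[OF A' cd'(1,2)] B'B' cd'(3) by simp
  qed
qed

text \<open>The resulting pair consists of \<open>A = 1 + 2 Q\<^sup>2\<close> and \<open>B = 2 \<omega> (E + \<kappa>\<^sub>x) Q\<close>, where \<open>E\<close> and \<open>Q\<close> are the even and the odd
part of the conjugate of \<open>\<omega>\<close>.\<close>

lemma odd_part_of_unit:
  assumes UV: "U * V = 1" "V * U = 1" and ty: "type2 \<phi> U"
  obtains A B where "A \<in> skew_center" "A \<in> range \<phi>" "B \<in> range \<phi>" "B * wx = - (wx * B)" "B \<noteq> 0"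
    "B * B = (1 - A * A) * (wx * wx)"
proof -
  have pUV: "\<phi> U * \<phi> V = 1" "\<phi> V * \<phi> U = 1" using UV by (simp_all add: phi_1 flip: phi_mult)
  have iU: "inverse (\<phi> U) = \<phi> V" by (rule inverse_unique[OF pUV(1)])
  define T where "T = conj_by wx (\<phi> U)"
  have T: "T = \<phi> U * wx * \<phi> V" unfolding T_def conj_by_def iU ..
  have wr: "wx \<in> range \<phi>" by (rule LR_phi[OF kap_omg_LR(4)])
  have "T \<in> range \<phi>" unfolding T by (intro range_phi_closed wr rangeI)
  then obtain a b c d where l: "a \<in> LR" "b \<in> LR" "c \<in> LR" "d \<in> LR" and Tp: "T = a + b * s + c * t + d * u"
    using phi_decomp by blast
  define E where "E = a + b * s"
  define Q where "Q = c * t + d * u"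
  have TEQ: "T = E + Q" unfolding E_def Q_def Tp by (simp only: add.assoc)
  have w: "a * wx = wx * a" "b * wx = wx * b"
    using LR_comm[OF l(1) kap_omg_LR(4)] LR_comm[OF l(2) kap_omg_LR(4)] by (simp_all add: comm_def)
  have Ew: "E * wx = wx * E" unfolding E_def
    by (simp add: distrib_left distrib_right mult.assoc omg_s w)
       (simp add: w flip: mult.assoc)
  have Qw: "Q * wx = - (wx * Q)" unfolding Q_def by (rule LR_tu_wx(1)[OF l(3,4)])
  have Er: "E \<in> range \<phi>" "Q \<in> range \<phi>"
    unfolding E_def Q_def by (intro range_phi_closed LR_phi l)+
  have "ext_degree skew_center (center_adjoin Q) = 2"
    using ty omega_parts(2)[OF TEQ Ew Qw] unfolding type2_def omega_degree_def T_def[symmetric] by simp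
  note d2 = ext_degree_2D[OF this]
  have Q0: "Q \<noteq> 0" using d2(1) center_closed(1) by auto
  obtain f g where fg: "f \<in> skew_center" "g \<in> skew_center" "Q * Q = f * Q + g" using d2(2) by blast
  have QQw: "Q * Q * wx = wx * (Q * Q)" by (simp add: mult.assoc Qw) (simp add: Qw flip: mult.assoc)
  \<comment> \<open>in \<open>Q\<^sup>2 = f Q + g\<close> the term \<open>f Q\<close> is odd, and even because the other two terms are; so it vanishes\<close>
  have "(f * Q) * wx = - (wx * (f * Q))" by (simp add: mult.assoc Qw center_left_comm[OF fg(1)])
  moreover have "(f * Q) * wx = wx * (f * Q)"
  proof -
    have "(f * Q + g) * wx = wx * (f * Q + g)" using QQw unfolding fg(3) .
    then show ?thesis using center_comm[OF fg(2), of wx] by (simp add: distrib_left distrib_right)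
  qed
  ultimately have "f * Q = 0" using even_and_odd_imp_0[of "f * Q"] by simp
  then have "Q * Q = g" unfolding fg(3) by (simp only: add_0)
  then have QQ: "Q * Q \<in> skew_center" using fg(2) by (simp only:)
  have TT: "T * T = wx * wx"
  proof -
    have "T * T = \<phi> U * wx * (\<phi> V * \<phi> U) * wx * \<phi> V" unfolding T by (simp only: mult.assoc)
    also have "\<dots> = \<phi> U * (wx * wx) * \<phi> V" unfolding pUV(2) by (simp only: mult.assoc mult_1_left mult_1_right)
    also have "\<dots> = wx * wx * (\<phi> U * \<phi> V)"
      unfolding center_comm[OF omg_sq_center, of "\<phi> U", symmetric] by (simp only: mult.assoc)
    finally show ?thesis by (simp add: pUV)
  qed
  define N where "N = E * Q + Q * E"
  have split: "E * E + Q * Q + N = wx * wx"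
    using TT unfolding TEQ N_def by (simp only: distrib_left distrib_right add_ac)
  \<comment> \<open>\<open>N = \<omega>\<^sup>2 - E\<^sup>2 - Q\<^sup>2\<close> is even, but as a sum of products of an even and an odd element it is odd\<close>
  have "N = 0"
  proof (rule even_and_odd_imp_0)
    have EEw: "E * E * wx = wx * (E * E)" by (simp add: mult.assoc Ew) (simp add: Ew flip: mult.assoc)
    have "N = wx * wx - E * E - Q * Q" using split by (simp add: algebra_simps)
    then show "wx * N = N * wx"
      using EEw QQw by (simp add: right_diff_distrib left_diff_distrib mult.assoc)
    show "N * wx = - (wx * N)"
      unfolding N_def by (simp add: distrib_left distrib_right mult.assoc Ew Qw)
        (simp add: Ew Qw flip: mult.assoc)
  qed
  then have EQ: "Q * E = - (E * Q)" and EE: "E * E = wx * wx - Q * Q"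
    using split unfolding N_def by (simp_all add: algebra_simps eq_neg_iff_add_eq_0)
  define A where "A = 1 + (Q * Q + Q * Q)"
  define M where "M = wx * (E + kx) * Q"
  have M0: "M \<noteq> 0"
  proof
    assume "M = 0"
    then have "E + kx = 0" using Q0 omg_ne_0 by (simp add: M_def)
    then have "E = - kx" by (simp only: eq_neg_iff_add_eq_0)
    then have "- (Q * kx) = kx * Q" using EQ by simp
    then have "kx * Q + kx * Q = 0" using center_comm[OF kap_center(1), of Q] by (metis eq_neg_iff_add_eq_0 add.commute)
    then have "kx * Q = 0" by (simp only: double_eq_0)
    then show False using Q0 kx_ne_0 by simp
  qed
  have Mr: "M \<in> range \<phi>"
    unfolding M_def by (intro range_phi_closed wr Er LR_phi kap_omg_LR)
  have Ekw: "(E + kx) * wx = wx * (E + kx)"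
    using center_comm[OF kap_center(1), of wx] by (simp add: distrib_left distrib_right Ew)
  have Mw: "M * wx = - (wx * M)"
    unfolding M_def by (simp only: mult.assoc Qw mult_minus_right) (simp only: Ekw flip: mult.assoc)
  have MM: "M * M = - (wx * wx * ((1 + Q * Q) * (Q * Q)))"
  proof -
    have QE: "Q * (E + kx) = (kx - E) * Q"
      using center_comm[OF kap_center(1), of Q] by (simp add: distrib_left left_diff_distrib EQ)
    have "M * M = wx * (E + kx) * (Q * wx) * (E + kx) * Q" unfolding M_def by (simp only: mult.assoc)
    also have "\<dots> = - (wx * ((E + kx) * wx) * (Q * (E + kx)) * Q)"
      unfolding Qw by (simp add: mult.assoc)
    also have "\<dots> = - (wx * wx * ((E + kx) * (kx - E)) * (Q * Q))"
      unfolding Ekw QE by (simp only: mult.assoc)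
    also have "(E + kx) * (kx - E) = kx * kx - E * E"
      using center_comm[OF kap_center(1), of E] by (simp add: distrib_right right_diff_distrib algebra_simps)
    also have "\<dots> = 1 + Q * Q" unfolding EE omg_sq[OF kap_center(1)] by (simp add: algebra_simps)
    finally show ?thesis by (simp only: mult.assoc)
  qed
  show thesis
  proof (rule that)
    show "A \<in> skew_center" unfolding A_def by (intro center_closed QQ)
    show "A \<in> range \<phi>" unfolding A_def by (intro range_phi_closed Er)
    show "M + M \<in> range \<phi>" by (intro range_phi_closed Mr)
    show "(M + M) * wx = - (wx * (M + M))" by (simp add: distrib_left distrib_right Mw)
    show "M + M \<noteq> 0" using M0 by (simp only: double_eq_0) simp
    have q: "1 + Q * Q \<in> skew_center" by (intro center_closed QQ)
    have "1 - A * A = - ((1 + Q * Q) * (Q * Q) + (1 + Q * Q) * (Q * Q) + ((1 + Q * Q) * (Q * Q) + (1 + Q * Q) * (Q * Q)))"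
      unfolding A_def by (simp add: distrib_left distrib_right)
    moreover have "(M + M) * (M + M) = (M * M + M * M) + (M * M + M * M)"
      by (simp only: distrib_left distrib_right)
    moreover have "wx * wx * ((1 + Q * Q) * (Q * Q)) = (1 + Q * Q) * (Q * Q) * (wx * wx)"
      by (rule center_comm[OF omg_sq_center])
    ultimately show "(M + M) * (M + M) = (1 - A * A) * (wx * wx)"
      unfolding MM by (simp only: mult_minus_left distrib_right minus_add_distrib add_ac)
  qed
qed

end

theorem theorem5p24:
  fixes \<phi> :: "'k::field prom_ring \<Rightarrow> 'q::division_ring"
  assumes "CHAR('k) \<noteq> 2"
    and "ore_fraction_field \<phi>"
  shows "(\<exists>U :: 'k prom_ring. nontrivial_unit U \<and> type2 \<phi> U) \<longleftrightarrow>
    (\<exists>A C1 C2 C3 C4 D1 D2 D3 D4 \<alpha> \<beta>.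
       {A, C1, C2, C3, C4, D1, D2, D3, D4, \<alpha>, \<beta>} \<subseteq> (skew_center :: 'q set) \<and>
       (A, C1, C2, C3, C4, D1, D2, D3, D4, \<alpha>, \<beta>) \<noteq> (1, 0, 0, 0, 0, 0, 0, 0, 0, 0, 0) \<and>
       (A, C1, C2, C3, C4, D1, D2, D3, D4, \<alpha>, \<beta>) \<noteq> (- 1, 0, 0, 0, 0, 0, 0, 0, 0, 0, 0) \<and>
       eq_a \<phi> A C1 C2 C3 C4 D1 D2 D3 D4 \<and>
       eq_b \<phi> C1 C2 C3 C4 \<and>
       eq_c \<phi> C1 C2 C3 C4 D1 D2 D3 D4 \<alpha> \<beta> \<and>
       A \<in> kappa_xi_ring \<phi> \<and>
       C1 * gamma1 \<phi> \<in> laurent_ring \<phi> \<and> C2 * gamma2 \<phi> \<in> laurent_ring \<phi> \<and>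
       C3 * gamma3 \<phi> \<in> laurent_ring \<phi> \<and> C4 * gamma4 \<phi> \<in> laurent_ring \<phi> \<and>
       D1 * delta1 \<phi> \<in> laurent_ring \<phi> \<and> D2 * delta2 \<phi> \<in> laurent_ring \<phi> \<and>
       D3 * delta3 \<phi> \<in> laurent_ring \<phi> \<and> D4 * delta4 \<phi> \<in> laurent_ring \<phi>)"
  (is "?unit \<longleftrightarrow> ?solution")
proof
  interpret promislow_ore \<phi> using assms by unfold_locales
  assume ?unit
  then obtain U V where "U * V = 1" "V * U = 1" "type2 \<phi> U"
    unfolding nontrivial_unit_def by blast
  from odd_part_of_unit[OF this] obtain A B where AB: "A \<in> skew_center" "A \<in> range \<phi>" "B \<in> range \<phi>"
    "B * omg \<phi> gx = - (omg \<phi> gx * B)" "B \<noteq> 0" "B * B = (1 - A * A) * (omg \<phi> gx * omg \<phi> gx)" .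
  from odd_part_with_t_component[OF AB] obtain A' c d where "A' \<in> skew_center" "A' \<in> range \<phi>"
    "c \<in> laurent_ring \<phi>" "d \<in> laurent_ring \<phi>" "c \<noteq> 0"
    "(c * grp \<phi> gt + d * grp \<phi> gu) * (c * grp \<phi> gt + d * grp \<phi> gu) = (1 - A' * A') * (omg \<phi> gx * omg \<phi> gx)" .
  then show ?solution by (rule solution_of_odd_part)
next
  interpret promislow_ore \<phi> using assms by unfold_locales
  assume ?solution
  then show ?unit by (elim exE conjE) (rule unit_of_solution)
qed

end
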